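(* Let $\alpha>0$, let $\mathcal{H}_\alpha$ be the $\alpha$-hyperbolic ensemble on the unit disc $\mathbb{D}$, and for $R>0$ put $C_R^{(\alpha)}=\alpha e^R/8$. Then for every bounded measurable and compactly supported function $f:\mathbb{R}\to\mathbb{R}$, $$\frac{1}{\sqrt{C_R^{(\alpha)}}}\sum_{z\in\mathcal{H}_{\alpha}}f\big(|z|_{\mathrm{h}}-R\big)-2\sqrt{C_R^{(\alpha)}}\int_{\mathbb{R}}f(x)e^{x}\,\mathrm{d}x\ \xrightarrow[R\to+\infty]{\mathrm{law}}\ \mathcal{N}\big(0,V_f^{(\alpha)}\big),$$ where $$V_f^{(\alpha)}=\frac{1}{B(\alpha,\alpha+1)}\int_{\mathbb{R}^2}\big[f(x)-f(y)\big]^2\frac{e^{(\alpha+1)(x+y)}}{\left(e^{x}+e^{y}\right)^{2\alpha+1}}\,\mathrm{d}x\,\mathrm{d}y .$$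
   Context: Determinantal point processes: let $X$ be a locally compact Polish space with a Radon measure $\mu$, and $K:X\times X\to\mathbb{C}$ measurable. A simple point process $\mathscr{X}$ on $X$ (a random locally finite configuration with no multiple points, identified with a random discrete subset; $\mathscr{X}(\Delta)$ is the number of points in $\Delta$) is determinantal with kernel $K$ with respect to the reference measure $\mu$ if for every $k\ge 1$ and all mutually disjoint pre-compact Borel sets $\Delta_1,\dots,\Delta_k\subset X$, $$\mathbb{E}\Big[\prod_{i=1}^k\mathscr{X}(\Delta_i)\Big]=\int_{\Delta_1\times\cdots\times\Delta_k}\det[K(x_i,x_j)]_{1\le i,j\le k}\,\mathrm{d}\mu(x_1)\cdots\mathrm{d}\mu(x_k).$$ Hyperbolic ensemble: for $\alpha>0$ let $\mu_\alpha$ be the probability measure $\mathrm{d}\mu_\alpha(z)=\frac{\alpha}{\pi}(1-|z|^2)^{\alpha-1}\mathrm{d}m(z)$ on the open unit disc $\mathbb{D}\subset\mathbb{C}$, where $m$ is Lebesgue measure. The $\alpha$-hyperbolic ensemble $\mathcal{H}_\alpha$ is the determinantal point process on $\mathbb{D}$ with reference measure $\mu_\alpha$ and kernel equal to the kernel of the orthogonal projection of $L^2(\mathbb{D},\mu_\alpha)$ onto its subspace of holomorphic functions, i.e. $K(z,w)=(1-z\overline{w})^{-(\alpha+1)}$. Hyperbolic modulus: for $z\in\mathbb{D}$, $|z|_{\mathrm{h}}=\log\frac{1+|z|}{1-|z|}$. $B(\cdot,\cdot)$ is the Euler Beta function. $\mathcal{N}(0,V)$ is the centered real Gaussian law with variance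 $V$ (the Dirac mass at $0$ if $V=0$). *)

theory Defs
  imports "HOL-Probability.Probability" "Jordan_Normal_Form.Determinant"
begin

text \<open>The underlying space \<open>S\<close> of a point process is a subset of a Polish type, with the subspace
  topology (for the open unit disc, a locally compact Polish space). Pre-compactness is
  relative to \<open>S\<close>: the closure in \<open>S\<close> has to be compact.\<close>

definition precompact_in :: "'a::polish_space set \<Rightarrow> 'a set \<Rightarrow> bool" where
  "precompact_in S D \<longleftrightarrow> (\<exists>C. compact C \<and> C \<subseteq> S \<and> D \<subseteq> C)"

text \<open>A configuration without multiple points is identified with the set of its points.\<close>

definition simple_point_process ::
    "'w measure \<Rightarrow> 'a::polish_space set \<Rightarrow> ('w \<Rightarrow> 'a set) \<Rightarrow> bool" where
  "simple_point_process M S X \<longleftrightarrow>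
     prob_space M \<and>
     (\<forall>\<omega>\<in>space M. X \<omega> \<subseteq> S \<and> (\<forall>D. precompact_in S D \<longrightarrow> finite (X \<omega> \<inter> D))) \<and>
     (\<forall>D\<in>sets borel. precompact_in S D \<longrightarrow>
        (\<lambda>\<omega>. card (X \<omega> \<inter> D)) \<in> measurable M (count_space UNIV))"

definition kernel_det :: "('a \<Rightarrow> 'a \<Rightarrow> complex) \<Rightarrow> nat \<Rightarrow> (nat \<Rightarrow> 'a) \<Rightarrow> complex" where
  "kernel_det K k x = Determinant.det (Matrix.mat k k (\<lambda>(i, j). K (x i) (x j)))"

text \<open>The point process lives on \<open>space \<mu>\<close>. The two integrability clauses say that both sides of
  the defining identity are finite; they are spelled out because the Bochner integral of a
  non-integrable function is \<open>0\<close> by convention.\<close>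

definition determinantal_process ::
    "'w measure \<Rightarrow> 'a::polish_space measure \<Rightarrow> ('a \<Rightarrow> 'a \<Rightarrow> complex) \<Rightarrow> ('w \<Rightarrow> 'a set) \<Rightarrow> bool" where
  "determinantal_process M \<mu> K X \<longleftrightarrow>
     simple_point_process M (space \<mu>) X \<and>
     (\<forall>k\<ge>1. \<forall>D :: nat \<Rightarrow> 'a set.
        (\<forall>i<k. D i \<in> sets borel \<and> precompact_in (space \<mu>) (D i)) \<longrightarrow>
        disjoint_family_on D {..<k} \<longrightarrow>
          integrable M (\<lambda>\<omega>. \<Prod>i<k. real (card (X \<omega> \<inter> D i))) \<and>
          set_integrable (\<Pi>\<^sub>M i\<in>{..<k}. \<mu>) (\<Pi>\<^sub>E i\<in>{..<k}. D i) (kernel_det K k) \<and>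
          complex_of_real (\<integral>\<omega>. (\<Prod>i<k. real (card (X \<omega> \<inter> D i))) \<partial>M) =
            (LINT x:(\<Pi>\<^sub>E i\<in>{..<k}. D i)|(\<Pi>\<^sub>M i\<in>{..<k}. \<mu>). kernel_det K k x))"

definition hyperbolic_measure :: "real \<Rightarrow> complex measure" where
  "hyperbolic_measure \<alpha> =
     density (restrict_space lborel (ball 0 1))
       (\<lambda>z. ennreal (\<alpha> / pi * (1 - (norm z)\<^sup>2) powr (\<alpha> - 1)))"

text \<open>The kernel of the orthogonal projection of \<open>L\<^sup>2\<close> of the unit disc with respect to
  \<open>hyperbolic_measure \<alpha>\<close> onto its holomorphic functions. For \<open>z\<close>, \<open>w\<close> in the disc the base
  has positive real part, so the principal branch of the power is the right one.\<close>

definition hyperbolic_kernel :: "real \<Rightarrow> complex \<Rightarrow> complex \<Rightarrow> complex" where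
  "hyperbolic_kernel \<alpha> z w = (1 - z * cnj w) powr (- (complex_of_real \<alpha> + 1))"

definition hyperbolic_ensemble :: "real \<Rightarrow> 'w measure \<Rightarrow> ('w \<Rightarrow> complex set) \<Rightarrow> bool" where
  "hyperbolic_ensemble \<alpha> M X \<longleftrightarrow>
     determinantal_process M (hyperbolic_measure \<alpha>) (hyperbolic_kernel \<alpha>) X"

definition hyperbolic_modulus :: "complex \<Rightarrow> real" where
  "hyperbolic_modulus z = ln ((1 + norm z) / (1 - norm z))"

definition scale_const :: "real \<Rightarrow> real \<Rightarrow> real" where
  "scale_const \<alpha> R = \<alpha> * exp R / 8"

text \<open>A configuration has infinitely many points in general, hence the unordered infinite sum;
  only finitely many terms are nonzero when \<open>f\<close> has compact support.\<close>

definition normalized_statistic ::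
    "real \<Rightarrow> (real \<Rightarrow> real) \<Rightarrow> ('w \<Rightarrow> complex set) \<Rightarrow> real \<Rightarrow> 'w \<Rightarrow> real" where
  "normalized_statistic \<alpha> f X R \<omega> =
     1 / sqrt (scale_const \<alpha> R) * (\<Sum>\<^sub>\<infinity>z\<in>X \<omega>. f (hyperbolic_modulus z - R))
     - 2 * sqrt (scale_const \<alpha> R) * (\<integral>x. f x * exp x \<partial>lborel)"

definition limit_variance :: "real \<Rightarrow> (real \<Rightarrow> real) \<Rightarrow> real" where
  "limit_variance \<alpha> f =
     1 / Beta \<alpha> (\<alpha> + 1) *
     (\<integral>(x, y). (f x - f y)\<^sup>2 *
        (exp ((\<alpha> + 1) * (x + y)) / (exp x + exp y) powr (2 * \<alpha> + 1)) \<partial>(lborel :: (real \<times> real) measure))"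

text \<open>The parameter is the variance, whereas \<open>normal_density\<close> takes the standard deviation.\<close>

definition centered_gaussian :: "real \<Rightarrow> real measure" where
  "centered_gaussian V =
     (if V = 0 then return borel 0
      else density lborel (\<lambda>x. ennreal (normal_density 0 (sqrt V) x)))"

text \<open>The library's \<open>weak_conv_m\<close> with an arbitrary filter in place of \<open>sequentially\<close>.\<close>

definition weak_conv_along :: "('i \<Rightarrow> real measure) \<Rightarrow> real measure \<Rightarrow> 'i filter \<Rightarrow> bool" where
  "weak_conv_along N L F \<longleftrightarrow>
     (\<forall>x. isCont (cdf L) x \<longrightarrow> ((\<lambda>i. cdf (N i) x) \<longlongrightarrow> cdf L x) F)"

lemma weak_conv_along_sequentially: "weak_conv_along N L sequentially \<longleftrightarrow> weak_conv_m N L"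
  by (simp add: weak_conv_along_def weak_conv_m_def weak_conv_def)

end

theory Submission
  imports Defs
begin

text \<open>For a radial function \<open>g\<close> supported in a smaller disc, expanding the kernel in monomials, which
  are orthogonal with respect to radial weights, gives
  \<open>E \<Prod> (1 + g z) = \<Prod> (1 + \<integral> g d\<nu>\<^sub>n)\<close>, where \<open>\<nu>\<^sub>n\<close> has density proportional to
  \<open>|z|\<^sup>2\<^sup>n\<close> with respect to the hyperbolic measure: the moduli behave like independent variables, one for
  each degree \<open>n\<close>. Hence the characteristic function of the linear statistic is an infinite product, and
  a second-order expansion of its factors compares it with the Gaussian one, at a cost of the total
  variance times \<open>C\<^sub>R\<^sup>-\<^sup>3\<^sup>/\<^sup>2\<close>. The sum of the variances is
  \<open>\<integral> f\<^sup>2 K(z, z)\<close> minus a double integral against \<open>S q = \<Sum>\<^sub>n c\<^sub>n\<^sup>2 q\<^sup>n\<close>, where the \<open>c\<^sub>n\<close>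
  are the Taylor coefficients of \<open>(1 - q) powr (- (\<alpha> + 1))\<close>; the behaviour of \<open>S\<close> as \<open>q\<close> tends to \<open>1\<close>
  yields the limiting variance. The joint moments over disjoint cells determine the factorial moments
  by refining the cells, since the determinant vanishes on the diagonals.\<close>

section \<open>Injective tuples and determinants\<close>

text \<open>The defining identity speaks of point counts in disjoint cells, whereas the proof needs
  weighted sums over tuples of distinct points. So points and weights are rounded together, tuples
  with two points in one cell are discarded, and this loss disappears in the limit because a
  configuration has finitely many points in a window. The kernel is truncated to polynomials so that
  the determinant becomes a finite sum of products of one-variable integrals. Two bounds control the
  limits: \<open>fact k * C ^ k\<close> for a fixed number k of points, and
  \<open>(L * kernel_bound) ^ k\<close>, which stays summable after division by
  \<open>fact k\<close> whatever the size of L. No independent variables are constructed: the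
  product formula is an identity of numbers, and products of characteristic functions are compared
  factor by factor. Scale: in the hyperbolic modulus u the mean density of points is \<alpha>/2 sinh
  u, which at u = R + x is close to 2 \<open>scale_const \<alpha> R\<close> exp x. The factor 1 /
  B(\<alpha>, \<alpha> + 1) arises because the limiting kernel has marginal B(\<alpha>, \<alpha> +
  1) exp x; this lets the diagonal and the cross term combine into one square.\<close>

definition inj_tuples :: "nat \<Rightarrow> 'a set \<Rightarrow> (nat \<Rightarrow> 'a) set" where
  "inj_tuples k A = {x \<in> {..<k} \<rightarrow>\<^sub>E A. inj_on x {..<k}}"

lemma finite_inj_tuples: "finite A \<Longrightarrow> finite (inj_tuples k A)"
  by (rule finite_subset[of _ "{..<k} \<rightarrow>\<^sub>E A"]) (auto simp: inj_tuples_def intro: finite_PiE)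

lemma inj_tuples_mono: "A \<subseteq> B \<Longrightarrow> inj_tuples k A \<subseteq> inj_tuples k B"
  by (auto simp: inj_tuples_def PiE_iff)

lemma card_inj_tuples_eq:
  assumes "finite T" "card T = k"
  shows "card (inj_tuples k T) = fact k"
proof -
  have "card (inj_tuples k T) = (\<Prod>i\<in>{0..<k}. k - i)"
    using card_inj_on_subset_funcset[of "{..<k}" T "{..<k}"] assms
    by (simp add: inj_tuples_def)
  also have "\<dots> = fact k" by (simp add: fact_prod_rev)
  finally show ?thesis .
qed

text \<open>Tuples are grouped by their image. A k-subset T is the image of exactly the injective
  k-tuples with values in T, of which there are k!. The right-hand sum is the k-th elementary
  symmetric polynomial.\<close>

lemma sum_inj_tuples:
  fixes g :: "'a \<Rightarrow> 'b :: {comm_semiring_1}"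
  assumes "finite A"
  shows "(\<Sum>x\<in>inj_tuples k A. \<Prod>i<k. g (x i)) = of_nat (fact k) * (\<Sum>T | T \<subseteq> A \<and> card T = k. \<Prod>a\<in>T. g a)"
proof -
  let ?I = "inj_tuples k A" and ?S = "{T. T \<subseteq> A \<and> card T = k}"
  have fS: "finite ?S" using assms by (rule rev_finite_subset[OF finite_Pow_iff[THEN iffD2]]) auto
  have im: "(\<lambda>x. x ` {..<k}) ` ?I \<subseteq> ?S"
  proof (clarsimp simp: inj_tuples_def)
    fix x :: "nat \<Rightarrow> 'a" assume "x \<in> {..<k} \<rightarrow>\<^sub>E A" "inj_on x {..<k}"
    then show "x ` {..<k} \<subseteq> A \<and> card (x ` {..<k}) = k"
      using card_image[of x "{..<k}"] by (simp add: PiE_iff image_subset_iff)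
  qed
  have fib: "{x \<in> ?I. x ` {..<k} = T} = inj_tuples k T" if T: "T \<in> ?S" for T
  proof
    show "{x \<in> ?I. x ` {..<k} = T} \<subseteq> inj_tuples k T"
      by (auto simp: inj_tuples_def PiE_iff extensional_def)
    have "x ` {..<k} = T" if "x \<in> inj_tuples k T" for x
    proof (rule card_subset_eq)
      show "finite T" using T assms finite_subset by auto
      show "x ` {..<k} \<subseteq> T" using that by (auto simp: inj_tuples_def)
      show "card (x ` {..<k}) = card T" using that T by (auto simp: inj_tuples_def card_image)
    qed
    then show "inj_tuples k T \<subseteq> {x \<in> ?I. x ` {..<k} = T}"
      using T inj_tuples_mono[of T A k] by auto
  qed
  have "(\<Sum>x\<in>?I. \<Prod>i<k. g (x i)) = (\<Sum>x\<in>?I. \<Prod>a\<in>x ` {..<k}. g a)"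
    by (intro sum.cong refl) (auto simp: inj_tuples_def prod.reindex)
  also have "\<dots> = (\<Sum>T\<in>?S. \<Sum>x\<in>{x \<in> ?I. x ` {..<k} = T}. \<Prod>a\<in>x ` {..<k}. g a)"
    by (rule sum.group[symmetric]) (use assms fS im finite_inj_tuples in auto)
  also have "\<dots> = (\<Sum>T\<in>?S. of_nat (fact k) * (\<Prod>a\<in>T. g a))"
  proof (rule sum.cong[OF refl])
    fix T assume T: "T \<in> ?S"
    have "finite T" using T assms finite_subset by auto
    have "(\<Sum>x\<in>{x \<in> ?I. x ` {..<k} = T}. \<Prod>a\<in>x ` {..<k}. g a) = (\<Sum>x\<in>{x \<in> ?I. x ` {..<k} = T}. \<Prod>a\<in>T. g a)"
      by (intro sum.cong refl) auto
    also have "\<dots> = of_nat (card (inj_tuples k T)) * (\<Prod>a\<in>T. g a)"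
      using fib[OF T] by simp
    also have "card (inj_tuples k T) = fact k"
      using T \<open>finite T\<close> by (intro card_inj_tuples_eq) auto
    finally show "(\<Sum>x\<in>{x \<in> ?I. x ` {..<k} = T}. \<Prod>a\<in>x ` {..<k}. g a) = of_nat (fact k) * (\<Prod>a\<in>T. g a)" .
  qed
  finally show ?thesis by (simp add: sum_distrib_left)
qed

lemma inj_tuples_empty_if_card_less:
  assumes "finite A" "card A < k"
  shows "inj_tuples k A = {}"
proof -
  have False if "x \<in> inj_tuples k A" for x
  proof -
    have "card (x ` {..<k}) \<le> card A"
      using that assms by (intro card_mono) (auto simp: inj_tuples_def)
    then show False using that assms by (auto simp: inj_tuples_def card_image)
  qed
  then show ?thesis by auto
qed

text \<open>Expansion of the product into elementary symmetric polynomials; the series is finite,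
  since k > card A leaves no injective tuple. It is used twice: for the points of a configuration,
  and for the degrees n < N, which reassembles the product over the modes.\<close>

lemma prod_one_plus_sums_inj_tuples:
  fixes g :: "'a \<Rightarrow> 'b :: {real_normed_field}"
  assumes "finite A"
  shows "(\<lambda>k. (\<Sum>x\<in>inj_tuples k A. \<Prod>i<k. g (x i)) / fact k) sums (\<Prod>a\<in>A. 1 + g a)"
proof -
  have "(\<Prod>a\<in>A. 1 + g a) = (\<Prod>a\<in>A. g a + 1)" by (simp add: add.commute)
  also have "\<dots> = (\<Sum>T\<in>Pow A. \<Prod>a\<in>T. g a)"
    using prod_add[OF assms, of g "\<lambda>_. 1"] by simp
  also have "\<dots> = (\<Sum>k\<in>{..card A}. \<Sum>T\<in>{T \<in> Pow A. card T = k}. \<Prod>a\<in>T. g a)"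
    by (rule sum.group[symmetric]) (use assms in \<open>auto intro: card_mono\<close>)
  also have "\<dots> = (\<Sum>k\<in>{..card A}. (\<Sum>x\<in>inj_tuples k A. \<Prod>i<k. g (x i)) / fact k)"
    by (intro sum.cong refl) (simp add: sum_inj_tuples[OF assms] Pow_def of_nat_fact)
  finally have eq: "(\<Prod>a\<in>A. 1 + g a) = (\<Sum>k\<in>{..card A}. (\<Sum>x\<in>inj_tuples k A. \<Prod>i<k. g (x i)) / fact k)" .
  show ?thesis unfolding eq
    by (rule sums_finite) (auto simp: inj_tuples_empty_if_card_less[OF assms])
qed

text \<open>Dropping injectivity turns the sum over tuples into a k-th power. No factor k! is lost,
  so the bound divided by k! is summable in k.\<close>

lemma norm_sum_inj_tuples_le:
  fixes g :: "'a \<Rightarrow> 'b :: {real_normed_field}"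
  assumes "finite A"
  shows "norm (\<Sum>x\<in>inj_tuples k A. \<Prod>i<k. g (x i)) \<le> (\<Sum>a\<in>A. norm (g a)) ^ k"
proof -
  have "norm (\<Sum>x\<in>inj_tuples k A. \<Prod>i<k. g (x i)) \<le> (\<Sum>x\<in>inj_tuples k A. \<Prod>i<k. norm (g (x i)))"
    by (rule order_trans[OF norm_sum]) (simp add: prod_norm)
  also have "\<dots> \<le> (\<Sum>x\<in>{..<k} \<rightarrow>\<^sub>E A. \<Prod>i<k. norm (g (x i)))"
  proof (rule sum_mono2)
    show "finite ({..<k} \<rightarrow>\<^sub>E A)" using assms by (intro finite_PiE) auto
    show "inj_tuples k A \<subseteq> {..<k} \<rightarrow>\<^sub>E A" by (simp add: inj_tuples_def)
  qed (simp add: prod_nonneg)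
  also have "\<dots> = (\<Prod>i<k. \<Sum>a\<in>A. norm (g a))"
    by (rule prod_sum_PiE[symmetric]) (auto simp: assms)
  finally show ?thesis by simp
qed

lemma det_equality_matrix:
  fixes n :: "nat \<Rightarrow> 'b"
  shows "Determinant.det (Matrix.mat k k (\<lambda>(i, j). if n i = n j then 1 else 0)) =
    (if inj_on n {..<k} then 1 else 0 :: 'a :: comm_ring_1)"
proof (cases "inj_on n {..<k}")
  case True
  have "Matrix.mat k k (\<lambda>(i, j). if n i = n j then 1 else 0 :: 'a) = 1\<^sub>m k"
    using True by (auto simp: inj_on_def)
  then show ?thesis using True by simp
next
  case False
  then obtain i j where ij: "i < k" "j < k" "i \<noteq> j" "n i = n j" by (auto simp: inj_on_def)
  have "Determinant.det (Matrix.mat k k (\<lambda>(i, j). if n i = n j then 1 else 0)) = (0::'a)"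
    by (rule det_identical_rows[OF _ ij(3,1,2)]) (use ij in auto)
  then show ?thesis using False by simp
qed

text \<open>The left side is the Leibniz expansion of the determinant with entries [n i = n j]: an
  identity matrix if n is injective, a matrix with two equal rows otherwise. This is what restricts
  the expanded determinant to tuples of distinct degrees.\<close>

lemma sum_signof_stabilizer:
  fixes n :: "nat \<Rightarrow> 'b"
  shows "(\<Sum>p | p permutes {0..<k}. signof p * (if \<forall>i<k. n i = n (p i) then 1 else 0)) =
    (if inj_on n {..<k} then 1 else 0 :: 'a :: comm_ring_1)"
proof -
  let ?A = "Matrix.mat k k (\<lambda>(i, j). if n i = n j then 1 else 0 :: 'a)"
  have "(\<Prod>i=0..<k. ?A $$ (i, p i)) = (if \<forall>i<k. n i = n (p i) then 1 else 0)"
    if "p permutes {0..<k}" for p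
  proof -
    have pk: "p i < k" if "i < k" for i
      using permutes_in_image[OF \<open>p permutes {0..<k}\<close>, of i] that by auto
    have "(\<Prod>i=0..<k. ?A $$ (i, p i)) = (\<Prod>i=0..<k. if n i = n (p i) then 1 else 0)"
      by (intro prod.cong) (auto simp: pk)
    also have "\<dots> = (if \<forall>i<k. n i = n (p i) then 1 else 0)"
    proof (cases "\<forall>i<k. n i = n (p i)")
      case False
      then show ?thesis by (intro prod_zero[THEN trans]) auto
    qed auto
    finally show ?thesis .
  qed
  then have "Determinant.det ?A = (\<Sum>p | p permutes {0..<k}. signof p * (if \<forall>i<k. n i = n (p i) then 1 else 0))"
    by (subst det_def'[of _ k]) (auto intro!: sum.cong)
  then show ?thesis by (simp add: det_equality_matrix)
qed

lemma kernel_det_eq: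
  "kernel_det K k x = (\<Sum>p | p permutes {0..<k}. signof p * (\<Prod>i<k. K (x i) (x (p i))))"
  unfolding kernel_det_def
proof (subst det_def'[of _ k], simp, rule sum.cong[OF refl])
  fix p assume "p \<in> {p. p permutes {0..<k}}"
  then have pk: "p i < k" if "i < k" for i
    using permutes_in_image[of p "{0..<k}" i] that by auto
  show "signof p * (\<Prod>i=0..<k. Matrix.mat k k (\<lambda>(i, j). K (x i) (x j)) $$ (i, p i)) =
    signof p * (\<Prod>i<k. K (x i) (x (p i)))"
    by (rule arg_cong[where f="(*) _"], rule prod.cong) (auto simp: pk)
qed

lemma kernel_det_not_inj:
  assumes "\<not> inj_on x {..<k}"
  shows "kernel_det K k x = 0"
proof -
  obtain i j where ij: "i < k" "j < k" "i \<noteq> j" "x i = x j" using assms by (auto simp: inj_on_def)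
  show ?thesis unfolding kernel_det_def
    by (rule det_identical_rows[OF _ ij(3,1,2)]) (use ij in auto)
qed

text \<open>A crude termwise bound of the Leibniz sum. It serves as a majorant for fixed k only; its
  factor k! would spoil the summation over k.\<close>

lemma norm_kernel_det_le:
  assumes "\<And>i j. i < k \<Longrightarrow> j < k \<Longrightarrow> norm (K (x i) (x j)) \<le> C"
  shows "norm (kernel_det K k x) \<le> fact k * C ^ k"
proof -
  have "norm (kernel_det K k x) \<le> (\<Sum>p | p permutes {0..<k}. norm (signof p * (\<Prod>i<k. K (x i) (x (p i)))))"
    unfolding kernel_det_eq by (rule norm_sum)
  also have "\<dots> \<le> (\<Sum>p | p permutes {0..<k}. C ^ k)"
  proof (rule sum_mono)
    fix p assume "p \<in> {p. p permutes {0..<k}}"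
    then have pk: "p i < k" if "i < k" for i
      using permutes_in_image[of p "{0..<k}" i] that by auto
    have "(\<Prod>i<k. norm (K (x i) (x (p i)))) \<le> (\<Prod>i<k. C)"
      by (rule prod_mono) (auto intro!: assms pk)
    then show "norm (signof p * (\<Prod>i<k. K (x i) (x (p i)))) \<le> C ^ k"
      by (simp add: norm_mult prod_norm sign_def)
  qed
  also have "\<dots> = fact k * C ^ k"
    by (simp add: card_permutations)
  finally show ?thesis .
qed

section \<open>Correlation functions of a determinantal process\<close>

text \<open>The labels \<open>h \<circ> x\<close> name the only product cell that can contain x, so
  at most one term of the sum survives, and it occurs among the injective label tuples exactly when
  these labels are distinct.\<close>

lemma sum_indicator_cells:
  fixes u :: "'c \<Rightarrow> complex"
  assumes "finite (h ` D)"
  shows "(\<Sum>c\<in>inj_tuples k (h ` D). (\<Prod>i<k. u (c i)) * indicator (\<Pi>\<^sub>E i\<in>{..<k}. {z \<in> D. h z = c i}) x) =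
    (if x \<in> ({..<k} \<rightarrow>\<^sub>E D) \<and> inj_on (h \<circ> x) {..<k} then \<Prod>i<k. u (h (x i)) else 0)"
proof (cases "x \<in> ({..<k} \<rightarrow>\<^sub>E D) \<and> inj_on (h \<circ> x) {..<k}")
  case True
  \<comment> \<open>Restriction makes the label tuple extensional, hence an element of
    \<open>inj_tuples\<close>.\<close>
  define d where "d = restrict (h \<circ> x) {..<k}"
  have d: "d \<in> inj_tuples k (h ` D)"
    unfolding inj_tuples_def mem_Collect_eq
  proof
    show "d \<in> {..<k} \<rightarrow>\<^sub>E h ` D"
      using True unfolding d_def by (simp add: restrict_PiE_iff PiE_iff)
    show "inj_on d {..<k}" using True unfolding d_def by (simp add: inj_on_restrict_eq)
  qed
  have "x \<in> (\<Pi>\<^sub>E i\<in>{..<k}. {z \<in> D. h z = c i}) \<longleftrightarrow> c = d" if "c \<in> inj_tuples k (h ` D)" for c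
  proof -
    have "c \<in> extensional {..<k}" using that by (simp add: inj_tuples_def PiE_iff)
    then have "c = d \<longleftrightarrow> (\<forall>i<k. c i = h (x i))"
      unfolding d_def by (auto simp: fun_eq_iff extensional_def)
    moreover have "x \<in> (\<Pi>\<^sub>E i\<in>{..<k}. {z \<in> D. h z = c i}) \<longleftrightarrow> (\<forall>i<k. h (x i) = c i)"
      using True by (auto simp: PiE_iff)
    ultimately show ?thesis by metis
  qed
  then have "(\<Sum>c\<in>inj_tuples k (h ` D). (\<Prod>i<k. u (c i)) * indicator (\<Pi>\<^sub>E i\<in>{..<k}. {z \<in> D. h z = c i}) x) =
    (\<Sum>c\<in>inj_tuples k (h ` D). if c = d then (\<Prod>i<k. u (c i)) else 0)"
    by (intro sum.cong refl) (auto simp: indicator_def)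
  also have "\<dots> = (\<Prod>i<k. u (d i))"
    using d finite_inj_tuples[OF assms] by (simp add: sum.delta)
  finally show ?thesis using True by (simp add: d_def)
next
  case False
  have "x \<notin> (\<Pi>\<^sub>E i\<in>{..<k}. {z \<in> D. h z = c i})" if "c \<in> inj_tuples k (h ` D)" for c
  proof
    assume x: "x \<in> (\<Pi>\<^sub>E i\<in>{..<k}. {z \<in> D. h z = c i})"
    then have "x \<in> {..<k} \<rightarrow>\<^sub>E D" by (simp add: PiE_iff)
    moreover have "inj_on (h \<circ> x) {..<k}"
      using x that by (subst inj_on_cong[of _ _ c]) (simp_all add: PiE_iff inj_tuples_def)
    ultimately show False using False by simp
  qed
  then show ?thesis using False by (auto intro!: sum.neutral simp: indicator_def)
qed

text \<open>A product of cardinalities counts the point tuples in a product of cells; summing over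
  injective label tuples then collects every point tuple with distinct labels once.\<close>

lemma sum_inj_image_tuples_eq_cells:
  fixes u :: "'c \<Rightarrow> complex"
  assumes "finite (h ` D)" "finite A" "A \<subseteq> D"
  shows "(\<Sum>x | x \<in> ({..<k} \<rightarrow>\<^sub>E A) \<and> inj_on (h \<circ> x) {..<k}. \<Prod>i<k. u (h (x i))) =
    (\<Sum>c\<in>inj_tuples k (h ` D). (\<Prod>i<k. u (c i)) * of_real (\<Prod>i<k. real (card (A \<inter> {z \<in> D. h z = c i}))))"
proof -
  have fin: "finite ({..<k} \<rightarrow>\<^sub>E A)" using assms by (intro finite_PiE) auto
  have "(\<Sum>c\<in>inj_tuples k (h ` D). (\<Prod>i<k. u (c i)) * of_real (\<Prod>i<k. real (card (A \<inter> {z \<in> D. h z = c i})))) =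
    (\<Sum>c\<in>inj_tuples k (h ` D). \<Sum>x\<in>({..<k} \<rightarrow>\<^sub>E A). (\<Prod>i<k. u (c i)) * indicator (\<Pi>\<^sub>E i\<in>{..<k}. {z \<in> D. h z = c i}) x)"
  proof (rule sum.cong[OF refl])
    fix c assume "c \<in> inj_tuples k (h ` D)"
    let ?P = "\<Pi>\<^sub>E i\<in>{..<k}. A \<inter> {z \<in> D. h z = c i}"
    have "(\<Sum>x\<in>({..<k} \<rightarrow>\<^sub>E A). (\<Prod>i<k. u (c i)) * indicator (\<Pi>\<^sub>E i\<in>{..<k}. {z \<in> D. h z = c i}) x) =
      (\<Sum>x\<in>?P. (\<Prod>i<k. u (c i)))"
    proof (rule sum.mono_neutral_cong_right[OF fin])
      show "?P \<subseteq> {..<k} \<rightarrow>\<^sub>E A" by (rule PiE_mono) auto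
    qed (auto simp: PiE_iff indicator_def)
    also have "\<dots> = (\<Prod>i<k. u (c i)) * of_nat (card ?P)" by simp
    also have "card ?P = (\<Prod>i<k. card (A \<inter> {z \<in> D. h z = c i}))"
      by (simp add: card_PiE)
    finally show "(\<Prod>i<k. u (c i)) * of_real (\<Prod>i<k. real (card (A \<inter> {z \<in> D. h z = c i}))) =
      (\<Sum>x\<in>({..<k} \<rightarrow>\<^sub>E A). (\<Prod>i<k. u (c i)) * indicator (\<Pi>\<^sub>E i\<in>{..<k}. {z \<in> D. h z = c i}) x)"
      by simp
  qed
  also have "\<dots> = (\<Sum>x\<in>({..<k} \<rightarrow>\<^sub>E A). \<Sum>c\<in>inj_tuples k (h ` D). (\<Prod>i<k. u (c i)) * indicator (\<Pi>\<^sub>E i\<in>{..<k}. {z \<in> D. h z = c i}) x)"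
    by (rule sum.swap)
  also have "\<dots> = (\<Sum>x\<in>({..<k} \<rightarrow>\<^sub>E A). if inj_on (h \<circ> x) {..<k} then \<Prod>i<k. u (h (x i)) else 0)"
    using assms(3) by (intro sum.cong refl) (subst sum_indicator_cells[OF assms(1)], auto simp: PiE_iff)
  also have "\<dots> = (\<Sum>x | x \<in> ({..<k} \<rightarrow>\<^sub>E A) \<and> inj_on (h \<circ> x) {..<k}. \<Prod>i<k. u (h (x i)))"
    by (subst sum.inter_filter[OF fin, symmetric]) auto
  finally show ?thesis by simp
qed

lemma determinantal_finite_inter:
  assumes "determinantal_process M \<mu> K X" "precompact_in (space \<mu>) D" "\<omega> \<in> space M"
  shows "finite (X \<omega> \<inter> D)"
  using assms unfolding determinantal_process_def simple_point_process_def by blast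

text \<open>Injective label tuples give disjoint cells, precisely the situation covered by the
  definition of the process. Linearity over the finitely many label tuples yields the identity for
  weights that are constant on cells; tuples sharing a cell are left out on both sides.\<close>

lemma determinantal_cell_moment:
  fixes h :: "'a::polish_space \<Rightarrow> 'c" and u :: "'c \<Rightarrow> complex"
  assumes det: "determinantal_process M \<mu> K X" and D: "precompact_in (space \<mu>) D"
    and cell: "\<And>c. {z \<in> D. h z = c} \<in> sets borel" and fin: "finite (h ` D)" and k: "k \<ge> 1"
  defines "U \<equiv> \<lambda>\<omega>. \<Sum>x | x \<in> ({..<k} \<rightarrow>\<^sub>E X \<omega> \<inter> D) \<and> inj_on (h \<circ> x) {..<k}. \<Prod>i<k. u (h (x i))"
    and "W \<equiv> \<lambda>x. if inj_on (h \<circ> x) {..<k} then (\<Prod>i<k. u (h (x i))) * kernel_det K k x else 0"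
  shows "integrable M U"
    and "set_integrable (\<Pi>\<^sub>M i\<in>{..<k}. \<mu>) ({..<k} \<rightarrow>\<^sub>E D) W"
    and "(\<integral>\<omega>. U \<omega> \<partial>M) = (LINT x:({..<k} \<rightarrow>\<^sub>E D)|(\<Pi>\<^sub>M i\<in>{..<k}. \<mu>). W x)"
proof -
  define B where "B c i = {z \<in> D. h z = c i}" for c :: "nat \<Rightarrow> 'c" and i :: nat
  let ?C = "inj_tuples k (h ` D)" and ?P = "\<Pi>\<^sub>M i\<in>{..<k}. \<mu>"
  let ?n = "\<lambda>c \<omega>. \<Prod>i<k. real (card (X \<omega> \<inter> B c i))"
  have pre: "precompact_in (space \<mu>) (B c i)" for c i
    using D unfolding precompact_in_def B_def by blast
  have key: "integrable M (?n c)" "set_integrable ?P (\<Pi>\<^sub>E i\<in>{..<k}. B c i) (kernel_det K k)"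
    "complex_of_real (\<integral>\<omega>. ?n c \<omega> \<partial>M) = (LINT x:(\<Pi>\<^sub>E i\<in>{..<k}. B c i)|?P. kernel_det K k x)"
    if c: "c \<in> ?C" for c
  proof -
    have 1: "\<forall>i<k. B c i \<in> sets borel \<and> precompact_in (space \<mu>) (B c i)"
      using cell pre by (auto simp: B_def)
    have 2: "disjoint_family_on (B c) {..<k}"
      using c by (auto simp: disjoint_family_on_def B_def inj_tuples_def inj_on_def)
    from det k 1 2
    show "integrable M (?n c)" "set_integrable ?P (\<Pi>\<^sub>E i\<in>{..<k}. B c i) (kernel_det K k)"
      "complex_of_real (\<integral>\<omega>. ?n c \<omega> \<partial>M) = (LINT x:(\<Pi>\<^sub>E i\<in>{..<k}. B c i)|?P. kernel_det K k x)"
      unfolding determinantal_process_def by blast+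
  qed
  have U: "U \<omega> = (\<Sum>c\<in>?C. (\<Prod>i<k. u (c i)) * of_real (?n c \<omega>))" if "\<omega> \<in> space M" for \<omega>
  proof -
    have *: "X \<omega> \<inter> D \<inter> {z \<in> D. h z = c i} = X \<omega> \<inter> B c i" for c i by (auto simp: B_def)
    show ?thesis
      unfolding U_def
      by (subst sum_inj_image_tuples_eq_cells[OF fin determinantal_finite_inter[OF det D that]])
         (simp_all add: *)
  qed
  have W: "indicator ({..<k} \<rightarrow>\<^sub>E D) x *\<^sub>R W x =
      (\<Sum>c\<in>?C. (\<Prod>i<k. u (c i)) * (indicator (\<Pi>\<^sub>E i\<in>{..<k}. B c i) x *\<^sub>R kernel_det K k x))" for x
  proof -
    have "(\<Sum>c\<in>?C. (\<Prod>i<k. u (c i)) * (indicator (\<Pi>\<^sub>E i\<in>{..<k}. B c i) x *\<^sub>R kernel_det K k x)) =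
      (\<Sum>c\<in>?C. (\<Prod>i<k. u (c i)) * indicator (\<Pi>\<^sub>E i\<in>{..<k}. B c i) x) * kernel_det K k x"
      unfolding sum_distrib_right by (intro sum.cong refl) (auto simp: indicator_def)
    also have "\<dots> = indicator ({..<k} \<rightarrow>\<^sub>E D) x *\<^sub>R W x"
      unfolding B_def sum_indicator_cells[OF fin] by (auto simp: W_def)
    finally show ?thesis by simp
  qed
  show "integrable M U"
    by (subst Bochner_Integration.integrable_cong[OF refl U])
       (auto intro!: integrable_mult_right integrable_of_real key(1) simp del: of_real_prod)
  show "set_integrable ?P ({..<k} \<rightarrow>\<^sub>E D) W"
    unfolding set_integrable_def W
    by (intro Bochner_Integration.integrable_sum integrable_mult_right key(2)[unfolded set_integrable_def])
  have "(\<integral>\<omega>. U \<omega> \<partial>M) = (\<integral>\<omega>. (\<Sum>c\<in>?C. (\<Prod>i<k. u (c i)) * complex_of_real (?n c \<omega>)) \<partial>M)"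
    by (rule Bochner_Integration.integral_cong[OF refl U])
  also have "\<dots> = (\<Sum>c\<in>?C. (\<Prod>i<k. u (c i)) * complex_of_real (\<integral>\<omega>. ?n c \<omega> \<partial>M))"
    by (subst Bochner_Integration.integral_sum)
       (auto intro!: integrable_mult_right integrable_of_real key(1) simp del: of_real_prod)
  also have "\<dots> = (\<Sum>c\<in>?C. (\<Prod>i<k. u (c i)) * (LINT x:(\<Pi>\<^sub>E i\<in>{..<k}. B c i)|?P. kernel_det K k x))"
    by (intro sum.cong refl) (simp only: key(3))
  also have "\<dots> = (LINT x:({..<k} \<rightarrow>\<^sub>E D)|?P. W x)"
    unfolding set_lebesgue_integral_def W
    by (subst Bochner_Integration.integral_sum,
        intro integrable_mult_right key(2)[unfolded set_integrable_def], assumption,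
        simp only: integral_mult_right_zero)
  finally show "(\<integral>\<omega>. U \<omega> \<partial>M) = (LINT x:({..<k} \<rightarrow>\<^sub>E D)|?P. W x)" .
qed

section \<open>Rounding to the grid of mesh 2^-m: half-open squares as cells, grid points as
  values\<close>

definition dyadic_round :: "nat \<Rightarrow> complex \<Rightarrow> complex" where
  "dyadic_round m z = Complex (of_int \<lfloor>2 ^ m * Re z\<rfloor> / 2 ^ m) (of_int \<lfloor>2 ^ m * Im z\<rfloor> / 2 ^ m)"

lemma dyadic_round_measurable [measurable]: "dyadic_round m \<in> borel_measurable borel"
  unfolding dyadic_round_def complex_eq_iff
  by (subst borel_measurable_complex_iff) simp

lemma norm_dyadic_round_diff_le: "norm (dyadic_round m z - z) \<le> 2 / 2 ^ m"
proof -
  have *: "\<bar>of_int \<lfloor>2 ^ m * r\<rfloor> / 2 ^ m - r\<bar> \<le> 1 / 2 ^ m" for r :: real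
  proof -
    have "\<bar>of_int \<lfloor>2 ^ m * r\<rfloor> - 2 ^ m * r\<bar> \<le> 1" by linarith
    moreover have "of_int \<lfloor>2 ^ m * r\<rfloor> / 2 ^ m - r = (of_int \<lfloor>2 ^ m * r\<rfloor> - 2 ^ m * r) / 2 ^ m"
      by (simp add: field_simps)
    ultimately show ?thesis by (simp add: divide_right_mono)
  qed
  have "norm (dyadic_round m z - z) \<le> \<bar>Re (dyadic_round m z - z)\<bar> + \<bar>Im (dyadic_round m z - z)\<bar>"
    by (rule cmod_le)
  also have "\<dots> \<le> 1 / 2 ^ m + 1 / 2 ^ m"
    using *[of "Re z"] *[of "Im z"] by (intro add_mono) (auto simp: dyadic_round_def)
  finally show ?thesis by simp
qed

lemma tendsto_dyadic_round: "(\<lambda>m. dyadic_round m z) \<longlonglongrightarrow> z"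
proof -
  have "(\<lambda>m. 2 / 2 ^ m :: real) \<longlonglongrightarrow> 0"
    by real_asymp
  then have "(\<lambda>m. dyadic_round m z - z) \<longlonglongrightarrow> 0"
    by (rule Lim_null_comparison[rotated]) (simp add: norm_dyadic_round_diff_le)
  then show ?thesis by (simp add: LIM_zero_iff)
qed

lemma norm_dyadic_round_le: "norm (dyadic_round m z) \<le> norm z + 2"
proof -
  have "norm (dyadic_round m z) \<le> norm z + norm (dyadic_round m z - z)"
    by (metis add.commute diff_add_cancel norm_triangle_ineq)
  moreover have "2 / 2 ^ m \<le> (2::real)" by (simp add: field_simps)
  ultimately show ?thesis using norm_dyadic_round_diff_le[of m z] by linarith
qed

lemma finite_dyadic_round_image:
  assumes "bounded B"
  shows "finite (dyadic_round m ` B)"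
proof -
  obtain b where b: "\<And>z. z \<in> B \<Longrightarrow> norm z \<le> b" using assms by (auto simp: bounded_iff)
  define N where "N = \<lceil>2 ^ m * b\<rceil> + 1"
  have *: "\<lfloor>2 ^ m * r\<rfloor> \<in> {- N..N}" if "\<bar>r\<bar> \<le> b" for r :: real
  proof -
    have "\<bar>2 ^ m * r\<bar> \<le> 2 ^ m * b" using that by (simp add: abs_mult)
    then show ?thesis unfolding N_def by (simp add: le_floor_iff floor_le_iff) linarith
  qed
  have "dyadic_round m ` B \<subseteq> (\<lambda>(i, j). Complex (of_int i / 2 ^ m) (of_int j / 2 ^ m)) ` ({- N..N} \<times> {- N..N})"
  proof (rule image_subsetI)
    fix z assume "z \<in> B"
    then have "\<bar>Re z\<bar> \<le> b" "\<bar>Im z\<bar> \<le> b"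
      using b[of z] abs_Re_le_cmod[of z] abs_Im_le_cmod[of z] by linarith+
    then show "dyadic_round m z \<in> (\<lambda>(i, j). Complex (of_int i / 2 ^ m) (of_int j / 2 ^ m)) ` ({- N..N} \<times> {- N..N})"
      using * unfolding dyadic_round_def by (intro image_eqI[of _ _ "(\<lfloor>2 ^ m * Re z\<rfloor>, \<lfloor>2 ^ m * Im z\<rfloor>)"]) auto
  qed
  then show ?thesis by (rule finite_subset) auto
qed

text \<open>Rounded points converge to the points themselves, so two distinct points have distinct
  roundings from some m on; there are only finitely many pairs.\<close>

lemma eventually_inj_on_dyadic_round:
  assumes "inj_on x {..<k::nat}"
  shows "eventually (\<lambda>m. inj_on (dyadic_round m \<circ> x) {..<k}) sequentially"
proof -
  have "eventually (\<lambda>m. \<forall>i\<in>{..<k}. \<forall>j\<in>{..<k}. i \<noteq> j \<longrightarrow> dyadic_round m (x i) \<noteq> dyadic_round m (x j)) sequentially"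
  proof (intro eventually_ball_finite ballI)
    fix i j assume ij: "i \<in> {..<k}" "j \<in> {..<k}"
    show "eventually (\<lambda>m. i \<noteq> j \<longrightarrow> dyadic_round m (x i) \<noteq> dyadic_round m (x j)) sequentially"
    proof (cases "i = j")
      case False
      then have "x i - x j \<noteq> 0" using assms ij by (auto simp: inj_on_def)
      moreover have "(\<lambda>m. dyadic_round m (x i) - dyadic_round m (x j)) \<longlonglongrightarrow> x i - x j"
        by (intro tendsto_diff tendsto_dyadic_round)
      ultimately have "eventually (\<lambda>m. dyadic_round m (x i) - dyadic_round m (x j) \<noteq> 0) sequentially"
        using tendsto_imp_eventually_ne by blast
      then show ?thesis by (rule eventually_mono) auto
    qed auto
  qed auto
  then show ?thesis by (rule eventually_mono) (auto simp: inj_on_def)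
qed

lemma set_integrable_bounded_PiE:
  fixes W :: "(nat \<Rightarrow> 'a) \<Rightarrow> complex"
  assumes \<mu>: "finite_measure \<mu>" and D: "D \<in> sets \<mu>"
    and m: "set_borel_measurable (\<Pi>\<^sub>M i\<in>{..<k}. \<mu>) ({..<k} \<rightarrow>\<^sub>E D) W"
    and bound: "\<And>x. x \<in> ({..<k} \<rightarrow>\<^sub>E D) \<Longrightarrow> norm (W x) \<le> b"
  shows "set_integrable (\<Pi>\<^sub>M i\<in>{..<k}. \<mu>) ({..<k} \<rightarrow>\<^sub>E D) W"
    and "integrable (\<Pi>\<^sub>M i\<in>{..<k}. \<mu>) (indicator ({..<k} \<rightarrow>\<^sub>E D) :: _ \<Rightarrow> real)"
    and "(\<integral>x. indicator ({..<k} \<rightarrow>\<^sub>E D) x \<partial>(\<Pi>\<^sub>M i\<in>{..<k}. \<mu>)) = measure \<mu> D ^ k"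
    and "norm (LINT x:({..<k} \<rightarrow>\<^sub>E D)|(\<Pi>\<^sub>M i\<in>{..<k}. \<mu>). W x) \<le> b * measure \<mu> D ^ k"
proof -
  interpret finite_measure \<mu> by fact
  interpret product_sigma_finite "\<lambda>_::nat. \<mu>" ..
  let ?P = "\<Pi>\<^sub>M i\<in>{..<k}. \<mu>"
  have sets: "({..<k} \<rightarrow>\<^sub>E D) \<in> sets ?P" using D by (intro sets_PiM_I_finite) auto
  have em: "emeasure ?P ({..<k} \<rightarrow>\<^sub>E D) = ennreal (measure \<mu> D ^ k)"
    using D by (subst emeasure_PiM) (auto simp: emeasure_eq_measure ennreal_power)
  show 1: "integrable ?P (indicator ({..<k} \<rightarrow>\<^sub>E D) :: _ \<Rightarrow> real)"
    using sets em by (subst integrable_indicator_iff) (auto simp: sets.Int_space_eq2)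
  show 2: "(\<integral>x. indicator ({..<k} \<rightarrow>\<^sub>E D) x \<partial>?P) = measure \<mu> D ^ k"
    using sets em by (simp add: sets.Int_space_eq2 measure_def)
  have "integrable ?P (\<lambda>x. indicator ({..<k} \<rightarrow>\<^sub>E D) x * b)" using 1 by simp
  moreover have le: "norm (indicator ({..<k} \<rightarrow>\<^sub>E D) x *\<^sub>R W x) \<le> indicator ({..<k} \<rightarrow>\<^sub>E D) x * b" for x
    using bound[of x] by (cases "x \<in> ({..<k} \<rightarrow>\<^sub>E D)") simp_all
  moreover have "(\<lambda>x. indicator ({..<k} \<rightarrow>\<^sub>E D) x *\<^sub>R W x) \<in> borel_measurable ?P"
    using m unfolding set_borel_measurable_def .
  ultimately show "set_integrable ?P ({..<k} \<rightarrow>\<^sub>E D) W"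
    unfolding set_integrable_def
    by (elim Bochner_Integration.integrable_bound) (auto intro!: AE_I2 order_trans[OF le] simp del: mult_eq_0_iff norm_scaleR)
  then have "norm (LINT x:({..<k} \<rightarrow>\<^sub>E D)|?P. W x) \<le> (\<integral>x. indicator ({..<k} \<rightarrow>\<^sub>E D) x * b \<partial>?P)"
    unfolding set_lebesgue_integral_def set_integrable_def
    by (intro order_trans[OF integral_norm_bound] integral_mono integrable_norm le
        integrable_mult_left[OF 1])
  then show "norm (LINT x:({..<k} \<rightarrow>\<^sub>E D)|?P. W x) \<le> b * measure \<mu> D ^ k"
    using 2 by (simp add: mult.commute)
qed

section \<open>Weighted factorial moments in a window on which the kernel is bounded\<close>

locale determinantal_window =
  fixes M :: "'w measure" and \<mu> :: "complex measure" and K :: "complex \<Rightarrow> complex \<Rightarrow> complex"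
    and X :: "'w \<Rightarrow> complex set" and D :: "complex set" and C :: real
  assumes det: "determinantal_process M \<mu> K X"
    and finite_\<mu>: "finite_measure \<mu>"
    and pre: "precompact_in (space \<mu>) D"
    and D_borel [measurable]: "D \<in> sets borel"
    and D_sets: "D \<in> sets \<mu>"
    and K_bound: "\<And>z w. z \<in> D \<Longrightarrow> w \<in> D \<Longrightarrow> norm (K z w) \<le> C"
begin

lemma prob_space_M: "prob_space M"
  using det by (auto simp: determinantal_process_def simple_point_process_def)

lemma bounded_window: "bounded D"
  using pre unfolding precompact_in_def using bounded_subset compact_imp_bounded by blast

lemma norm_kernel_det_window_le:
  assumes "x \<in> ({..<k} \<rightarrow>\<^sub>E D)"
  shows "norm (kernel_det K k x) \<le> fact k * C ^ k"
  by (rule norm_kernel_det_le) (use assms in \<open>auto intro!: K_bound simp: PiE_iff\<close>)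

text \<open>The label of z has two parts: the rounded position separates points as m grows, and the
  rounded value of g is a weight that is constant on cells. Boundedness of the window and of g makes
  the number of cells finite.\<close>

lemma rounded_moment:
  fixes g :: "complex \<Rightarrow> complex"
  assumes [measurable]: "g \<in> borel_measurable borel" and g: "\<And>z. norm (g z) \<le> L" and k: "k \<ge> 1"
  defines "h \<equiv> \<lambda>m z. (dyadic_round m z, dyadic_round m (g z))"
  defines "U \<equiv> \<lambda>m \<omega>. \<Sum>x | x \<in> ({..<k} \<rightarrow>\<^sub>E X \<omega> \<inter> D) \<and> inj_on (h m \<circ> x) {..<k}. \<Prod>i<k. snd (h m (x i))"
    and "W \<equiv> \<lambda>m x. if inj_on (h m \<circ> x) {..<k} then (\<Prod>i<k. snd (h m (x i))) * kernel_det K k x else 0"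
  shows "integrable M (U m)"
    and "set_integrable (\<Pi>\<^sub>M i\<in>{..<k}. \<mu>) ({..<k} \<rightarrow>\<^sub>E D) (W m)"
    and "(\<integral>\<omega>. U m \<omega> \<partial>M) = (LINT x:({..<k} \<rightarrow>\<^sub>E D)|(\<Pi>\<^sub>M i\<in>{..<k}. \<mu>). W m x)"
proof -
  have "h m ` D \<subseteq> dyadic_round m ` D \<times> dyadic_round m ` (g ` D)" by (auto simp: h_def)
  moreover have "bounded (g ` D)" using g by (auto simp: bounded_iff)
  ultimately have fin: "finite (h m ` D)"
    using finite_dyadic_round_image bounded_window by (meson finite_SigmaI finite_subset)
  have cell: "{z \<in> D. h m z = c} \<in> sets borel" for c
  proof -
    have "dyadic_round m -` {fst c} \<in> sets borel" "(\<lambda>z. dyadic_round m (g z)) -` {snd c} \<in> sets borel"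
      by (rule measurable_sets_borel; measurable)+
    then have "D \<inter> (dyadic_round m -` {fst c} \<inter> (\<lambda>z. dyadic_round m (g z)) -` {snd c}) \<in> sets borel"
      using D_borel by blast
    also have "D \<inter> (dyadic_round m -` {fst c} \<inter> (\<lambda>z. dyadic_round m (g z)) -` {snd c}) = {z \<in> D. h m z = c}"
      by (auto simp: h_def)
    finally show ?thesis .
  qed
  note * = determinantal_cell_moment[where h = "h m" and u = snd, OF det pre cell fin k]
  show "integrable M (U m)" "set_integrable (\<Pi>\<^sub>M i\<in>{..<k}. \<mu>) ({..<k} \<rightarrow>\<^sub>E D) (W m)"
    "(\<integral>\<omega>. U m \<omega> \<partial>M) = (LINT x:({..<k} \<rightarrow>\<^sub>E D)|(\<Pi>\<^sub>M i\<in>{..<k}. \<mu>). W m x)"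
    unfolding U_def W_def by (rule *)+
qed

lemma rounded_sum_eq:
  assumes "\<omega> \<in> space M"
  shows "(\<Sum>x | x \<in> ({..<k} \<rightarrow>\<^sub>E X \<omega> \<inter> D) \<and> inj_on ((\<lambda>z. (dyadic_round m z, dyadic_round m (g z))) \<circ> x) {..<k}.
      \<Prod>i<k. snd ((\<lambda>z. (dyadic_round m z, dyadic_round m (g z))) (x i))) =
    (\<Sum>x\<in>inj_tuples k (X \<omega> \<inter> D).
      if inj_on ((\<lambda>z. (dyadic_round m z, dyadic_round m (g z))) \<circ> x) {..<k} then \<Prod>i<k. dyadic_round m (g (x i)) else 0)"
proof -
  have "finite (inj_tuples k (X \<omega> \<inter> D))"
    using determinantal_finite_inter[OF det pre assms] by (rule finite_inj_tuples)
  then show ?thesis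
    by (subst sum.inter_filter[symmetric])
       (auto simp: inj_tuples_def intro!: sum.cong intro: inj_on_imageI2)
qed

lemma eventually_inj_on_rounded:
  assumes "inj_on x {..<k::nat}"
  shows "eventually (\<lambda>m. inj_on ((\<lambda>z. (dyadic_round m z, dyadic_round m (g z))) \<circ> x) {..<k}) sequentially"
  using eventually_inj_on_dyadic_round[OF assms]
proof (rule eventually_mono)
  fix m assume "inj_on (dyadic_round m \<circ> x) {..<k}"
  then have "inj_on (fst \<circ> ((\<lambda>z. (dyadic_round m z, dyadic_round m (g z))) \<circ> x)) {..<k}"
    by (simp add: comp_def)
  then show "inj_on ((\<lambda>z. (dyadic_round m z, dyadic_round m (g z))) \<circ> x) {..<k}"
    by (rule inj_on_imageI2)
qed

text \<open>For a fixed outcome the window holds finitely many points, so the sum has finitely many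
  terms, and each of its injective tuples is eventually separated.\<close>

lemma tendsto_rounded_sum:
  assumes "\<omega> \<in> space M"
  shows "(\<lambda>m. \<Sum>x | x \<in> ({..<k} \<rightarrow>\<^sub>E X \<omega> \<inter> D) \<and> inj_on ((\<lambda>z. (dyadic_round m z, dyadic_round m (g z))) \<circ> x) {..<k}.
      \<Prod>i<k. snd ((\<lambda>z. (dyadic_round m z, dyadic_round m (g z))) (x i)))
    \<longlonglongrightarrow> (\<Sum>x\<in>inj_tuples k (X \<omega> \<inter> D). \<Prod>i<k. g (x i))"
  unfolding rounded_sum_eq[OF assms]
proof (rule tendsto_sum)
  fix x assume x: "x \<in> inj_tuples k (X \<omega> \<inter> D)"
  have "(\<lambda>m. \<Prod>i<k. dyadic_round m (g (x i))) \<longlonglongrightarrow> (\<Prod>i<k. g (x i))"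
    by (intro tendsto_prod tendsto_dyadic_round)
  moreover have "eventually (\<lambda>m. (\<Prod>i<k. dyadic_round m (g (x i))) =
    (if inj_on ((\<lambda>z. (dyadic_round m z, dyadic_round m (g z))) \<circ> x) {..<k} then \<Prod>i<k. dyadic_round m (g (x i)) else 0)) sequentially"
  proof -
    have "inj_on x {..<k}" using x by (simp add: inj_tuples_def)
    from eventually_inj_on_rounded[OF this, of g] show ?thesis by (rule eventually_mono) simp
  qed
  ultimately show "(\<lambda>m. if inj_on ((\<lambda>z. (dyadic_round m z, dyadic_round m (g z))) \<circ> x) {..<k}
      then \<Prod>i<k. dyadic_round m (g (x i)) else 0) \<longlonglongrightarrow> (\<Prod>i<k. g (x i))"
    by (rule Lim_transform_eventually)
qed

lemma norm_rounded_weight_le: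
  assumes "\<And>z. norm (g z) \<le> L"
  shows "norm (\<Prod>i<k. dyadic_round m (g (x i))) \<le> (L + 2) ^ k"
proof -
  have "(\<Prod>i<k. norm (dyadic_round m (g (x i)))) \<le> (\<Prod>i<k. L + 2)"
  proof (intro prod_mono conjI norm_ge_zero)
    show "norm (dyadic_round m (g (x i))) \<le> L + 2" for i
      using norm_dyadic_round_le[of m "g (x i)"] assms[of "x i"] by linarith
  qed
  then show ?thesis by (simp add: prod_norm)
qed

lemma rounded_integrand_le:
  assumes "\<And>z. norm (g z) \<le> L" "x \<in> ({..<k} \<rightarrow>\<^sub>E D)"
  shows "norm (if inj_on (h \<circ> x) {..<k} then (\<Prod>i<k. dyadic_round m (g (x i))) * kernel_det K k x else 0)
    \<le> (L + 2) ^ k * (fact k * C ^ k)"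
proof -
  have "0 \<le> norm (g 0)" by simp
  then have "0 \<le> L" using assms(1)[of 0] by linarith
  have "norm ((\<Prod>i<k. dyadic_round m (g (x i))) * kernel_det K k x) \<le> (L + 2) ^ k * (fact k * C ^ k)"
    unfolding norm_mult using \<open>0 \<le> L\<close>
    by (intro mult_mono norm_rounded_weight_le norm_kernel_det_window_le assms) auto
  then show ?thesis using norm_ge_zero order_trans by (smt (verit) norm_zero)
qed

text \<open>Fatou's lemma along the dyadic partitions, with the constant weight \<open>1\<close>.\<close>

lemma integrable_card_inj_tuples:
  "integrable M (\<lambda>\<omega>. real (card (inj_tuples k (X \<omega> \<inter> D))))"
proof (cases "k = 0")
  case True
  interpret prob_space M by (rule prob_space_M)
  show ?thesis by (simp add: True inj_tuples_def)
next
  case False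
  then have k: "k \<ge> 1" by simp
  let ?g = "\<lambda>_::complex. 1::complex"
  let ?h = "\<lambda>m z. (dyadic_round m z, dyadic_round m (?g z))"
  let ?U = "\<lambda>m \<omega>. \<Sum>x | x \<in> ({..<k} \<rightarrow>\<^sub>E X \<omega> \<inter> D) \<and> inj_on (?h m \<circ> x) {..<k}. \<Prod>i<k. snd (?h m (x i))"
  let ?P = "\<Pi>\<^sub>M i\<in>{..<k}. \<mu>"
  \<comment> \<open>Rounding fixes the weight 1, so the rounded sum is a count and equals its own
    norm; the norm of its expectation, known from the kernel side, then controls its L1
    norm.\<close>
  have dr1: "dyadic_round m 1 = 1" for m
    by (simp add: dyadic_round_def complex_eq_iff)
  note rm = rounded_moment[where g = ?g and L = 1 and k = k, OF _ _ k]
  have U: "integrable M (?U m)" for m using rm(1) by simp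
  have U_real: "?U m \<omega> = of_real (norm (?U m \<omega>))" for m \<omega> by (simp add: dr1)
  \<comment> \<open>The base 1 + 2 is the general bound L + 2 for rounded weights at L = 1.\<close>
  define b where "b = (1 + 2) ^ k * (fact k * C ^ k) * measure \<mu> D ^ k"
  have le: "(\<integral>\<^sup>+\<omega>. ennreal (norm (?U m \<omega>)) \<partial>M) \<le> ennreal b" for m
  proof -
    let ?W = "\<lambda>x. if inj_on (?h m \<circ> x) {..<k} then (\<Prod>i<k. snd (?h m (x i))) * kernel_det K k x else 0"
    have Wi: "set_integrable ?P ({..<k} \<rightarrow>\<^sub>E D) ?W" using rm(2)[of m] by simp
    have Wm: "set_borel_measurable ?P ({..<k} \<rightarrow>\<^sub>E D) ?W"
      using Wi unfolding set_integrable_def set_borel_measurable_def by (rule borel_measurable_integrable)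
    have Wb: "norm (?W x) \<le> (1 + 2) ^ k * (fact k * C ^ k)" if "x \<in> ({..<k} \<rightarrow>\<^sub>E D)" for x
      using rounded_integrand_le[OF _ that, of ?g 1 "?h m" m] unfolding snd_conv by simp
    note fin = set_integrable_bounded_PiE[OF finite_\<mu> D_sets Wm Wb]
    have "(\<integral>\<omega>. norm (?U m \<omega>) \<partial>M) = norm (\<integral>\<omega>. ?U m \<omega> \<partial>M)"
    proof -
      have "(\<integral>\<omega>. ?U m \<omega> \<partial>M) = (\<integral>\<omega>. complex_of_real (norm (?U m \<omega>)) \<partial>M)"
        by (rule Bochner_Integration.integral_cong[OF refl U_real])
      also have "\<dots> = of_real (\<integral>\<omega>. norm (?U m \<omega>) \<partial>M)" by (rule integral_complex_of_real)
      finally show ?thesis by (simp del: norm_sum)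
    qed
    also have "\<dots> = norm (LINT x:({..<k} \<rightarrow>\<^sub>E D)|?P. ?W x)"
      using rm(3)[of m] by simp
    also have "\<dots> \<le> b" unfolding b_def by (rule fin(4))
    finally have "(\<integral>\<omega>. norm (?U m \<omega>) \<partial>M) \<le> b" .
    moreover have "(\<integral>\<^sup>+\<omega>. ennreal (norm (?U m \<omega>)) \<partial>M) = ennreal (\<integral>\<omega>. norm (?U m \<omega>) \<partial>M)"
      by (rule nn_integral_eq_integral) (use U[of m] in auto)
    ultimately show ?thesis by (simp only: ennreal_leI)
  qed
  have meas: "(\<lambda>\<omega>. \<Sum>x\<in>inj_tuples k (X \<omega> \<inter> D). \<Prod>i<k. ?g (x i)) \<in> borel_measurable M"
    by (rule borel_measurable_LIMSEQ_metric[of ?U, OF borel_measurable_integrable[OF U] tendsto_rounded_sum])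
  have lim: "(\<lambda>m. ennreal (norm (?U m \<omega>))) \<longlonglongrightarrow> ennreal (real (card (inj_tuples k (X \<omega> \<inter> D))))" if "\<omega> \<in> space M" for \<omega>
    using tendsto_norm[OF tendsto_rounded_sum[OF that, where k = k and g = ?g]]
    by (intro tendsto_ennrealI) (simp only: prod.neutral_const sum_constant mult_1_right norm_of_nat)
  show ?thesis
  proof (rule integrableI_bounded)
    show "(\<lambda>\<omega>. real (card (inj_tuples k (X \<omega> \<inter> D)))) \<in> borel_measurable M"
      using measurable_compose[OF meas borel_measurable_norm]
      by (simp only: prod.neutral_const sum_constant mult_1_right norm_of_nat)
    have "(\<integral>\<^sup>+\<omega>. ennreal (norm (real (card (inj_tuples k (X \<omega> \<inter> D))))) \<partial>M) = (\<integral>\<^sup>+\<omega>. liminf (\<lambda>m. ennreal (norm (?U m \<omega>))) \<partial>M)"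
    proof (rule nn_integral_cong)
      fix \<omega> assume "\<omega> \<in> space M"
      from lim_imp_Liminf[OF _ lim[OF this]]
      show "ennreal (norm (real (card (inj_tuples k (X \<omega> \<inter> D))))) = liminf (\<lambda>m. ennreal (norm (?U m \<omega>)))" by simp
    qed
    also have "\<dots> \<le> liminf (\<lambda>m. \<integral>\<^sup>+\<omega>. ennreal (norm (?U m \<omega>)) \<partial>M)"
      by (rule nn_integral_liminf) (use borel_measurable_integrable[OF U] in measurable)
    also have "\<dots> \<le> liminf (\<lambda>m. ennreal b)"
      by (intro Liminf_mono always_eventually allI le)
    also have "\<dots> = ennreal b" by (simp add: Liminf_const)
    also have "\<dots> < \<infinity>" by simp
    finally show "(\<integral>\<^sup>+\<omega>. ennreal (norm (real (card (inj_tuples k (X \<omega> \<inter> D))))) \<partial>M) < \<infinity>" .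
  qed
qed

text \<open>Dominated convergence on both sides of the rounded identity. On the probability side the
  majorant is a multiple of the number of injective tuples, integrable by the preceding lemma; on
  the kernel side it is a constant on the product of windows. Measurability of the limiting
  integrand is inherited from the rounded ones.\<close>

theorem factorial_moment:
  fixes g :: "complex \<Rightarrow> complex"
  assumes g_meas [measurable]: "g \<in> borel_measurable borel" and g: "\<And>z. norm (g z) \<le> L"
  shows "integrable M (\<lambda>\<omega>. \<Sum>x\<in>inj_tuples k (X \<omega> \<inter> D). \<Prod>i<k. g (x i))"
    and "set_borel_measurable (\<Pi>\<^sub>M i\<in>{..<k}. \<mu>) ({..<k} \<rightarrow>\<^sub>E D) (\<lambda>x. (\<Prod>i<k. g (x i)) * kernel_det K k x)"
    and "(\<integral>\<omega>. (\<Sum>x\<in>inj_tuples k (X \<omega> \<inter> D). \<Prod>i<k. g (x i)) \<partial>M) =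
      (LINT x:({..<k} \<rightarrow>\<^sub>E D)|(\<Pi>\<^sub>M i\<in>{..<k}. \<mu>). (\<Prod>i<k. g (x i)) * kernel_det K k x)"
proof -
  let ?P = "\<Pi>\<^sub>M i\<in>{..<k}. \<mu>"
  let ?J = "\<lambda>\<omega>. \<Sum>x\<in>inj_tuples k (X \<omega> \<inter> D). \<Prod>i<k. g (x i)"
  let ?V = "\<lambda>x. (\<Prod>i<k. g (x i)) * kernel_det K k x"
  have "integrable M ?J \<and> set_borel_measurable ?P ({..<k} \<rightarrow>\<^sub>E D) ?V \<and> (\<integral>\<omega>. ?J \<omega> \<partial>M) = (LINT x:({..<k} \<rightarrow>\<^sub>E D)|?P. ?V x)"
  \<comment> \<open>The definition of the process starts at k = 1. For k = 0 the empty tuple is the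
    only one and both sides are 1.\<close>
  proof (cases "k = 0")
    case True
    interpret prob_space M by (rule prob_space_M)
    interpret P0: prob_space "PiM {} (\<lambda>_::nat. \<mu>)"
      by standard (simp add: space_PiM emeasure_PiM_empty PiM_empty)
    have [simp]: "kernel_det K 0 x = 1" for x by (simp add: kernel_det_eq)
    have *: "indicator {\<lambda>_::nat. undefined} x = (1::real)" if "x \<in> space (PiM {} (\<lambda>_::nat. \<mu>))" for x :: "nat \<Rightarrow> complex"
      using that by (simp add: space_PiM)
    have "(LINT x|PiM {} (\<lambda>_::nat. \<mu>). indicator {\<lambda>_. undefined} x *\<^sub>R (1::complex)) = (LINT x|PiM {} (\<lambda>_::nat. \<mu>). 1)"
      by (rule Bochner_Integration.integral_cong) (auto simp: *)
    moreover have "inj_tuples 0 A = {\<lambda>_. undefined}" for A :: "complex set"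
      by (auto simp: inj_tuples_def)
    moreover have "(\<lambda>x. indicator {\<lambda>_. undefined} x *\<^sub>R (1::complex)) \<in> borel_measurable (PiM {} (\<lambda>_::nat. \<mu>))"
      by (subst measurable_cong[where g = "\<lambda>_. 1"]) (simp_all add: *)
    ultimately show ?thesis
      unfolding True set_borel_measurable_def set_lebesgue_integral_def
      by (simp add: P0.prob_space prob_space del: indicator_simps)
  next
    case False
    then have k: "k \<ge> 1" by simp
    let ?h = "\<lambda>m z. (dyadic_round m z, dyadic_round m (g z))"
    let ?U = "\<lambda>m \<omega>. \<Sum>x | x \<in> ({..<k} \<rightarrow>\<^sub>E X \<omega> \<inter> D) \<and> inj_on (?h m \<circ> x) {..<k}. \<Prod>i<k. snd (?h m (x i))"
    let ?W = "\<lambda>m x. if inj_on (?h m \<circ> x) {..<k} then (\<Prod>i<k. snd (?h m (x i))) * kernel_det K k x else 0"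
    note rm = rounded_moment[OF g_meas g k]
    have U: "integrable M (?U m)" for m by (rule rm(1))
    have W: "set_integrable ?P ({..<k} \<rightarrow>\<^sub>E D) (?W m)" for m by (rule rm(2))
    have Wb: "norm (?W m x) \<le> (L + 2) ^ k * (fact k * C ^ k)" if "x \<in> ({..<k} \<rightarrow>\<^sub>E D)" for x m
      using rounded_integrand_le[OF g that, of "?h m" m] unfolding snd_conv .
    have J_meas: "?J \<in> borel_measurable M"
      by (rule borel_measurable_LIMSEQ_metric[of ?U, OF borel_measurable_integrable[OF U] tendsto_rounded_sum])
    have U_le: "norm (?U m \<omega>) \<le> (L + 2) ^ k * real (card (inj_tuples k (X \<omega> \<inter> D)))" if "\<omega> \<in> space M" for m \<omega>
    proof -
      have "norm (g 0) \<ge> 0" by simp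
      then have L0: "0 \<le> L" using g[of 0] by linarith
      have "norm (?U m \<omega>) \<le> (\<Sum>x\<in>inj_tuples k (X \<omega> \<inter> D). (L + 2) ^ k)"
        unfolding rounded_sum_eq[OF that]
      proof (rule order_trans[OF norm_sum], rule sum_mono)
        fix x
        show "norm (if inj_on (?h m \<circ> x) {..<k} then \<Prod>i<k. dyadic_round m (g (x i)) else 0) \<le> (L + 2) ^ k"
          using norm_rounded_weight_le[OF g, where k = k and m = m and x = x] L0 by auto
      qed
      then show ?thesis by (simp add: mult.commute)
    qed
    have U_lim: "(\<lambda>m. \<integral>\<omega>. ?U m \<omega> \<partial>M) \<longlonglongrightarrow> (\<integral>\<omega>. ?J \<omega> \<partial>M)" and J_int: "integrable M ?J"
    proof -
      let ?w = "\<lambda>\<omega>. (L + 2) ^ k * real (card (inj_tuples k (X \<omega> \<inter> D)))"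
      have w: "integrable M ?w" by (intro integrable_mult_right integrable_card_inj_tuples)
      have l: "AE \<omega> in M. (\<lambda>m. ?U m \<omega>) \<longlonglongrightarrow> ?J \<omega>" by (intro AE_I2 tendsto_rounded_sum)
      have b: "\<And>m. AE \<omega> in M. norm (?U m \<omega>) \<le> ?w \<omega>" by (intro AE_I2 U_le)
      show "(\<lambda>m. \<integral>\<omega>. ?U m \<omega> \<partial>M) \<longlonglongrightarrow> (\<integral>\<omega>. ?J \<omega> \<partial>M)"
        by (rule integral_dominated_convergence[OF J_meas borel_measurable_integrable[OF U] w l b])
      show "integrable M ?J"
        by (rule integrable_dominated_convergence[OF J_meas borel_measurable_integrable[OF U] w l b])
    qed
    have W_tendsto: "(\<lambda>m. indicator ({..<k} \<rightarrow>\<^sub>E D) x *\<^sub>R ?W m x) \<longlonglongrightarrow> indicator ({..<k} \<rightarrow>\<^sub>E D) x *\<^sub>R ?V x" for x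
    proof (rule tendsto_scaleR[OF tendsto_const], cases "inj_on x {..<k}")
      case True
      have "(\<lambda>m. (\<Prod>i<k. dyadic_round m (g (x i))) * kernel_det K k x) \<longlonglongrightarrow> ?V x"
        by (intro tendsto_mult tendsto_prod tendsto_dyadic_round tendsto_const)
      moreover have "eventually (\<lambda>m. (\<Prod>i<k. dyadic_round m (g (x i))) * kernel_det K k x = ?W m x) sequentially"
        using eventually_inj_on_rounded[OF True, of g] by (rule eventually_mono) simp
      ultimately show "(\<lambda>m. ?W m x) \<longlonglongrightarrow> ?V x" by (rule Lim_transform_eventually)
    next
      \<comment> \<open>Coinciding points are never separated by rounding, so the rounded integrand
        is 0 throughout; the limit agrees because the determinant vanishes on the diagonals.\<close>
      case False
      then have "kernel_det K k x = 0" by (rule kernel_det_not_inj)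
      then show "(\<lambda>m. ?W m x) \<longlonglongrightarrow> ?V x" by (simp only: mult_zero_right if_cancel tendsto_const)
    qed
    have W_meas: "(\<lambda>x. indicator ({..<k} \<rightarrow>\<^sub>E D) x *\<^sub>R ?W m x) \<in> borel_measurable ?P" for m
      using W[of m] unfolding set_integrable_def by (rule borel_measurable_integrable)
    have V_meas: "(\<lambda>x. indicator ({..<k} \<rightarrow>\<^sub>E D) x *\<^sub>R ?V x) \<in> borel_measurable ?P"
      by (rule borel_measurable_LIMSEQ_metric[OF W_meas W_tendsto])
    have W_lim: "(\<lambda>m. LINT x:({..<k} \<rightarrow>\<^sub>E D)|?P. ?W m x) \<longlonglongrightarrow> (LINT x:({..<k} \<rightarrow>\<^sub>E D)|?P. ?V x)"
      unfolding set_lebesgue_integral_def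
    proof (rule integral_dominated_convergence[OF V_meas W_meas, where w = "\<lambda>x. indicator ({..<k} \<rightarrow>\<^sub>E D) x * ((L + 2) ^ k * (fact k * C ^ k))"])
      have "set_borel_measurable ?P ({..<k} \<rightarrow>\<^sub>E D) (?W 0)"
        using W_meas[of 0] unfolding set_borel_measurable_def .
      from set_integrable_bounded_PiE(2)[OF finite_\<mu> D_sets this Wb]
      show "integrable ?P (\<lambda>x. indicator ({..<k} \<rightarrow>\<^sub>E D) x * ((L + 2) ^ k * (fact k * C ^ k)))" by simp
      show "AE x in ?P. (\<lambda>m. indicator ({..<k} \<rightarrow>\<^sub>E D) x *\<^sub>R ?W m x) \<longlonglongrightarrow> indicator ({..<k} \<rightarrow>\<^sub>E D) x *\<^sub>R ?V x"
        by (intro AE_I2 W_tendsto)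
      show "AE x in ?P. norm (indicator ({..<k} \<rightarrow>\<^sub>E D) x *\<^sub>R ?W m x) \<le> indicator ({..<k} \<rightarrow>\<^sub>E D) x * ((L + 2) ^ k * (fact k * C ^ k))" for m
      proof (rule AE_I2)
        fix x
        show "norm (indicator ({..<k} \<rightarrow>\<^sub>E D) x *\<^sub>R ?W m x) \<le> indicator ({..<k} \<rightarrow>\<^sub>E D) x * ((L + 2) ^ k * (fact k * C ^ k))"
        proof (cases "x \<in> ({..<k} \<rightarrow>\<^sub>E D)")
          case True
          then show ?thesis using Wb[OF True, of m] by simp
        qed simp
      qed
    qed
    have "(\<lambda>m. \<integral>\<omega>. ?U m \<omega> \<partial>M) \<longlonglongrightarrow> (LINT x:({..<k} \<rightarrow>\<^sub>E D)|?P. ?V x)"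
      unfolding rm(3) by (rule W_lim)
    with U_lim have "(\<integral>\<omega>. ?J \<omega> \<partial>M) = (LINT x:({..<k} \<rightarrow>\<^sub>E D)|?P. ?V x)"
      by (rule LIMSEQ_unique)
    then show ?thesis using J_int V_meas by (simp add: set_borel_measurable_def)
  qed
  then show "integrable M ?J" "set_borel_measurable ?P ({..<k} \<rightarrow>\<^sub>E D) ?V"
    "(\<integral>\<omega>. ?J \<omega> \<partial>M) = (LINT x:({..<k} \<rightarrow>\<^sub>E D)|?P. ?V x)" by blast+
qed

end

section \<open>The radial law of the hyperbolic measure\<close>

text \<open>This is |z|^2 for a point z of the disc with hyperbolic modulus u; see
  \<open>sqrad_hyperbolic_modulus\<close>.\<close>

definition sqrad :: "real \<Rightarrow> real" where "sqrad u = (tanh (u / 2))\<^sup>2"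

text \<open>With s = |z|^2 the hyperbolic measure becomes \<alpha> (1 - s)^(\<alpha> - 1) ds, and ds
  = tanh (u/2) (1 - s) du supplies the tanh and one more power of 1 - s.\<close>

definition modulus_density :: "real \<Rightarrow> real \<Rightarrow> real" where
  "modulus_density \<alpha> u = indicator {0..} u * (\<alpha> * tanh (u / 2) * (1 - sqrad u) powr \<alpha>)"

lemma sqrad_nonneg [simp]: "0 \<le> sqrad u" by (simp add: sqrad_def)

lemma sqrad_less_one [simp]: "sqrad u < 1"
  using tanh_real_bounds[of "u / 2"] by (auto simp: sqrad_def power2_eq_square abs_square_less_1[unfolded power2_eq_square])

lemma sqrad_neq_one [simp]: "sqrad u \<noteq> 1" "1 \<noteq> sqrad u"
  using less_imp_neq[OF sqrad_less_one[of u]] by auto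

lemma powr_one_minus_sqrad: "(1 - sqrad u) powr \<alpha> = (1 - sqrad u) powr (\<alpha> - 1) * (1 - sqrad u)"
  using powr_mult_base[of "1 - sqrad u" "\<alpha> - 1"] less_imp_le[OF sqrad_less_one[of u]] by (simp add: mult.commute)

lemma sqrad_measurable [measurable]: "sqrad \<in> borel_measurable borel"
  unfolding sqrad_def by (intro borel_measurable_continuous_onI continuous_intros) auto

lemma tanh_half_measurable [measurable]: "(\<lambda>u::real. tanh (u / 2)) \<in> borel_measurable borel"
  by (intro borel_measurable_continuous_onI continuous_intros) auto

lemma modulus_density_measurable [measurable]: "modulus_density \<alpha> \<in> borel_measurable borel"
  unfolding modulus_density_def by measurable

lemma modulus_density_nonneg: "\<alpha> > 0 \<Longrightarrow> 0 \<le> modulus_density \<alpha> u"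
  by (auto simp: modulus_density_def indicator_def)

lemma has_real_derivative_sqrad:
  "(sqrad has_real_derivative tanh (u / 2) * (1 - sqrad u)) (at u)"
  unfolding sqrad_def
  by (auto intro!: derivative_eq_intros simp: cosh_square_eq field_simps power2_eq_square)

lemma tendsto_sqrad_at_top: "(sqrad \<longlongrightarrow> 1) at_top"
proof -
  have "filterlim (\<lambda>u::real. u / 2) at_top at_top" by real_asymp
  from filterlim_compose[OF tanh_real_at_top this]
  have "((\<lambda>u. (tanh (u / 2 :: real))\<^sup>2) \<longlongrightarrow> 1\<^sup>2) at_top" by (intro tendsto_power)
  then show ?thesis by (simp add: sqrad_def[abs_def])
qed

lemma tanh_half_hyperbolic_modulus:
  assumes "norm z < 1"
  shows "tanh (hyperbolic_modulus z / 2) = norm z"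
proof -
  let ?q = "(1 + norm z) / (1 - norm z)"
  have "?q > 0" using assms by (intro divide_pos_pos add_pos_nonneg) auto
  have "tanh (hyperbolic_modulus z / 2) = (1 - exp (- ln ?q)) / (1 + exp (- ln ?q))"
    by (simp add: tanh_real_altdef hyperbolic_modulus_def)
  also have "exp (- ln ?q) = (1 - norm z) / (1 + norm z)"
    using \<open>?q > 0\<close> by (simp add: exp_minus)
  also have "1 + norm z \<noteq> 0" by (metis add_pos_nonneg less_numeral_extra(1,3) norm_ge_zero)
  then have "(1 - (1 - norm z) / (1 + norm z)) / (1 + (1 - norm z) / (1 + norm z)) = norm z"
    by (simp add: field_simps)
  finally show ?thesis .
qed

lemma sqrad_hyperbolic_modulus: "norm z < 1 \<Longrightarrow> sqrad (hyperbolic_modulus z) = (norm z)\<^sup>2"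
  by (simp add: sqrad_def tanh_half_hyperbolic_modulus)

lemma hyperbolic_modulus_le_iff:
  assumes "norm z < 1"
  shows "hyperbolic_modulus z \<le> u \<longleftrightarrow> norm z \<le> tanh (u / 2)"
  using tanh_real_le_iff[of "hyperbolic_modulus z / 2" "u / 2"] by (simp add: tanh_half_hyperbolic_modulus assms)

lemma hyperbolic_modulus_measurable [measurable]: "hyperbolic_modulus \<in> borel_measurable borel"
  unfolding hyperbolic_modulus_def by measurable

text \<open>The points of modulus at most u form the closed disc of radius tanh (u/2), of area \<pi>
  \<open>sqrad u\<close>; the density on the right is the derivative of that area. Hence both sides
  have the same distribution function.\<close>

lemma distr_disc_modulus:
  "distr (restrict_space lborel (ball (0::complex) 1)) borel hyperbolic_modulus =
    density lborel (\<lambda>u. ennreal (pi * (tanh (u / 2) * (1 - sqrad u))) * indicator {0..} u)"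
  (is "?N1 = ?N2")
proof (rule cdf_unique')
  have [measurable]: "hyperbolic_modulus \<in> borel_measurable (restrict_space lborel (ball (0::complex) 1))"
    by (intro measurable_restrict_space1) simp
  have em1: "emeasure ?N1 {..u} = emeasure lborel ({z \<in> ball (0::complex) 1. hyperbolic_modulus z \<le> u})" for u
  proof -
    have "emeasure ?N1 {..u} = emeasure (restrict_space lborel (ball 0 1)) (hyperbolic_modulus -` {..u} \<inter> ball 0 1)"
      by (subst emeasure_distr) (auto simp: space_restrict_space)
    also have "\<dots> = emeasure lborel (hyperbolic_modulus -` {..u} \<inter> ball (0::complex) 1)"
      by (subst emeasure_restrict_space) auto
    also have "hyperbolic_modulus -` {..u} \<inter> ball (0::complex) 1 = {z \<in> ball 0 1. hyperbolic_modulus z \<le> u}" by auto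
    finally show ?thesis .
  qed
  have N1: "emeasure ?N1 {..u} = ennreal (if u < 0 then 0 else pi * sqrad u)" for u
  proof (cases "u < 0")
    case True
    then have "tanh (u / 2) < 0" by simp
    have "\<not> hyperbolic_modulus z \<le> u" if "norm z < 1" for z
      using hyperbolic_modulus_le_iff[OF that, of u] \<open>tanh (u / 2) < 0\<close> norm_ge_zero[of z] by linarith
    then have "{z \<in> ball (0::complex) 1. hyperbolic_modulus z \<le> u} = {}"
      by auto
    then show ?thesis using True by (simp only: em1 emeasure_empty if_True ennreal_0)
  next
    case False
    have "{z \<in> ball (0::complex) 1. hyperbolic_modulus z \<le> u} = cball 0 (tanh (u / 2))"
      using hyperbolic_modulus_le_iff[of _ u] tanh_real_lt_1[of "u / 2"] by (auto simp: dist_norm)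
    then show ?thesis using False
      by (simp add: em1 emeasure_cball sqrad_def unit_ball_vol_2)
  qed
  have N2: "emeasure ?N2 {..u} = ennreal (if u < 0 then 0 else pi * sqrad u)" for u
  proof (cases "u < 0")
    case True
    have "emeasure ?N2 {..u} = (\<integral>\<^sup>+x. ennreal (pi * (tanh (x / 2) * (1 - sqrad x))) * indicator {0..} x * indicator {..u} x \<partial>lborel)"
      by (rule emeasure_density) auto
    also have "\<dots> = (\<integral>\<^sup>+x. 0 \<partial>(lborel :: real measure))"
      by (intro nn_integral_cong) (use True in \<open>auto simp: indicator_def\<close>)
    finally show ?thesis using True by simp
  next
    case False
    have "emeasure ?N2 {..u} = (\<integral>\<^sup>+x. ennreal (pi * (tanh (x / 2) * (1 - sqrad x))) * indicator {0..u} x \<partial>lborel)"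
      by (subst emeasure_density) (auto intro!: nn_integral_cong simp: indicator_def)
    also have "\<dots> = ennreal (pi * sqrad u - pi * sqrad 0)"
      using False
      by (intro nn_integral_FTC_Icc)
        (auto intro!: DERIV_cmult has_real_derivative_sqrad mult_nonneg_nonneg simp: less_imp_le[OF sqrad_less_one])
    finally show ?thesis using False by (simp add: sqrad_def)
  qed
  \<comment> \<open>Uniqueness by distribution functions is for finite measures; exhausting the line
    by half-lines bounds the total mass by \<pi>.\<close>
  have fin: "finite_borel_measure N" if "sets N = sets borel" "\<And>u. emeasure N {..u} = ennreal (if u < 0 then 0 else pi * sqrad u)" for N
  proof (intro finite_borel_measure.intro finite_measureI finite_borel_measure_axioms.intro)
    have "emeasure N (space N) = emeasure N (\<Union>n. {..real n})"
      using sets_eq_imp_space_eq[OF that(1)] real_arch_simple by (intro arg_cong[where f = "emeasure N"]) auto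
    also have "\<dots> = (SUP n. emeasure N {..real n})"
      by (subst SUP_emeasure_incseq) (auto simp: that(1) incseq_def)
    also have "\<dots> \<le> ennreal pi"
      unfolding that(2) by (intro SUP_least ennreal_leI) (auto simp: mult_left_le less_imp_le)
    also have "\<dots> < \<infinity>" by simp
    finally show "emeasure N (space N) \<noteq> \<infinity>" by simp
    show "sets N = sets borel" by fact
  qed
  show "finite_borel_measure ?N1" by (rule fin) (simp_all add: N1)
  show "finite_borel_measure ?N2" by (rule fin) (simp_all add: N2)
  show "cdf ?N1 = cdf ?N2" by (simp add: cdf_def measure_def N1 N2 fun_eq_iff)
qed

lemma sets_hyperbolic_measure: "sets (hyperbolic_measure \<alpha>) = sets (restrict_space borel (ball 0 1))"
  by (simp add: hyperbolic_measure_def cong: sets_restrict_space_cong)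

lemma space_hyperbolic_measure [simp]: "space (hyperbolic_measure \<alpha>) = ball 0 1"
  by (simp add: hyperbolic_measure_def space_restrict_space)

lemma measurable_hyperbolic_measure [measurable]:
  "g \<in> borel_measurable borel \<Longrightarrow> g \<in> borel_measurable (hyperbolic_measure \<alpha>)"
  by (simp add: hyperbolic_measure_def measurable_restrict_space1)

lemma distr_hyperbolic_modulus:
  assumes "\<alpha> > 0"
  shows "distr (hyperbolic_measure \<alpha>) borel hyperbolic_modulus = density lborel (modulus_density \<alpha>)"
proof -
  let ?d = "\<lambda>u. ennreal (\<alpha> / pi * (1 - sqrad u) powr (\<alpha> - 1))"
  let ?B = "restrict_space lborel (ball (0::complex) 1)"
  have m: "hyperbolic_modulus \<in> borel_measurable ?B"
    by (intro measurable_restrict_space1) simp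
  have d: "?d \<in> borel_measurable borel" by measurable
  have "hyperbolic_measure \<alpha> = density ?B (\<lambda>z. ?d (hyperbolic_modulus z))"
    unfolding hyperbolic_measure_def
  proof (rule density_cong)
    show "AE z in ?B. ennreal (\<alpha> / pi * (1 - (norm z)\<^sup>2) powr (\<alpha> - 1)) = ?d (hyperbolic_modulus z)"
      by (intro AE_I2) (simp add: space_restrict_space sqrad_hyperbolic_modulus)
    show "(\<lambda>z. ennreal (\<alpha> / pi * (1 - (norm z)\<^sup>2) powr (\<alpha> - 1))) \<in> borel_measurable ?B"
      by (intro measurable_restrict_space1) simp
    show "(\<lambda>z. ?d (hyperbolic_modulus z)) \<in> borel_measurable ?B"
      by (rule measurable_compose[OF m d])
  qed
  also have "distr \<dots> borel hyperbolic_modulus = density (distr ?B borel hyperbolic_modulus) ?d"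
    by (rule density_distr[OF d m, symmetric])
  also have "\<dots> = density lborel (\<lambda>u. ennreal (pi * (tanh (u / 2) * (1 - sqrad u))) * indicator {0..} u * ?d u)"
    unfolding distr_disc_modulus by (rule density_density_eq) simp_all
  also have "\<dots> = density lborel (modulus_density \<alpha>)"
  proof (rule density_cong)
    have "ennreal (pi * (tanh (u / 2) * (1 - sqrad u))) * ?d u = ennreal (\<alpha> * tanh (u / 2) * (1 - sqrad u) powr \<alpha>)" if "u \<ge> 0" for u
    proof -
      have "pi * (tanh (u / 2) * (1 - sqrad u)) * (\<alpha> / pi * (1 - sqrad u) powr (\<alpha> - 1)) =
        \<alpha> * tanh (u / 2) * (1 - sqrad u) powr \<alpha>"
        unfolding powr_one_minus_sqrad[of u \<alpha>] by simp
      then show ?thesis using that assms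
        by (subst ennreal_mult[symmetric]) (auto simp: less_imp_le)
    qed
    then show "AE u in lborel. ennreal (pi * (tanh (u / 2) * (1 - sqrad u))) * indicator {0..} u * ?d u = ennreal (modulus_density \<alpha> u)"
      by (intro AE_I2) (auto simp: modulus_density_def indicator_def)
  qed simp_all
  finally show ?thesis .
qed

lemma integral_radial:
  fixes \<gamma> :: "real \<Rightarrow> 'b :: {banach, second_countable_topology}"
  assumes "\<alpha> > 0" and [measurable]: "\<gamma> \<in> borel_measurable borel"
  shows "(\<integral>z. \<gamma> (hyperbolic_modulus z) \<partial>hyperbolic_measure \<alpha>) = (\<integral>u. modulus_density \<alpha> u *\<^sub>R \<gamma> u \<partial>lborel)"
proof -
  have "(\<integral>z. \<gamma> (hyperbolic_modulus z) \<partial>hyperbolic_measure \<alpha>) = (\<integral>u. \<gamma> u \<partial>distr (hyperbolic_measure \<alpha>) borel hyperbolic_modulus)"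
    by (rule integral_distr[symmetric]) simp_all
  also have "\<dots> = (\<integral>u. modulus_density \<alpha> u *\<^sub>R \<gamma> u \<partial>lborel)"
    unfolding distr_hyperbolic_modulus[OF assms(1)]
    by (rule integral_density) (auto simp: modulus_density_nonneg assms)
  finally show ?thesis .
qed

text \<open>Besides being Taylor coefficients, these are the reciprocals of the squared norms of the
  monomials z^n in L^2 of the hyperbolic measure: that is the content of
  \<open>has_bochner_integral_modulus_density\<close>.\<close>

definition disc_coeff :: "real \<Rightarrow> nat \<Rightarrow> real" where
  "disc_coeff \<alpha> n = pochhammer (\<alpha> + 1) n / fact n"

lemma disc_coeff_pos: "\<alpha> > 0 \<Longrightarrow> disc_coeff \<alpha> n > 0"
  by (simp add: disc_coeff_def pochhammer_pos)

lemma disc_coeff_0 [simp]: "disc_coeff \<alpha> 0 = 1" by (simp add: disc_coeff_def)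

lemma disc_coeff_Suc: "disc_coeff \<alpha> (Suc n) = disc_coeff \<alpha> n * (\<alpha> + 1 + n) / (n + 1)"
  by (simp add: disc_coeff_def pochhammer_Suc field_simps)

lemma disc_coeff_sums_complex:
  assumes "norm z < 1"
  shows "(\<lambda>n. of_real (disc_coeff \<alpha> n) * z ^ n) sums (1 - z) powr (- (complex_of_real \<alpha> + 1))"
proof -
  have "of_real (disc_coeff \<alpha> n) * z ^ n = ((- (complex_of_real \<alpha> + 1)) gchoose n) * (- z) ^ n" for n
  proof -
    have "pochhammer (complex_of_real \<alpha> + 1) n = of_real (pochhammer (\<alpha> + 1) n)"
      using pochhammer_of_real[of "\<alpha> + 1" n, where 'a = complex] by simp
    then have "((- (complex_of_real \<alpha> + 1)) gchoose n) = (- 1) ^ n * of_real (disc_coeff \<alpha> n)"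
      unfolding gbinomial_pochhammer disc_coeff_def minus_minus by simp
    then show ?thesis unfolding power_minus[of z] by (cases "even n") simp_all
  qed
  then show ?thesis using gen_binomial_complex[of "- z" "- (complex_of_real \<alpha> + 1)"] assms by simp
qed

lemma disc_coeff_sums:
  assumes "\<bar>t\<bar> < 1"
  shows "(\<lambda>n. disc_coeff \<alpha> n * t ^ n) sums (1 - t) powr (- (\<alpha> + 1))"
proof -
  have "disc_coeff \<alpha> n * t ^ n = ((- (\<alpha> + 1)) gchoose n) * (- t) ^ n" for n
    by (cases "even n") (simp_all add: gbinomial_pochhammer disc_coeff_def add.commute[of \<alpha> 1])
  then show ?thesis using gen_binomial_real[of "- t" "- (\<alpha> + 1)"] assms by simp
qed

text \<open>Integration by parts: the derivative of \<open>T\<^sup>n\<^sup>+\<^sup>1 (1 - T)\<^sup>\<alpha>\<close> integrates to \<open>0\<close> over the half line.\<close>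

lemma has_bochner_integral_modulus_density:
  assumes \<alpha>: "\<alpha> > 0"
  shows "has_bochner_integral lborel (\<lambda>u. disc_coeff \<alpha> n * sqrad u ^ n * modulus_density \<alpha> u) 1"
proof (induction n)
  case 0
  have "(\<integral>\<^sup>+u. ennreal (\<alpha> * tanh (u / 2) * (1 - sqrad u) powr \<alpha>) * indicator {0..} u \<partial>lborel) = ennreal (0 - (- ((1 - sqrad 0) powr \<alpha>)))"
  proof (rule nn_integral_FTC_atLeast[where F = "\<lambda>u. - ((1 - sqrad u) powr \<alpha>)"])
    show "((\<lambda>u. - ((1 - sqrad u) powr \<alpha>)) has_real_derivative \<alpha> * tanh (u / 2) * (1 - sqrad u) powr \<alpha>) (at u)" for u
      by (rule derivative_eq_intros has_real_derivative_sqrad refl | simp)+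
         (simp add: powr_one_minus_sqrad[of u \<alpha>])
    have "((\<lambda>u. (1 - sqrad u) powr \<alpha>) \<longlongrightarrow> (1 - 1) powr \<alpha>) at_top"
      using \<alpha> by (intro tendsto_powr' tendsto_diff tendsto_const tendsto_sqrad_at_top) (auto simp: less_imp_le)
    then show "((\<lambda>u. - ((1 - sqrad u) powr \<alpha>)) \<longlongrightarrow> 0) at_top"
      using tendsto_minus by fastforce
  qed (use \<alpha> in auto)
  then have "(\<integral>\<^sup>+u. ennreal (modulus_density \<alpha> u) \<partial>lborel) = ennreal 1"
    by (subst nn_integral_cong[where v = "\<lambda>u. ennreal (\<alpha> * tanh (u / 2) * (1 - sqrad u) powr \<alpha>) * indicator {0..} u"])
       (auto simp: modulus_density_def indicator_def sqrad_def)
  then show ?case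
    by (intro has_bochner_integral_nn_integral) (auto simp: modulus_density_nonneg \<alpha>)
next
  case (Suc n)
  let ?I = "\<lambda>n u. sqrad u ^ n * modulus_density \<alpha> u"
  have c: "disc_coeff \<alpha> n \<noteq> 0" using disc_coeff_pos[OF \<alpha>, of n] by simp
  from has_bochner_integral_mult_right[OF Suc.IH, of "1 / disc_coeff \<alpha> n"]
  have I: "has_bochner_integral lborel (?I n) (1 / disc_coeff \<alpha> n)" using c by simp
  have int: "integrable lborel (?I (Suc n))"
  proof (rule Bochner_Integration.integrable_bound)
    show "integrable lborel (?I n)" using I by (rule has_bochner_integral_iff[THEN iffD1, THEN conjunct1])
    show "AE u in lborel. norm (?I (Suc n) u) \<le> norm (?I n u)"
      using less_imp_le[OF sqrad_less_one] by (intro AE_I2) (simp add: abs_mult mult.assoc mult_left_le_one_le)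
  qed measurable
  define J where "J = (\<integral>u. ?I (Suc n) u \<partial>lborel)"
  let ?F = "\<lambda>u. sqrad u ^ Suc n * (1 - sqrad u) powr \<alpha>"
  let ?f = "\<lambda>u. (real (Suc n) * sqrad u ^ n * (1 - sqrad u) - \<alpha> * sqrad u ^ Suc n) * (tanh (u / 2) * (1 - sqrad u) powr \<alpha>)"
  \<comment> \<open>Splitting s^n (1 - s) into s^n - s^(n+1) expresses the derivative through the
    moments of order n and n + 1.\<close>
  have f: "indicator {0..} u *\<^sub>R ?f u = (real (Suc n) / \<alpha>) * ?I n u - (real (Suc n) / \<alpha> + 1) * ?I (Suc n) u" for u
    using \<alpha> by (auto simp: modulus_density_def indicator_def field_simps)
  have int_f: "has_bochner_integral lborel (\<lambda>u. indicator {0..} u *\<^sub>R ?f u)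
      ((real (Suc n) / \<alpha>) * (1 / disc_coeff \<alpha> n) - (real (Suc n) / \<alpha> + 1) * J)"
    unfolding f J_def
    by (intro has_bochner_integral_diff has_bochner_integral_mult_right I has_bochner_integral_integrable int)
  have "((\<lambda>y. LBINT u:{0..y}. ?f u) \<longlongrightarrow> (LBINT u:{0..}. ?f u)) at_top"
    by (rule tendsto_set_lebesgue_integral_at_top) (use int_f in \<open>auto simp: set_integrable_def has_bochner_integral_iff\<close>)
  moreover have "\<forall>\<^sub>F y in at_top. (LBINT u:{0..y}. ?f u) = ?F y"
    using eventually_ge_at_top[of 0]
  proof eventually_elim
    case (elim y)
    have "(LBINT u:{0..y}. ?f u) = ?F y - ?F 0"
      unfolding set_lebesgue_integral_def
    proof (rule integral_FTC_Icc[OF elim])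
      fix u
      have "(?F has_real_derivative ?f u) (at u)"
        by (rule derivative_eq_intros has_real_derivative_sqrad refl | simp)+
           (simp add: powr_one_minus_sqrad[of u \<alpha>] algebra_simps)
      then show "(?F has_vector_derivative ?f u) (at u within {0..y})"
        by (simp add: has_real_derivative_iff_has_vector_derivative has_vector_derivative_at_within)
      have "continuous_on UNIV sqrad" unfolding sqrad_def by (intro continuous_intros) auto
      then show "continuous_on {0..y} ?f"
        by (intro continuous_intros continuous_on_powr') (auto intro: continuous_on_subset)
    qed
    then show ?case by (simp add: sqrad_def)
  qed
  ultimately have "(?F \<longlongrightarrow> (LBINT u:{0..}. ?f u)) at_top" by (rule Lim_transform_eventually)
  moreover have "(?F \<longlongrightarrow> 1 ^ Suc n * (1 - 1) powr \<alpha>) at_top"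
    using \<alpha> by (intro tendsto_mult tendsto_power tendsto_powr' tendsto_diff tendsto_const tendsto_sqrad_at_top) (auto simp: less_imp_le)
  ultimately have "(LBINT u:{0..}. ?f u) = 0" using tendsto_unique[OF trivial_limit_at_top_linorder] by fastforce
  with int_f have J: "(real (Suc n) / \<alpha>) * (1 / disc_coeff \<alpha> n) = (real (Suc n) / \<alpha> + 1) * J"
    unfolding set_lebesgue_integral_def by (simp add: has_bochner_integral_iff)
  have "r / c = (r + \<alpha>) * J" if "(r / \<alpha>) * (1 / c) = (r / \<alpha> + 1) * J" "c \<noteq> 0" for r c :: real
    using that \<alpha> by (simp add: field_simps)
  \<comment> \<open>The recursion J = (n + 1) / (c (n + 1 + \<alpha>)), with c the n-th coefficient,
    is the reciprocal of the recursion \<open>disc_coeff_Suc\<close>.\<close>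
  from this[OF J c] have "disc_coeff \<alpha> (Suc n) * J = 1"
    using \<alpha> c by (simp add: disc_coeff_Suc field_simps)
  then have "has_bochner_integral lborel (\<lambda>u. disc_coeff \<alpha> (Suc n) * ?I (Suc n) u) 1"
    using has_bochner_integral_mult_right[OF has_bochner_integral_integrable[OF int], of "disc_coeff \<alpha> (Suc n)"]
    by (simp add: J_def)
  then show ?case by (simp add: mult.assoc)
qed

lemma prob_space_hyperbolic_measure:
  assumes "\<alpha> > 0" shows "prob_space (hyperbolic_measure \<alpha>)"
proof -
  let ?N = "distr (hyperbolic_measure \<alpha>) borel hyperbolic_modulus"
  have "(\<integral>\<^sup>+u. ennreal (modulus_density \<alpha> u) \<partial>lborel) = 1"
    using has_bochner_integral_modulus_density[OF assms, of 0]
    by (subst nn_integral_eq_integral) (auto simp: has_bochner_integral_iff modulus_density_nonneg assms)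
  then have "emeasure ?N (space ?N) = 1"
    by (simp add: distr_hyperbolic_modulus assms emeasure_density cong: nn_integral_cong_simp)
  then have "emeasure (hyperbolic_measure \<alpha>) (hyperbolic_modulus -` UNIV \<inter> space (hyperbolic_measure \<alpha>)) = 1"
    by (subst (asm) emeasure_distr) auto
  then show ?thesis by (intro prob_spaceI) simp
qed

section \<open>Rotation invariance and truncated kernels\<close>

lemma borel_measurable_Complex: "(\<lambda>(x, y). Complex x y) \<in> borel_measurable borel"
  unfolding Complex_eq split_beta' by (intro borel_measurable_continuous_onI continuous_intros)

lemma distr_complex_lborel: "distr lborel borel (\<lambda>(x, y). Complex x y) = lborel"
proof (rule lborel_eqI[symmetric])
  fix l u :: complex assume le: "\<And>b. b \<in> Basis \<Longrightarrow> l \<bullet> b \<le> u \<bullet> b"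
  have "emeasure (distr lborel borel (\<lambda>(x, y). Complex x y)) (box l u) =
    emeasure lborel ((\<lambda>(x, y). Complex x y) -` box l u \<inter> space (lborel :: (real \<times> real) measure))"
    by (rule emeasure_distr) (simp_all only: measurable_lborel1 measurable_lborel2 borel_measurable_Complex sets_distr open_box borel_open)
  also have "(\<lambda>(x, y). Complex x y) -` box l u \<inter> space (lborel :: (real \<times> real) measure) = {Re l<..<Re u} \<times> {Im l<..<Im u}"
    by (auto simp: in_box_complex_iff)
  also have "emeasure lborel \<dots> = emeasure (lborel \<Otimes>\<^sub>M lborel) ({Re l<..<Re u} \<times> {Im l<..<Im u})"
    by (simp only: lborel_prod)
  also have "\<dots> = ennreal ((Re u - Re l) * (Im u - Im l))"
    using le[of 1] le[of \<i>]
    by (subst lborel.emeasure_pair_measure_Times) (simp_all add: ennreal_mult)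
  also have "\<dots> = ennreal (\<Prod>b\<in>Basis. (u - l) \<bullet> b)"
    by (simp add: Basis_complex_def)
  finally show "emeasure (distr lborel borel (\<lambda>(x, y). Complex x y)) (box l u) = (\<Prod>b\<in>Basis. (u - l) \<bullet> b)" .
qed simp

text \<open>On each horizontal line the shear is a translation, so Fubini reduces the claim to
  translation invariance on the real line.\<close>

lemma distr_shear_fst: "distr lborel borel (\<lambda>(x, y). (x + s * y, y)) = (lborel :: (real \<times> real) measure)"
proof (rule measure_eqI)
  have m: "(\<lambda>(x, y). (x + s * y, y)) \<in> borel_measurable (borel :: (real \<times> real) measure)"
    unfolding borel_prod[symmetric] by measurable
  fix A assume "A \<in> sets (distr lborel borel (\<lambda>(x, y). (x + s * y, y)))"
  then have A: "A \<in> sets (borel :: (real \<times> real) measure)" by simp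
  have A' [measurable]: "A \<in> sets (borel \<Otimes>\<^sub>M borel)" using A by (simp only: borel_prod)
  have "emeasure (distr lborel borel (\<lambda>(x, y). (x + s * y, y))) A = (\<integral>\<^sup>+z. indicator A z \<partial>distr lborel borel (\<lambda>(x, y). (x + s * y, y)))"
    using A by simp
  also have "\<dots> = (\<integral>\<^sup>+z. indicator A (fst z + s * snd z, snd z) \<partial>lborel)"
    using m A by (subst nn_integral_distr) (auto simp: split_beta')
  also have "\<dots> = (\<integral>\<^sup>+z. indicator A (fst z + s * snd z, snd z) \<partial>(lborel \<Otimes>\<^sub>M lborel))"
    by (simp add: lborel_prod)
  also have "\<dots> = (\<integral>\<^sup>+y. \<integral>\<^sup>+x. indicator A (x + s * y, y) \<partial>lborel \<partial>lborel)"
    by (subst lborel_pair.nn_integral_snd[symmetric]) auto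
  also have "\<dots> = (\<integral>\<^sup>+y. \<integral>\<^sup>+x. indicator A (x, y) \<partial>lborel \<partial>lborel)"
  proof (rule nn_integral_cong)
    fix y :: real
    show "(\<integral>\<^sup>+x. indicator A (x + s * y, y) \<partial>lborel) = (\<integral>\<^sup>+x. indicator A (x, y) \<partial>lborel)"
      using nn_integral_real_affine[of "\<lambda>x. indicator A (x, y)" 1 "s * y"] by (simp add: add.commute)
  qed
  also have "\<dots> = (\<integral>\<^sup>+z. indicator A z \<partial>(lborel \<Otimes>\<^sub>M lborel))"
    by (subst lborel_pair.nn_integral_snd[symmetric]) auto
  also have "\<dots> = emeasure lborel A" using A by (simp add: lborel_prod)
  finally show "emeasure (distr lborel borel (\<lambda>(x, y). (x + s * y, y))) A = emeasure lborel A" .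
qed simp

lemma distr_shear_snd: "distr lborel borel (\<lambda>(x, y). (x, y + s * x)) = (lborel :: (real \<times> real) measure)"
proof (rule measure_eqI)
  have m: "(\<lambda>(x, y). (x, y + s * x)) \<in> borel_measurable (borel :: (real \<times> real) measure)"
    unfolding borel_prod[symmetric] by measurable
  fix A assume "A \<in> sets (distr lborel borel (\<lambda>(x, y). (x, y + s * x)))"
  then have A: "A \<in> sets (borel :: (real \<times> real) measure)" by simp
  have A' [measurable]: "A \<in> sets (borel \<Otimes>\<^sub>M borel)" using A by (simp only: borel_prod)
  have "emeasure (distr lborel borel (\<lambda>(x, y). (x, y + s * x))) A = (\<integral>\<^sup>+z. indicator A z \<partial>distr lborel borel (\<lambda>(x, y). (x, y + s * x)))"
    using A by simp
  also have "\<dots> = (\<integral>\<^sup>+z. indicator A (fst z, snd z + s * fst z) \<partial>lborel)"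
    using m A by (subst nn_integral_distr) (auto simp: split_beta')
  also have "\<dots> = (\<integral>\<^sup>+z. indicator A (fst z, snd z + s * fst z) \<partial>(lborel \<Otimes>\<^sub>M lborel))"
    by (simp add: lborel_prod)
  also have "\<dots> = (\<integral>\<^sup>+x. \<integral>\<^sup>+y. indicator A (x, y + s * x) \<partial>lborel \<partial>lborel)"
    by (subst lborel.nn_integral_fst[symmetric]) auto
  also have "\<dots> = (\<integral>\<^sup>+x. \<integral>\<^sup>+y. indicator A (x, y) \<partial>lborel \<partial>lborel)"
  proof (rule nn_integral_cong)
    fix x :: real
    show "(\<integral>\<^sup>+y. indicator A (x, y + s * x) \<partial>lborel) = (\<integral>\<^sup>+y. indicator A (x, y) \<partial>lborel)"
      using nn_integral_real_affine[of "\<lambda>y. indicator A (x, y)" 1 "s * x"] by (simp add: add.commute)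
  qed
  also have "\<dots> = (\<integral>\<^sup>+z. indicator A z \<partial>(lborel \<Otimes>\<^sub>M lborel))"
    by (subst lborel.nn_integral_fst[symmetric]) auto
  also have "\<dots> = emeasure lborel A" using A by (simp add: lborel_prod)
  finally show "emeasure (distr lborel borel (\<lambda>(x, y). (x, y + s * x))) A = emeasure lborel A" .
qed simp

text \<open>A rotation by an angle with non-zero sine is a product of three shears.\<close>

lemma distr_rotation:
  assumes "sin \<theta> \<noteq> 0"
  shows "distr lborel borel ((*) (cis \<theta>)) = (lborel :: complex measure)"
proof -
  \<comment> \<open>This is -tan (\<theta>/2), the parameter for which the shear by s, the shear by
    sin \<theta> and the shear by s again compose to the rotation; \<open>1\<close> and
    \<open>2\<close> below are the two matrix identities behind it.\<close>
  define s where "s = (cos \<theta> - 1) / sin \<theta>"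
  let ?C = "\<lambda>(x::real, y). Complex x y"
  let ?S = "\<lambda>(x::real, y::real). (x + s * y, y)" and ?T = "\<lambda>(x::real, y::real). (x, y + sin \<theta> * x)"
  have mC: "?C \<in> borel_measurable borel" by (rule borel_measurable_Complex)
  have mS: "?S \<in> borel_measurable borel"
    unfolding split_beta' by (intro borel_measurable_continuous_onI continuous_intros)
  have mT: "?T \<in> borel_measurable borel"
    unfolding split_beta' by (intro borel_measurable_continuous_onI continuous_intros)
  have mR: "(*) (cis \<theta>) \<in> borel_measurable borel"
    by (intro borel_measurable_continuous_onI continuous_intros)
  have 1: "1 + s * sin \<theta> = cos \<theta>" using assms by (simp add: s_def)
  have "s * (1 + cos \<theta>) = - sin \<theta>"
  proof -
    have "(cos \<theta> - 1) * (1 + cos \<theta>) = - (sin \<theta>)\<^sup>2"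
      by (simp add: sin_squared_eq algebra_simps power2_eq_square)
    then show ?thesis using assms by (simp add: s_def field_simps power2_eq_square)
  qed
  then have 2: "s * cos \<theta> + s = - sin \<theta>" by (simp add: algebra_simps)
  have comp: "cis \<theta> * ?C p = ?C (?S (?T (?S p)))" for p
  proof -
    obtain x y where p: "p = (x, y)" by fastforce
    have "x + s * y + s * (y + sin \<theta> * (x + s * y)) = (1 + s * sin \<theta>) * x + (s * (1 + s * sin \<theta>) + s) * y"
      by (simp add: algebra_simps)
    also have "\<dots> = cos \<theta> * x - sin \<theta> * y" by (simp add: 1 2)
    finally have a: "x + s * y + s * (y + sin \<theta> * (x + s * y)) = cos \<theta> * x - sin \<theta> * y" .
    have "y + sin \<theta> * (x + s * y) = sin \<theta> * x + (1 + s * sin \<theta>) * y" by (simp add: algebra_simps)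
    then have b: "y + sin \<theta> * (x + s * y) = sin \<theta> * x + cos \<theta> * y" by (simp add: 1)
    show ?thesis using a b by (simp add: p complex_eq_iff)
  qed
  have push: "distr lborel borel (F \<circ> G) = distr (distr lborel borel G) borel F"
    if "F \<in> borel_measurable borel" "G \<in> borel_measurable borel"
    for F :: "'p :: euclidean_space \<Rightarrow> 'q :: topological_space" and G :: "real \<times> real \<Rightarrow> 'p"
    using that by (intro distr_distr[symmetric]) simp_all
  have "distr (lborel :: complex measure) borel ((*) (cis \<theta>)) = distr (distr lborel borel ?C) borel ((*) (cis \<theta>))"
    by (simp only: distr_complex_lborel)
  also have "\<dots> = distr lborel borel ((*) (cis \<theta>) \<circ> ?C)"
    by (rule push[OF mR mC, symmetric])
  also have "(*) (cis \<theta>) \<circ> ?C = ?C \<circ> (?S \<circ> (?T \<circ> ?S))"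
    by (simp only: fun_eq_iff comp_def comp simp_thms)
  also have "distr lborel borel (?C \<circ> (?S \<circ> (?T \<circ> ?S))) = lborel"
    by (simp only: push measurable_comp[OF mS mT] measurable_comp[OF measurable_comp[OF mS mT] mS] mC mS mT
        distr_shear_fst distr_shear_snd distr_complex_lborel)
  finally show ?thesis .
qed

lemma hyperbolic_weight_measurable:
  "(\<lambda>z::complex. (1 - (norm z)\<^sup>2) powr (\<alpha> - 1)) \<in> borel_measurable borel"
  by (intro powr_real_measurable[OF borel_measurable_continuous_onI borel_measurable_const] continuous_intros)

lemma integral_hyperbolic_measure:
  fixes F :: "complex \<Rightarrow> complex"
  assumes \<alpha>: "\<alpha> > 0" and F: "F \<in> borel_measurable borel"
  shows "(\<integral>z. F z \<partial>hyperbolic_measure \<alpha>) =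
    (\<integral>z. (indicator (ball 0 1) z * (\<alpha> / pi * (1 - (norm z)\<^sup>2) powr (\<alpha> - 1))) *\<^sub>R F z \<partial>lborel)"
proof -
  have "(\<integral>z. F z \<partial>hyperbolic_measure \<alpha>) = (\<integral>z. (\<alpha> / pi * (1 - (norm z)\<^sup>2) powr (\<alpha> - 1)) *\<^sub>R F z \<partial>restrict_space lborel (ball 0 1))"
    unfolding hyperbolic_measure_def
  proof (rule integral_density)
    show "F \<in> borel_measurable (restrict_space lborel (ball 0 1))"
      by (rule measurable_restrict_space1) (simp only: F measurable_lborel1 measurable_lborel2)
    show "(\<lambda>z::complex. \<alpha> / pi * (1 - (norm z)\<^sup>2) powr (\<alpha> - 1)) \<in> borel_measurable (restrict_space lborel (ball 0 1))"
      by (rule measurable_restrict_space1)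
         (simp only: measurable_lborel1 measurable_lborel2 borel_measurable_times borel_measurable_const hyperbolic_weight_measurable)
    show "AE z in restrict_space lborel (ball (0::complex) 1). 0 \<le> \<alpha> / pi * (1 - (norm z)\<^sup>2) powr (\<alpha> - 1)"
      using \<alpha> by (intro AE_I2 mult_nonneg_nonneg) auto
  qed
  then show ?thesis by (simp add: integral_restrict_space)
qed

lemma integral_hyperbolic_rotate:
  fixes F :: "complex \<Rightarrow> complex"
  assumes \<alpha>: "\<alpha> > 0" and F: "F \<in> borel_measurable borel" and \<theta>: "sin \<theta> \<noteq> 0"
  shows "(\<integral>z. F (cis \<theta> * z) \<partial>hyperbolic_measure \<alpha>) = (\<integral>z. F z \<partial>hyperbolic_measure \<alpha>)"
proof -
  let ?d = "\<lambda>z::complex. indicator (ball 0 1) z * (\<alpha> / pi * (1 - (norm z)\<^sup>2) powr (\<alpha> - 1)) :: real"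
  have d: "?d \<in> borel_measurable borel"
    by (intro borel_measurable_times borel_measurable_indicator borel_measurable_const
        hyperbolic_weight_measurable borel_open open_ball)
  have m: "(*) (cis \<theta>) \<in> borel_measurable borel"
    by (intro borel_measurable_continuous_onI continuous_intros)
  have "(\<integral>z. F z \<partial>hyperbolic_measure \<alpha>) = (\<integral>z. ?d z *\<^sub>R F z \<partial>distr lborel borel ((*) (cis \<theta>)))"
    unfolding integral_hyperbolic_measure[OF \<alpha> F] distr_rotation[OF \<theta>] ..
  also have "\<dots> = (\<integral>z. ?d (cis \<theta> * z) *\<^sub>R F (cis \<theta> * z) \<partial>lborel)"
    by (rule integral_distr) (simp_all only: measurable_lborel1 measurable_lborel2 m borel_measurable_scaleR[OF d F])
  also have "\<dots> = (\<integral>z. ?d z *\<^sub>R F (cis \<theta> * z) \<partial>lborel)"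
    by (simp add: norm_mult indicator_def)
  also have "\<dots> = (\<integral>z. F (cis \<theta> * z) \<partial>hyperbolic_measure \<alpha>)"
    by (rule integral_hyperbolic_measure[symmetric, OF \<alpha> measurable_compose[OF m F]])
  finally show ?thesis by simp
qed

section \<open>Orthogonality of monomials for radial weights, and the determinant of a truncated
  kernel\<close>

lemma monomial_measurable: "(\<lambda>z. z ^ a * cnj z ^ b) \<in> borel_measurable borel"
  by (intro borel_measurable_continuous_onI continuous_intros)

text \<open>A rotation leaves the integral unchanged and also multiplies it by a phase; a phase
  other than 1 forces it to be 0.\<close>

lemma radial_orthogonality:
  fixes g :: "complex \<Rightarrow> complex"
  assumes \<alpha>: "\<alpha> > 0" and g: "g \<in> borel_measurable borel" "\<And>z \<theta>. g (cis \<theta> * z) = g z" and "a \<noteq> b"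
  shows "(\<integral>z. g z * (z ^ a * cnj z ^ b) \<partial>hyperbolic_measure \<alpha>) = 0"
proof -
  \<comment> \<open>The angle makes \<theta> |a - b| a right angle, so the phase is \<i> or -\<i>;
    since |a - b| is at least 1, \<theta> lies strictly between 0 and \<pi> and its sine is not
    0.\<close>
  define \<theta> where "\<theta> = pi / (2 * \<bar>real a - real b\<bar>)"
  have ge: "\<bar>real a - real b\<bar> \<ge> 1" using \<open>a \<noteq> b\<close> by linarith
  have "0 < \<theta>" "\<theta> < pi" using ge pi_gt_zero by (auto simp: \<theta>_def field_simps intro: less_le_trans)
  then have s: "sin \<theta> \<noteq> 0" using sin_gt_zero[of \<theta>] by simp
  let ?I = "\<integral>z. g z * (z ^ a * cnj z ^ b) \<partial>hyperbolic_measure \<alpha>"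
  let ?c = "cis \<theta> ^ a * cnj (cis \<theta>) ^ b"
  have m: "(\<lambda>z. g z * (z ^ a * cnj z ^ b)) \<in> borel_measurable borel"
    by (intro borel_measurable_times g(1) monomial_measurable)
  have "?I = (\<integral>z. g (cis \<theta> * z) * ((cis \<theta> * z) ^ a * cnj (cis \<theta> * z) ^ b) \<partial>hyperbolic_measure \<alpha>)"
    by (rule integral_hyperbolic_rotate[symmetric, OF \<alpha> m s])
  also have "\<dots> = (\<integral>z. ?c * (g z * (z ^ a * cnj z ^ b)) \<partial>hyperbolic_measure \<alpha>)"
    unfolding g(2) complex_cnj_mult power_mult_distrib by (simp only: mult_ac)
  also have "\<dots> = ?c * ?I" by simp
  finally have "(1 - ?c) * ?I = 0" by (simp add: algebra_simps)
  moreover have "?c \<noteq> 1"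
  proof -
    have "?c = cis (\<theta> * (real a - real b))"
      by (simp only: cis_cnj Complex.DeMoivre cis_mult) (simp add: algebra_simps)
    moreover have "\<theta> * (real a - real b) = pi / 2 \<or> \<theta> * (real a - real b) = - (pi / 2)"
      using ge by (cases "real a \<ge> real b") (auto simp: \<theta>_def field_simps)
    then have "cos (\<theta> * (real a - real b)) = 0" by (auto simp only: cos_minus cos_pi_half)
    then have "cis (\<theta> * (real a - real b)) \<noteq> 1" by (simp add: complex_eq_iff)
    ultimately show ?thesis by simp
  qed
  ultimately show ?thesis by simp
qed

text \<open>Since z^n times its conjugate is |z|^(2n), this is the mean of g under the law of degree
  n. For radial g it is also the eigenvalue, at z^n, of multiplication by g followed by projection
  to the holomorphic functions.\<close>

definition radial_moment :: "real \<Rightarrow> (complex \<Rightarrow> complex) \<Rightarrow> nat \<Rightarrow> complex" where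
  "radial_moment \<alpha> g n = of_real (disc_coeff \<alpha> n) * (\<integral>z. g z * (z ^ n * cnj z ^ n) \<partial>hyperbolic_measure \<alpha>)"

text \<open>The kernel of the orthogonal projection onto polynomials of degree less than N.\<close>

definition truncated_kernel :: "real \<Rightarrow> nat \<Rightarrow> complex \<Rightarrow> complex \<Rightarrow> complex" where
  "truncated_kernel \<alpha> N z w = (\<Sum>n<N. of_real (disc_coeff \<alpha> n) * (z * cnj w) ^ n)"

locale radial_function =
  fixes \<alpha> r L :: real and g :: "complex \<Rightarrow> complex"
  assumes \<alpha>: "\<alpha> > 0" and r: "0 \<le> r" "r < 1"
    and g_meas [measurable]: "g \<in> borel_measurable borel"
    and g_radial: "\<And>z \<theta>. g (cis \<theta> * z) = g z"
    and g_bound: "\<And>z. norm (g z) \<le> L"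
    and g_supp: "\<And>z. z \<notin> cball 0 r \<Longrightarrow> g z = 0"
begin

abbreviation "\<mu> \<equiv> hyperbolic_measure \<alpha>"

sublocale prob_space \<mu> by (rule prob_space_hyperbolic_measure[OF \<alpha>])

sublocale P: product_sigma_finite "\<lambda>_::nat. \<mu>" ..

lemma L_nonneg: "0 \<le> L"
  using g_bound[of 0] norm_ge_zero[of "g 0"] by linarith

lemma norm_weighted_monomial_le: "norm (g z * (z ^ a * cnj z ^ b)) \<le> L * r ^ (a + b)"
proof (cases "z \<in> cball 0 r")
  case True
  then have "norm z ^ (a + b) \<le> r ^ (a + b)" by (intro power_mono) auto
  then have "norm (g z) * norm z ^ (a + b) \<le> L * r ^ (a + b)"
    using g_bound[of z] L_nonneg by (intro mult_mono) auto
  then show ?thesis by (simp add: norm_mult norm_power power_add)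
next
  case False
  then show ?thesis using g_supp[OF False] L_nonneg r by simp
qed

lemma integrable_weighted_monomial: "integrable \<mu> (\<lambda>z. g z * (z ^ a * cnj z ^ b))"
proof (rule integrable_const_bound)
  show "AE z in \<mu>. norm (g z * (z ^ a * cnj z ^ b)) \<le> L * r ^ (a + b)"
    by (intro AE_I2 norm_weighted_monomial_le)
  show "(\<lambda>z. g z * (z ^ a * cnj z ^ b)) \<in> borel_measurable \<mu>"
    by (intro measurable_hyperbolic_measure borel_measurable_times g_meas monomial_measurable)
qed

text \<open>Only the disc of radius r contributes and the measure has mass 1. Geometric decay of
  r^(2n) makes the bound summable over n, with sum L \<open>kernel_bound\<close>.\<close>

lemma norm_radial_moment_le: "norm (radial_moment \<alpha> g n) \<le> L * (disc_coeff \<alpha> n * (r\<^sup>2) ^ n)"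
proof -
  have "norm (\<integral>z. g z * (z ^ n * cnj z ^ n) \<partial>\<mu>) \<le> (\<integral>z. norm (g z * (z ^ n * cnj z ^ n)) \<partial>\<mu>)"
    by (rule integral_norm_bound)
  also have "\<dots> \<le> (\<integral>z. L * r ^ (n + n) \<partial>\<mu>)"
    by (intro integral_mono integrable_norm integrable_weighted_monomial norm_weighted_monomial_le) simp
  also have "\<dots> = L * r ^ (n + n)" using prob_space by simp
  finally have "disc_coeff \<alpha> n * norm (\<integral>z. g z * (z ^ n * cnj z ^ n) \<partial>\<mu>) \<le> disc_coeff \<alpha> n * (L * r ^ (n + n))"
    using disc_coeff_pos[OF \<alpha>, of n] by (intro mult_left_mono) auto
  moreover have "r ^ (n + n) = (r\<^sup>2) ^ n" by (simp add: power_add power_mult_distrib power2_eq_square)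
  ultimately show ?thesis
    using disc_coeff_pos[OF \<alpha>, of n] by (simp add: radial_moment_def norm_mult mult_ac)
qed

text \<open>Multiplying out the product of kernels gives a sum over degree tuples n. Collecting
  powers by coordinate instead of by kernel factor prepares the integration over one variable at a
  time.\<close>

lemma truncated_det_expansion:
  "(\<Prod>i<k. g (x i)) * kernel_det (truncated_kernel \<alpha> N) k x =
    (\<Sum>p | p permutes {0..<k}. signof p * (\<Sum>n\<in>{..<k} \<rightarrow>\<^sub>E {..<N}.
      \<Prod>i<k. of_real (disc_coeff \<alpha> (n i)) * (g (x i) * (x i ^ n i * cnj (x i) ^ n (Hilbert_Choice.inv p i)))))"
proof -
  have "(\<Prod>i<k. g (x i)) * (\<Prod>i<k. truncated_kernel \<alpha> N (x i) (x (p i))) =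
     (\<Sum>n\<in>{..<k} \<rightarrow>\<^sub>E {..<N}. \<Prod>i<k. of_real (disc_coeff \<alpha> (n i)) * (g (x i) * (x i ^ n i * cnj (x i) ^ n (Hilbert_Choice.inv p i))))"
    if "p permutes {0..<k}" for p
  proof -
    have p: "p permutes {..<k}" using that by (simp add: lessThan_atLeast0)
    have "(\<Prod>i<k. truncated_kernel \<alpha> N (x i) (x (p i))) =
      (\<Sum>n\<in>{..<k} \<rightarrow>\<^sub>E {..<N}. \<Prod>i<k. of_real (disc_coeff \<alpha> (n i)) * (x i * cnj (x (p i))) ^ n i)"
      unfolding truncated_kernel_def by (rule prod_sum_PiE) auto
    also have "\<dots> = (\<Sum>n\<in>{..<k} \<rightarrow>\<^sub>E {..<N}. \<Prod>i<k. of_real (disc_coeff \<alpha> (n i)) * (x i ^ n i * cnj (x i) ^ n (Hilbert_Choice.inv p i)))"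
    proof (rule sum.cong[OF refl])
      fix n :: "nat \<Rightarrow> nat"
      \<comment> \<open>Reindexing by p: the conjugate of x (p i) carries the exponent n i, so that
        of x i carries the exponent at the preimage of i.\<close>
      have "(\<Prod>i<k. cnj (x (p i)) ^ n i) = (\<Prod>i<k. cnj (x i) ^ n (Hilbert_Choice.inv p i))"
        using prod.permute[OF p, of "\<lambda>i. cnj (x i) ^ n (Hilbert_Choice.inv p i)"]
        by (simp add: comp_def permutes_inverses(2)[OF p])
      then show "(\<Prod>i<k. of_real (disc_coeff \<alpha> (n i)) * (x i * cnj (x (p i))) ^ n i) =
        (\<Prod>i<k. of_real (disc_coeff \<alpha> (n i)) * (x i ^ n i * cnj (x i) ^ n (Hilbert_Choice.inv p i)))"
        by (simp add: prod.distrib power_mult_distrib)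
    qed
    finally show ?thesis
      by (simp add: sum_distrib_left prod.distrib mult_ac)
  qed
  then show ?thesis
    unfolding kernel_det_eq sum_distrib_left[of "\<Prod>i<k. g (x i)"]
    by (intro sum.cong refl) (simp add: mult.left_commute)
qed

text \<open>The integral factors over the coordinates, and orthogonality keeps a permutation only if
  it leaves the degree tuple invariant. Exchanging the two sums leaves the signed count of such
  permutations, which is 1 for distinct degrees and 0 otherwise.\<close>

lemma has_bochner_integral_truncated_det:
  "has_bochner_integral (\<Pi>\<^sub>M i\<in>{..<k}. \<mu>) (\<lambda>x. (\<Prod>i<k. g (x i)) * kernel_det (truncated_kernel \<alpha> N) k x)
    (\<Sum>n\<in>inj_tuples k {..<N}. \<Prod>i<k. radial_moment \<alpha> g (n i))"
proof -
  let ?P = "\<Pi>\<^sub>M i\<in>{..<k}. \<mu>"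
  let ?q = "radial_moment \<alpha> g"
  let ?E = "{..<k} \<rightarrow>\<^sub>E {..<N}"
  have one: "has_bochner_integral ?P
      (\<lambda>x. \<Prod>i<k. of_real (disc_coeff \<alpha> (n i)) * (g (x i) * (x i ^ n i * cnj (x i) ^ n (Hilbert_Choice.inv p i))))
      ((\<Prod>i<k. ?q (n i)) * (if \<forall>i<k. n i = n (p i) then 1 else 0))"
    if p: "p permutes {0..<k}" for p and n :: "nat \<Rightarrow> nat"
  proof -
    let ?f = "\<lambda>i z. of_real (disc_coeff \<alpha> (n i)) * (g z * (z ^ n i * cnj z ^ n (Hilbert_Choice.inv p i)))"
    have int: "integrable \<mu> (?f i)" for i
      by (intro integrable_mult_right integrable_weighted_monomial)
    have f: "integral\<^sup>L \<mu> (?f i) = (if n i = n (Hilbert_Choice.inv p i) then ?q (n i) else 0)" for i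
      using radial_orthogonality[OF \<alpha> g_meas g_radial, of "n i" "n (Hilbert_Choice.inv p i)"]
      by (auto simp: radial_moment_def)
    have "(\<Prod>i<k. integral\<^sup>L \<mu> (?f i)) = (\<Prod>i<k. ?q (n i)) * (if \<forall>i<k. n i = n (Hilbert_Choice.inv p i) then 1 else 0)"
      unfolding f by (cases "\<forall>i<k. n i = n (Hilbert_Choice.inv p i)") (auto intro!: prod_zero)
    moreover have "(\<forall>i<k. n i = n (Hilbert_Choice.inv p i)) \<longleftrightarrow> (\<forall>i<k. n i = n (p i))"
      using p permutes_inverses[OF p] permutes_in_image[OF p] permutes_in_image[OF permutes_inv[OF p]]
      by (metis atLeastLessThan_iff zero_le)
    ultimately show ?thesis
      using P.product_integral_prod[of "{..<k}" ?f, OF _ int] P.product_integrable_prod[of "{..<k}" ?f, OF _ int]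
      by (simp add: has_bochner_integral_iff)
  qed
  have "has_bochner_integral ?P (\<lambda>x. (\<Prod>i<k. g (x i)) * kernel_det (truncated_kernel \<alpha> N) k x)
    (\<Sum>p | p permutes {0..<k}. signof p * (\<Sum>n\<in>?E. (\<Prod>i<k. ?q (n i)) * (if \<forall>i<k. n i = n (p i) then 1 else 0)))"
    unfolding truncated_det_expansion
    by (intro has_bochner_integral_sum has_bochner_integral_mult_right one) simp
  also have "(\<Sum>p | p permutes {0..<k}. signof p * (\<Sum>n\<in>?E. (\<Prod>i<k. ?q (n i)) * (if \<forall>i<k. n i = n (p i) then 1 else 0))) =
    (\<Sum>n\<in>?E. (\<Prod>i<k. ?q (n i)) * (\<Sum>p | p permutes {0..<k}. signof p * (if \<forall>i<k. n i = n (p i) then 1 else 0)))"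
    unfolding sum_distrib_left by (subst sum.swap) (simp only: mult.left_commute)
  also have "\<dots> = (\<Sum>n\<in>?E. if inj_on n {..<k} then \<Prod>i<k. ?q (n i) else 0)"
    unfolding sum_signof_stabilizer by (intro sum.cong refl) simp
  also have "\<dots> = (\<Sum>n\<in>inj_tuples k {..<N}. \<Prod>i<k. ?q (n i))"
    unfolding inj_tuples_def by (subst sum.inter_filter) (auto intro!: finite_PiE)
  finally show ?thesis .
qed

end

section \<open>The generating functional on a disc\<close>

lemma tendsto_truncated_kernel:
  assumes "norm z < 1" "norm w < 1"
  shows "(\<lambda>N. truncated_kernel \<alpha> N z w) \<longlonglongrightarrow> hyperbolic_kernel \<alpha> z w"
proof -
  have "norm (z * cnj w) < 1"
    using mult_strict_mono[of "norm z" 1 "norm w" 1] assms by (simp add: norm_mult)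
  from disc_coeff_sums_complex[OF this, of \<alpha>] show ?thesis
    by (simp add: sums_def truncated_kernel_def hyperbolic_kernel_def)
qed

context radial_function
begin

text \<open>The value of the kernel on the diagonal at |z| = r. All Taylor coefficients are
  positive, so it dominates the kernel and its truncations on the disc of radius r.\<close>

definition "kernel_bound = (1 - r\<^sup>2) powr (- (\<alpha> + 1))"

lemma disc_coeff_sums_radius: "(\<lambda>n. disc_coeff \<alpha> n * (r\<^sup>2) ^ n) sums kernel_bound"
proof -
  have "r\<^sup>2 < 1" using r by (simp add: abs_square_less_1)
  then show ?thesis unfolding kernel_bound_def by (intro disc_coeff_sums) auto
qed

lemma sum_disc_coeff_le: "(\<Sum>n<N. disc_coeff \<alpha> n * (r\<^sup>2) ^ n) \<le> kernel_bound"
  unfolding sums_unique[OF disc_coeff_sums_radius]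
  by (rule sum_le_suminf[OF sums_summable[OF disc_coeff_sums_radius]])
     (auto intro!: mult_nonneg_nonneg less_imp_le[OF disc_coeff_pos] \<alpha>)

lemma kernel_bound_nonneg: "0 \<le> kernel_bound" by (simp add: kernel_bound_def)

lemma norm_truncated_kernel_le:
  assumes "z \<in> cball 0 r" "w \<in> cball 0 r"
  shows "norm (truncated_kernel \<alpha> N z w) \<le> kernel_bound"
proof -
  have zw: "norm (z * cnj w) \<le> r\<^sup>2"
    using assms r by (auto simp: norm_mult power2_eq_square intro!: mult_mono)
  have "norm (truncated_kernel \<alpha> N z w) \<le> (\<Sum>n<N. norm (of_real (disc_coeff \<alpha> n) * (z * cnj w) ^ n))"
    unfolding truncated_kernel_def by (rule norm_sum)
  also have "\<dots> \<le> (\<Sum>n<N. disc_coeff \<alpha> n * (r\<^sup>2) ^ n)"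
  proof (rule sum_mono)
    fix n
    have "norm (z * cnj w) ^ n \<le> (r\<^sup>2) ^ n" by (intro power_mono zw norm_ge_zero)
    then show "norm (of_real (disc_coeff \<alpha> n) * (z * cnj w) ^ n) \<le> disc_coeff \<alpha> n * (r\<^sup>2) ^ n"
      using disc_coeff_pos[OF \<alpha>, of n] by (simp only: norm_mult norm_power norm_of_real) (simp add: mult_left_mono)
  qed
  also have "\<dots> \<le> kernel_bound" by (rule sum_disc_coeff_le)
  finally show ?thesis .
qed

lemma norm_hyperbolic_kernel_le:
  assumes "z \<in> cball 0 r" "w \<in> cball 0 r"
  shows "norm (hyperbolic_kernel \<alpha> z w) \<le> kernel_bound"
proof (rule tendsto_upperbound)
  show "(\<lambda>N. norm (truncated_kernel \<alpha> N z w)) \<longlonglongrightarrow> norm (hyperbolic_kernel \<alpha> z w)"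
    using assms r by (intro tendsto_norm tendsto_truncated_kernel) auto
  show "eventually (\<lambda>N. norm (truncated_kernel \<alpha> N z w) \<le> kernel_bound) sequentially"
    using norm_truncated_kernel_le[OF assms] by simp
qed simp

lemma tendsto_truncated_det:
  assumes "x \<in> ({..<k} \<rightarrow>\<^sub>E cball 0 r)"
  shows "(\<lambda>N. kernel_det (truncated_kernel \<alpha> N) k x) \<longlonglongrightarrow> kernel_det (hyperbolic_kernel \<alpha>) k x"
  unfolding kernel_det_eq
proof (intro tendsto_sum tendsto_mult tendsto_const tendsto_prod)
  fix p i assume p: "p \<in> {p. p permutes {0..<k}}" and i: "i \<in> {..<k}"
  then have "p i < k" using permutes_in_image[of p "{0..<k}" i] by auto
  then have "x i \<in> cball 0 r" "x (p i) \<in> cball 0 r" using assms i by (auto simp: PiE_iff)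
  then show "(\<lambda>N. truncated_kernel \<alpha> N (x i) (x (p i))) \<longlonglongrightarrow> hyperbolic_kernel \<alpha> (x i) (x (p i))"
    using r by (intro tendsto_truncated_kernel) auto
qed

lemma prod_eq_0_outside:
  fixes k :: nat
  assumes "x \<in> space (\<Pi>\<^sub>M i\<in>{..<k}. \<mu>)" "x \<notin> ({..<k} \<rightarrow>\<^sub>E cball 0 r)"
  shows "(\<Prod>i<k. g (x i)) = 0"
proof -
  have "\<exists>i<k. x i \<notin> cball 0 r" using assms by (auto simp: space_PiM PiE_iff)
  then show ?thesis using g_supp by (intro prod_zero) auto
qed

text \<open>For fixed k the integrands converge and are bounded by one constant on a product of
  probability spaces. Outside the product of discs the weight is 0, so the integral over the whole
  space is the one over the window.\<close>

lemma tendsto_truncated_moment: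
  "(\<lambda>N. \<Sum>n\<in>inj_tuples k {..<N}. \<Prod>i<k. radial_moment \<alpha> g (n i)) \<longlonglongrightarrow>
    (LINT x:({..<k} \<rightarrow>\<^sub>E cball 0 r)|(\<Pi>\<^sub>M i\<in>{..<k}. \<mu>). (\<Prod>i<k. g (x i)) * kernel_det (hyperbolic_kernel \<alpha>) k x)"
proof -
  let ?P = "\<Pi>\<^sub>M i\<in>{..<k}. \<mu>"
  let ?D = "{..<k} \<rightarrow>\<^sub>E cball 0 r"
  interpret PM: prob_space ?P by (intro prob_space_PiM prob_space_axioms)
  let ?f = "\<lambda>N x. (\<Prod>i<k. g (x i)) * kernel_det (truncated_kernel \<alpha> N) k x"
  let ?F = "\<lambda>x. indicator ?D x *\<^sub>R ((\<Prod>i<k. g (x i)) * kernel_det (hyperbolic_kernel \<alpha>) k x)"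
  let ?b = "L ^ k * (fact k * kernel_bound ^ k)"
  have int: "integrable ?P (?f N)" "integral\<^sup>L ?P (?f N) = (\<Sum>n\<in>inj_tuples k {..<N}. \<Prod>i<k. radial_moment \<alpha> g (n i))" for N
    using has_bochner_integral_truncated_det[of k N] by (auto simp: has_bochner_integral_iff)
  have lim: "(\<lambda>N. ?f N x) \<longlonglongrightarrow> ?F x" if x: "x \<in> space ?P" for x
  proof (cases "x \<in> ?D")
    case True
    have "(\<lambda>N. ?f N x) \<longlonglongrightarrow> (\<Prod>i<k. g (x i)) * kernel_det (hyperbolic_kernel \<alpha>) k x"
      by (intro tendsto_mult tendsto_const tendsto_truncated_det True)
    then show ?thesis using True by simp
  next
    case False
    then show ?thesis using prod_eq_0_outside[OF x False] by (simp only: mult_zero_left scaleR_zero_right tendsto_const)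
  qed
  have F_meas: "?F \<in> borel_measurable ?P"
    by (rule borel_measurable_LIMSEQ_metric[OF borel_measurable_integrable[OF int(1)] lim])
  have bound: "norm (?f N x) \<le> ?b" if x: "x \<in> space ?P" for N x
  proof (cases "x \<in> ?D")
    case True
    have "(\<Prod>i<k. norm (g (x i))) \<le> (\<Prod>i<k. L)" by (intro prod_mono) (auto intro: g_bound)
    moreover have "norm (kernel_det (truncated_kernel \<alpha> N) k x) \<le> fact k * kernel_bound ^ k"
      using True by (intro norm_kernel_det_le norm_truncated_kernel_le) (auto simp: PiE_iff)
    ultimately show ?thesis
      unfolding norm_mult prod_norm[symmetric] using L_nonneg by (intro mult_mono) auto
  next
    case False
    have "0 \<le> ?b" using L_nonneg kernel_bound_nonneg by auto
    then show ?thesis by (simp only: prod_eq_0_outside[OF x False] mult_zero_left norm_zero)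
  qed
  have "(\<lambda>N. integral\<^sup>L ?P (?f N)) \<longlonglongrightarrow> integral\<^sup>L ?P ?F"
  proof (rule integral_dominated_convergence[OF F_meas borel_measurable_integrable[OF int(1)]])
    show "integrable ?P (\<lambda>_. ?b)" by simp
    show "AE x in ?P. (\<lambda>N. ?f N x) \<longlonglongrightarrow> ?F x" using lim by (intro AE_I2)
    show "AE x in ?P. norm (?f N x) \<le> ?b" for N using bound by (intro AE_I2)
  qed
  then show ?thesis unfolding int(2) set_lebesgue_integral_def .
qed

text \<open>Read off from the evaluated sum rather than from the determinant, this bound has no
  factor k!, which is what allows the later summation over k for any L.\<close>

lemma norm_truncated_moment_le:
  "norm (\<Sum>n\<in>inj_tuples k {..<N}. \<Prod>i<k. radial_moment \<alpha> g (n i)) \<le> (L * kernel_bound) ^ k"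
proof -
  have "norm (\<Sum>n\<in>inj_tuples k {..<N}. \<Prod>i<k. radial_moment \<alpha> g (n i)) \<le> (\<Sum>n<N. norm (radial_moment \<alpha> g n)) ^ k"
    by (rule norm_sum_inj_tuples_le) simp
  also have "\<dots> \<le> (L * kernel_bound) ^ k"
  proof (rule power_mono)
    have "(\<Sum>n<N. norm (radial_moment \<alpha> g n)) \<le> (\<Sum>n<N. L * (disc_coeff \<alpha> n * (r\<^sup>2) ^ n))"
      by (intro sum_mono norm_radial_moment_le)
    also have "\<dots> \<le> L * kernel_bound"
      unfolding sum_distrib_left[symmetric] by (intro mult_left_mono sum_disc_coeff_le L_nonneg)
    finally show "(\<Sum>n<N. norm (radial_moment \<alpha> g n)) \<le> L * kernel_bound" .
  qed (simp add: sum_nonneg)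
  finally show ?thesis .
qed

lemma determinantal_window_cball:
  assumes "hyperbolic_ensemble \<alpha> M X"
  shows "determinantal_window M \<mu> (hyperbolic_kernel \<alpha>) X (cball 0 r) kernel_bound"
proof (rule determinantal_window.intro)
  show "determinantal_process M \<mu> (hyperbolic_kernel \<alpha>) X" using assms by (simp add: hyperbolic_ensemble_def)
  show "finite_measure \<mu>" by (rule finite_measure_axioms)
  have sub: "cball 0 r \<subseteq> (ball 0 1 :: complex set)" using r by auto
  then show "precompact_in (space \<mu>) (cball 0 r)"
    unfolding precompact_in_def space_hyperbolic_measure by (intro exI[of _ "cball 0 r"]) auto
  show "cball 0 r \<in> sets borel" by simp
  show "cball 0 r \<in> sets \<mu>"
    unfolding sets_hyperbolic_measure using sub by (subst sets_restrict_space_iff) auto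
  show "norm (hyperbolic_kernel \<alpha> z w) \<le> kernel_bound" if "z \<in> cball 0 r" "w \<in> cball 0 r" for z w
    using norm_hyperbolic_kernel_le that .
qed

lemma finite_window:
  assumes "hyperbolic_ensemble \<alpha> M X" "\<omega> \<in> space M"
  shows "finite (X \<omega> \<inter> cball 0 r)"
proof -
  interpret W: determinantal_window M \<mu> "hyperbolic_kernel \<alpha>" X "cball 0 r" kernel_bound
    by (rule determinantal_window_cball[OF assms(1)])
  show ?thesis by (rule determinantal_finite_inter[OF W.det W.pre assms(2)])
qed

text \<open>The case of the indicator of the disc, with L = 1. It bounds the k-th factorial moment
  of the number of points by a k-th power and so gives absolute convergence of the generating
  functional.\<close>

lemma expectation_card_inj_tuples_le:
  assumes "hyperbolic_ensemble \<alpha> M X"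
  shows "(\<integral>\<omega>. real (card (inj_tuples k (X \<omega> \<inter> cball 0 r))) \<partial>M) \<le> kernel_bound ^ k"
proof -
  interpret W: determinantal_window M \<mu> "hyperbolic_kernel \<alpha>" X "cball 0 r" kernel_bound
    by (rule determinantal_window_cball[OF assms])
  let ?i = "\<lambda>z. if z \<in> cball 0 r then 1 else 0 :: complex"
  interpret I: radial_function \<alpha> r 1 ?i
    by standard (use \<alpha> r in \<open>auto simp: norm_mult\<close>)
  let ?J = "\<lambda>\<omega>. \<Sum>x\<in>inj_tuples k (X \<omega> \<inter> cball 0 r). \<Prod>i<k. ?i (x i)"
  have J: "?J \<omega> = of_real (card (inj_tuples k (X \<omega> \<inter> cball 0 r)))" for \<omega>
  proof -
    have "(\<Prod>i<k. ?i (x i)) = 1" if "x \<in> inj_tuples k (X \<omega> \<inter> cball 0 r)" for x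
      using that by (intro prod.neutral) (simp add: inj_tuples_def PiE_iff)
    then show ?thesis by simp
  qed
  have "(\<lambda>N. \<Sum>n\<in>inj_tuples k {..<N}. \<Prod>i<k. radial_moment \<alpha> ?i (n i)) \<longlonglongrightarrow> (\<integral>\<omega>. ?J \<omega> \<partial>M)"
    using I.tendsto_truncated_moment[of k] W.factorial_moment(3)[OF I.g_meas I.g_bound, of k] by simp
  then have "norm (\<integral>\<omega>. ?J \<omega> \<partial>M) \<le> (1 * kernel_bound) ^ k"
    using I.norm_truncated_moment_le[of k] unfolding I.kernel_bound_def kernel_bound_def
    by (intro tendsto_upperbound[OF tendsto_norm]) auto
  also have "(\<integral>\<omega>. ?J \<omega> \<partial>M) = of_real (\<integral>\<omega>. real (card (inj_tuples k (X \<omega> \<inter> cball 0 r))) \<partial>M)"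
    unfolding J by (rule integral_complex_of_real)
  finally show ?thesis by simp
qed

text \<open>The product over the points is a series of factorial sums divided by k!. Expectation and
  series are exchanged by absolute summability, each expectation is a limit over truncations N, and
  this limit is exchanged with the sum over k.\<close>

theorem expectation_prod_one_plus:
  assumes H: "hyperbolic_ensemble \<alpha> M X"
  shows "integrable M (\<lambda>\<omega>. \<Prod>z\<in>X \<omega> \<inter> cball 0 r. 1 + g z)"
    and "(\<lambda>N. \<Prod>n<N. 1 + radial_moment \<alpha> g n) \<longlonglongrightarrow> (\<integral>\<omega>. (\<Prod>z\<in>X \<omega> \<inter> cball 0 r. 1 + g z) \<partial>M)"
proof -
  interpret W: determinantal_window M \<mu> "hyperbolic_kernel \<alpha>" X "cball 0 r" kernel_bound
    by (rule determinantal_window_cball[OF H])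
  let ?A = "\<lambda>\<omega>. X \<omega> \<inter> cball 0 r"
  let ?J = "\<lambda>k \<omega>. (\<Sum>x\<in>inj_tuples k (?A \<omega>). \<Prod>i<k. g (x i)) / fact k"
  let ?e = "\<lambda>k N. (\<Sum>n\<in>inj_tuples k {..<N}. \<Prod>i<k. radial_moment \<alpha> g (n i)) / fact k"
  have fin: "finite (?A \<omega>)" if "\<omega> \<in> space M" for \<omega> by (rule finite_window[OF H that])
  have J_int: "integrable M (?J k)" for k
    by (intro integrable_divide_zero W.factorial_moment(1)[OF g_meas g_bound])
  have J_sums: "(\<lambda>k. ?J k \<omega>) sums (\<Prod>z\<in>?A \<omega>. 1 + g z)" if "\<omega> \<in> space M" for \<omega>
    by (rule prod_one_plus_sums_inj_tuples[OF fin[OF that]])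
  have J_fin: "summable (\<lambda>k. norm (?J k \<omega>))" if "\<omega> \<in> space M" for \<omega>
  proof (rule summable_finite[of "{..card (?A \<omega>)}"])
    show "norm (?J k \<omega>) = 0" if "k \<notin> {..card (?A \<omega>)}" for k
      using that inj_tuples_empty_if_card_less[OF fin[OF \<open>\<omega> \<in> space M\<close>], of k] by simp
  qed simp
  have J_le: "norm (?J k \<omega>) \<le> L ^ k / fact k * real (card (inj_tuples k (?A \<omega>)))" for k \<omega>
  proof -
    have "norm (\<Prod>i<k. g (x i)) \<le> L ^ k" for x
      using prod_mono[of "{..<k}" "\<lambda>i. norm (g (x i))" "\<lambda>_. L"] g_bound by (simp add: prod_norm)
    then have "norm (\<Sum>x\<in>inj_tuples k (?A \<omega>). \<Prod>i<k. g (x i)) \<le> (\<Sum>x\<in>inj_tuples k (?A \<omega>). L ^ k)"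
      by (intro sum_norm_le)
    then show ?thesis by (simp add: norm_divide field_simps)
  qed
  have EJ_le: "(\<integral>\<omega>. norm (?J k \<omega>) \<partial>M) \<le> (L * kernel_bound) ^ k / fact k" for k
  proof -
    have "(\<integral>\<omega>. norm (?J k \<omega>) \<partial>M) \<le> (\<integral>\<omega>. L ^ k / fact k * real (card (inj_tuples k (?A \<omega>))) \<partial>M)"
      by (intro integral_mono integrable_norm J_int integrable_mult_right W.integrable_card_inj_tuples J_le)
    also have "\<dots> \<le> L ^ k / fact k * kernel_bound ^ k"
      using expectation_card_inj_tuples_le[OF H, of k] L_nonneg by (simp add: mult_left_mono divide_right_mono)
    finally show ?thesis by (simp add: power_mult_distrib)
  qed
  have exp_summable: "summable (\<lambda>k. (L * kernel_bound) ^ k / fact k)"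
    using summable_exp[of "L * kernel_bound"] by (simp add: field_simps)
  have sum_EJ: "summable (\<lambda>k. \<integral>\<omega>. norm (?J k \<omega>) \<partial>M)"
    by (rule summable_comparison_test'[OF exp_summable, of 0]) (use EJ_le in auto)
  have ae: "AE \<omega> in M. summable (\<lambda>k. norm (?J k \<omega>))" using J_fin by (intro AE_I2)
  have suminf_J: "(\<Sum>k. ?J k \<omega>) = (\<Prod>z\<in>?A \<omega>. 1 + g z)" if "\<omega> \<in> space M" for \<omega>
    using sums_unique[OF J_sums[OF that]] by simp
  show "integrable M (\<lambda>\<omega>. \<Prod>z\<in>?A \<omega>. 1 + g z)"
    using integrable_suminf[OF J_int ae sum_EJ] suminf_J
    by (simp cong: Bochner_Integration.integrable_cong)
  have E: "(\<integral>\<omega>. (\<Prod>z\<in>?A \<omega>. 1 + g z) \<partial>M) = (\<Sum>k. \<integral>\<omega>. ?J k \<omega> \<partial>M)"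
    using integral_suminf[OF J_int ae sum_EJ] suminf_J
    by (simp cong: Bochner_Integration.integral_cong)
  have lim: "(\<lambda>N. ?e k N) \<longlonglongrightarrow> (\<integral>\<omega>. ?J k \<omega> \<partial>M)" for k
  proof -
    have "(\<integral>\<omega>. ?J k \<omega> \<partial>M) = (\<integral>\<omega>. (\<Sum>x\<in>inj_tuples k (?A \<omega>). \<Prod>i<k. g (x i)) \<partial>M) / fact k"
      by simp
    then show ?thesis
      unfolding W.factorial_moment(3)[OF g_meas g_bound, of k]
      by (simp only:) (intro tendsto_divide tendsto_truncated_moment tendsto_const, simp)
  qed
  have bound: "norm (?e k N) \<le> (L * kernel_bound) ^ k / fact k" for k N
    using norm_truncated_moment_le[of k N] by (simp add: norm_divide divide_right_mono)
  \<comment> \<open>Dominated convergence for series; the majorant is the exponential series at L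
    \<open>kernel_bound\<close>, independent of N.\<close>
  have "((\<lambda>N. \<Sum>k. ?e k N) \<longlongrightarrow> (\<Sum>k. \<integral>\<omega>. ?J k \<omega> \<partial>M)) sequentially"
    by (rule tannerys_theorem[OF lim _ exp_summable, THEN conjunct2, THEN conjunct2])
       (use bound in \<open>auto intro!: always_eventually\<close>)
  \<comment> \<open>The expansion of a finite product is now read backwards, with the degrees n < N
    in the role of points.\<close>
  moreover have "(\<Sum>k. ?e k N) = (\<Prod>n<N. 1 + radial_moment \<alpha> g n)" for N
    using sums_unique[OF prod_one_plus_sums_inj_tuples[of "{..<N}" "radial_moment \<alpha> g"]] by simp
  ultimately show "(\<lambda>N. \<Prod>n<N. 1 + radial_moment \<alpha> g n) \<longlonglongrightarrow> (\<integral>\<omega>. (\<Prod>z\<in>?A \<omega>. 1 + g z) \<partial>M)"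
    by (simp add: E)
qed

end

section \<open>Characteristic functions of radial statistics\<close>

text \<open>From below by convexity; from above because the third-order Taylor remainder at -u is
  not positive.\<close>

lemma abs_exp_minus_one_plus_le:
  assumes "u \<ge> (0::real)"
  shows "\<bar>exp (- u) - (1 - u)\<bar> \<le> u\<^sup>2 / 2"
proof -
  have "1 - u \<le> exp (- u)" using exp_ge_add_one_self[of "- u"] by simp
  moreover have "exp (- u) \<le> 1 - u + u\<^sup>2 / 2"
  proof -
    have "\<exists>t. \<bar>t\<bar> \<le> \<bar>- u\<bar> \<and> exp (- u) = (\<Sum>m<3. (- u) ^ m / fact m) + exp t / fact 3 * (- u) ^ 3"
      by (rule Maclaurin_exp_le)
    then obtain t where "exp (- u) = (\<Sum>m<3. (- u) ^ m / fact m) + exp t / fact 3 * (- u) ^ 3" by blast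
    moreover have "(\<Sum>m<3. (- u) ^ m / fact m) = 1 - u + u\<^sup>2 / 2"
      by (simp add: numeral_3_eq_3 power2_eq_square)
    moreover have "exp t / fact 3 * (- u) ^ 3 \<le> 0"
      using assms by (intro mult_nonneg_nonpos) auto
    ultimately show ?thesis by linarith
  qed
  ultimately show ?thesis by linarith
qed

lemma (in prob_space) norm_iexp_expectation_le:
  fixes \<phi> :: "'a \<Rightarrow> real"
  shows "norm (expectation (\<lambda>x. iexp (\<tau> * \<phi> x))) \<le> 1"
proof -
  have "norm (expectation (\<lambda>x. iexp (\<tau> * \<phi> x))) \<le> expectation (\<lambda>x. norm (iexp (\<tau> * \<phi> x)))"
    by (rule integral_norm_bound)
  then show ?thesis by (simp add: prob_space)
qed

text \<open>Both terms are compared with 1 - \<tau>^2 v / 2. The centred variable is at most 2 B, so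
  its third absolute moment is at most 2 B v, giving |\<tau>|^3 B / 3; and v \<le> 4 B^2 turns
  \<tau>^4 v^2 / 8 into \<tau>^4 B^2 v / 2. The error is proportional to the variance, hence
  summable over the modes.\<close>

lemma (in prob_space) gaussian_approximation:
  fixes \<phi> :: "'a \<Rightarrow> real"
  assumes \<phi> [measurable]: "\<phi> \<in> borel_measurable M" and B: "\<And>x. \<bar>\<phi> x\<bar> \<le> B"
  shows "norm (expectation (\<lambda>x. iexp (\<tau> * \<phi> x)) * iexp (- \<tau> * expectation \<phi>) - exp (- (\<tau>\<^sup>2 * variance \<phi> / 2)))
    \<le> (\<bar>\<tau>\<bar> ^ 3 * B / 3 + \<tau> ^ 4 * B\<^sup>2 / 2) * variance \<phi>"
proof -
  have B0: "0 \<le> B" using B[of undefined] by linarith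
  have int: "integrable M \<phi>"
    by (rule integrable_const_bound[of _ B]) (use B in auto)
  define m where "m = expectation \<phi>"
  define X where "X x = \<phi> x - m" for x
  have m: "\<bar>m\<bar> \<le> B"
  proof -
    have "\<bar>m\<bar> \<le> expectation (\<lambda>x. \<bar>\<phi> x\<bar>)" unfolding m_def by (rule integral_abs_bound)
    also have "\<dots> \<le> expectation (\<lambda>x. B)" by (intro integral_mono integrable_abs int) (use B in auto)
    finally show ?thesis by (simp add: prob_space)
  qed
  have X_meas [measurable]: "X \<in> borel_measurable M" unfolding X_def by measurable
  have X: "\<bar>X x\<bar> \<le> 2 * B" for x using B[of x] m unfolding X_def by linarith
  have X2: "(X x)\<^sup>2 \<le> 4 * B\<^sup>2" for x
    using power_mono[OF X[of x], of 2] by (simp add: power_mult_distrib)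
  have X_int: "integrable M X" unfolding X_def using int by simp
  have X2_int: "integrable M (\<lambda>x. (X x)\<^sup>2)"
    by (rule integrable_const_bound[of _ "4 * B\<^sup>2"]) (use X2 in auto)
  have EX: "expectation X = 0" unfolding X_def using int by (simp add: m_def prob_space)
  define v where "v = variance \<phi>"
  have v: "v = expectation (\<lambda>x. (X x)\<^sup>2)" by (simp add: v_def X_def m_def)
  have v0: "0 \<le> v" unfolding v by simp
  have v4: "v \<le> 4 * B\<^sup>2"
  proof -
    have "v \<le> expectation (\<lambda>x. 4 * B\<^sup>2)" unfolding v by (intro integral_mono X2_int X2) simp
    then show ?thesis by (simp add: prob_space)
  qed
  have c3: "cmod (char (distr M borel X) \<tau> - (1 - \<tau>\<^sup>2 * v / 2)) \<le>
    (\<tau>\<^sup>2 / 6) * expectation (\<lambda>x. min (6 * (X x)\<^sup>2) (\<bar>\<tau>\<bar> * \<bar>X x\<bar> ^ 3))"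
    by (rule char_approx3') (use X_int X2_int EX v in auto)
  have "expectation (\<lambda>x. min (6 * (X x)\<^sup>2) (\<bar>\<tau>\<bar> * \<bar>X x\<bar> ^ 3)) \<le> expectation (\<lambda>x. \<bar>\<tau>\<bar> * (2 * B) * (X x)\<^sup>2)"
  proof (rule integral_mono)
    show "min (6 * (X x)\<^sup>2) (\<bar>\<tau>\<bar> * \<bar>X x\<bar> ^ 3) \<le> \<bar>\<tau>\<bar> * (2 * B) * (X x)\<^sup>2" for x
    proof -
      have "\<bar>\<tau>\<bar> * \<bar>X x\<bar> ^ 3 = \<bar>\<tau>\<bar> * (\<bar>X x\<bar> * (X x)\<^sup>2)" by (simp add: power3_eq_cube power2_eq_square)
      also have "\<dots> \<le> \<bar>\<tau>\<bar> * ((2 * B) * (X x)\<^sup>2)" by (intro mult_left_mono mult_right_mono X) auto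
      finally show ?thesis by simp
    qed
    show "integrable M (\<lambda>x. min (6 * (X x)\<^sup>2) (\<bar>\<tau>\<bar> * \<bar>X x\<bar> ^ 3))"
      by (rule Bochner_Integration.integrable_bound[OF integrable_mult_right[OF X2_int, of 6]])
         (auto intro!: AE_I2)
    show "integrable M (\<lambda>x. \<bar>\<tau>\<bar> * (2 * B) * (X x)\<^sup>2)" by (intro integrable_mult_right X2_int)
  qed
  also have "expectation (\<lambda>x. \<bar>\<tau>\<bar> * (2 * B) * (X x)\<^sup>2) = \<bar>\<tau>\<bar> * (2 * B) * v" by (simp add: v)
  finally have "(\<tau>\<^sup>2 / 6) * expectation (\<lambda>x. min (6 * (X x)\<^sup>2) (\<bar>\<tau>\<bar> * \<bar>X x\<bar> ^ 3)) \<le> (\<tau>\<^sup>2 / 6) * (\<bar>\<tau>\<bar> * (2 * B) * v)"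
    by (intro mult_left_mono) auto
  also have "\<dots> = \<bar>\<tau>\<bar> ^ 3 * B / 3 * v"
    by (simp add: power3_eq_cube power2_eq_square)
  finally have 1: "cmod (char (distr M borel X) \<tau> - (1 - \<tau>\<^sup>2 * v / 2)) \<le> \<bar>\<tau>\<bar> ^ 3 * B / 3 * v"
    using c3 by linarith
  have "\<bar>exp (- (\<tau>\<^sup>2 * v / 2)) - (1 - \<tau>\<^sup>2 * v / 2)\<bar> \<le> (\<tau>\<^sup>2 * v / 2)\<^sup>2 / 2"
    using v0 by (intro abs_exp_minus_one_plus_le) auto
  also have "\<dots> = \<tau> ^ 4 / 8 * (v * v)" by (simp add: power2_eq_square power4_eq_xxxx)
  also have "\<dots> \<le> \<tau> ^ 4 / 8 * (4 * B\<^sup>2 * v)" using v4 v0 by (intro mult_left_mono mult_right_mono) auto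
  also have "\<dots> = \<tau> ^ 4 * B\<^sup>2 / 2 * v" by simp
  finally have "cmod (of_real (1 - \<tau>\<^sup>2 * v / 2) - of_real (exp (- (\<tau>\<^sup>2 * v / 2)))) \<le> \<tau> ^ 4 * B\<^sup>2 / 2 * v"
    unfolding of_real_diff[symmetric] norm_of_real by (simp add: abs_minus_commute)
  then have 2: "cmod ((1 - \<tau>\<^sup>2 * v / 2) - exp (- (\<tau>\<^sup>2 * v / 2))) \<le> \<tau> ^ 4 * B\<^sup>2 / 2 * v" by simp
  have "char (distr M borel X) \<tau> = expectation (\<lambda>x. iexp (\<tau> * X x))"
    unfolding char_def by (rule integral_distr) measurable
  also have "\<dots> = expectation (\<lambda>x. iexp (\<tau> * \<phi> x) * iexp (- \<tau> * m))"
    by (rule Bochner_Integration.integral_cong) (auto simp: X_def algebra_simps exp_diff exp_minus field_simps)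
  also have "\<dots> = expectation (\<lambda>x. iexp (\<tau> * \<phi> x)) * iexp (- \<tau> * m)" by simp
  finally have "expectation (\<lambda>x. iexp (\<tau> * \<phi> x)) * iexp (- \<tau> * m) - exp (- (\<tau>\<^sup>2 * v / 2)) =
    (char (distr M borel X) \<tau> - (1 - \<tau>\<^sup>2 * v / 2)) + ((1 - \<tau>\<^sup>2 * v / 2) - exp (- (\<tau>\<^sup>2 * v / 2)))"
    by simp
  then have "norm (expectation (\<lambda>x. iexp (\<tau> * \<phi> x)) * iexp (- \<tau> * m) - exp (- (\<tau>\<^sup>2 * v / 2)))
    \<le> \<bar>\<tau>\<bar> ^ 3 * B / 3 * v + \<tau> ^ 4 * B\<^sup>2 / 2 * v"
    using norm_triangle_ineq order_trans[OF norm_triangle_ineq add_mono[OF 1 2]] by metis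
  then show ?thesis by (simp only: v_def m_def distrib_right)
qed

text \<open>The law of the hyperbolic modulus under the measure of degree n, that is, with density
  \<open>disc_coeff \<alpha> n\<close> |z|^(2n) with respect to the hyperbolic measure.\<close>

definition mode_law :: "real \<Rightarrow> nat \<Rightarrow> real measure" where
  "mode_law \<alpha> n = density lborel (\<lambda>u. ennreal (disc_coeff \<alpha> n * sqrad u ^ n * modulus_density \<alpha> u))"

lemma sets_mode_law [simp, measurable_cong]: "sets (mode_law \<alpha> n) = sets borel"
  by (simp add: mode_law_def)

lemma mode_density_nonneg: "\<alpha> > 0 \<Longrightarrow> 0 \<le> disc_coeff \<alpha> n * sqrad u ^ n * modulus_density \<alpha> u"
  by (intro mult_nonneg_nonneg modulus_density_nonneg zero_le_power sqrad_nonneg less_imp_le[OF disc_coeff_pos])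

lemma prob_space_mode_law:
  assumes "\<alpha> > 0" shows "prob_space (mode_law \<alpha> n)"
proof (rule prob_spaceI)
  have "(\<integral>\<^sup>+u. ennreal (disc_coeff \<alpha> n * sqrad u ^ n * modulus_density \<alpha> u) \<partial>lborel) = 1"
    using has_bochner_integral_modulus_density[OF assms, of n] mode_density_nonneg[OF assms]
    by (subst nn_integral_eq_integral) (auto simp: has_bochner_integral_iff)
  then show "emeasure (mode_law \<alpha> n) (space (mode_law \<alpha> n)) = 1"
    by (simp add: mode_law_def emeasure_density)
qed

lemma integral_mode_law:
  fixes \<gamma> :: "real \<Rightarrow> 'b :: {banach, second_countable_topology}"
  assumes "\<alpha> > 0" "\<gamma> \<in> borel_measurable borel"
  shows "(\<integral>u. \<gamma> u \<partial>mode_law \<alpha> n) = (\<integral>u. (disc_coeff \<alpha> n * sqrad u ^ n * modulus_density \<alpha> u) *\<^sub>R \<gamma> u \<partial>lborel)"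
  unfolding mode_law_def using assms mode_density_nonneg[OF assms(1)]
  by (intro integral_density) auto

section \<open>Characteristic function of the sum of a bounded function of the moduli in a
  disc\<close>

locale window_statistic =
  fixes \<alpha> B U :: real and \<phi> :: "real \<Rightarrow> real"
  assumes \<alpha>: "\<alpha> > 0" and U: "0 \<le> U"
    and \<phi>_meas [measurable]: "\<phi> \<in> borel_measurable borel"
    and \<phi>_bound: "\<And>u. \<bar>\<phi> u\<bar> \<le> B"
    and \<phi>_supp: "\<And>u. U < u \<Longrightarrow> \<phi> u = 0"
begin

definition "radius = tanh (U / 2)"

definition "mode_mean n = (\<integral>u. \<phi> u \<partial>mode_law \<alpha> n)"

definition "mode_second n = (\<integral>u. (\<phi> u)\<^sup>2 \<partial>mode_law \<alpha> n)"

lemma radius: "0 \<le> radius" "radius < 1"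
  using U by (auto simp: radius_def tanh_real_lt_1)

lemma B_nonneg: "0 \<le> B" using \<phi>_bound[of 0] by linarith

lemma bounded_measurable_mode:
  fixes \<gamma> :: "real \<Rightarrow> 'b :: {banach, second_countable_topology}"
  assumes "\<gamma> \<in> borel_measurable borel" "\<And>u. norm (\<gamma> u) \<le> b"
  shows "integrable (mode_law \<alpha> n) \<gamma>"
proof -
  interpret prob_space "mode_law \<alpha> n" by (rule prob_space_mode_law[OF \<alpha>])
  show ?thesis by (rule integrable_const_bound[of _ b]) (use assms in auto)
qed

lemma mode_variance:
  "prob_space.variance (mode_law \<alpha> n) \<phi> = mode_second n - (mode_mean n)\<^sup>2"
proof -
  interpret prob_space "mode_law \<alpha> n" by (rule prob_space_mode_law[OF \<alpha>])
  have i: "integrable (mode_law \<alpha> n) \<phi>" by (rule bounded_measurable_mode[of _ B]) (use \<phi>_bound in auto)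
  have "(\<phi> u)\<^sup>2 \<le> B\<^sup>2" for u using power_mono[OF \<phi>_bound[of u], of 2] by simp
  then have i2: "integrable (mode_law \<alpha> n) (\<lambda>u. (\<phi> u)\<^sup>2)" by (intro bounded_measurable_mode[of _ "B\<^sup>2"]) auto
  show ?thesis
    using variance_eq[OF i i2] by (simp add: mode_mean_def mode_second_def)
qed

text \<open>The cut-off changes nothing inside the unit disc, where \<phi> vanishes beyond the
  radius. Outside it \<open>hyperbolic_modulus\<close> is a default value at which \<phi> may be
  nonzero, so the support condition is imposed by hand.\<close>

definition "char_fun \<tau> z = (if z \<in> cball 0 radius then iexp (\<tau> * \<phi> (hyperbolic_modulus z)) - 1 else 0)"

lemma radial_function_char_fun: "radial_function \<alpha> radius 2 (char_fun \<tau>)"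
proof
  show "\<alpha> > 0" "0 \<le> radius" "radius < 1" by (fact \<alpha> radius)+
  show "char_fun \<tau> \<in> borel_measurable borel"
  proof -
    have "(\<lambda>x. iexp (\<tau> * x) - 1) \<in> borel_measurable borel"
      by (intro borel_measurable_continuous_onI continuous_intros)
    from measurable_compose[OF measurable_compose[OF hyperbolic_modulus_measurable \<phi>_meas] this]
    have "(\<lambda>z. indicator (cball 0 radius) z * (iexp (\<tau> * \<phi> (hyperbolic_modulus z)) - 1)) \<in> borel_measurable borel"
      by (intro borel_measurable_times borel_measurable_indicator borel_closed closed_cball)
    moreover have "char_fun \<tau> z = indicator (cball 0 radius) z * (iexp (\<tau> * \<phi> (hyperbolic_modulus z)) - 1)" for z
      by (simp add: char_fun_def)
    ultimately show ?thesis by presburger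
  qed
  show "char_fun \<tau> (cis \<theta> * z) = char_fun \<tau> z" for \<theta> z
    by (simp add: char_fun_def hyperbolic_modulus_def norm_mult)
  show "norm (char_fun \<tau> z) \<le> 2" for z
  proof -
    have "norm (iexp (\<tau> * \<phi> (hyperbolic_modulus z)) - 1) \<le> norm (iexp (\<tau> * \<phi> (hyperbolic_modulus z))) + norm (1::complex)"
      by (rule norm_triangle_ineq4)
    then show ?thesis by (simp add: char_fun_def)
  qed
  show "char_fun \<tau> z = 0" if "z \<notin> cball 0 radius" for z using that by (simp add: char_fun_def)
qed

text \<open>The 1 cancels the -1 in \<open>char_fun\<close> because the mode law has mass 1; so each
  factor of the product formula is a genuine characteristic function.\<close>

lemma one_plus_radial_moment_char_fun:
  "1 + radial_moment \<alpha> (char_fun \<tau>) n = (\<integral>u. iexp (\<tau> * \<phi> u) \<partial>mode_law \<alpha> n)"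
proof -
  interpret prob_space "mode_law \<alpha> n" by (rule prob_space_mode_law[OF \<alpha>])
  let ?\<gamma> = "\<lambda>u. of_real (sqrad u ^ n) * (iexp (\<tau> * \<phi> u) - 1)"
  have \<gamma>_meas: "?\<gamma> \<in> borel_measurable borel" by measurable
  have "(\<integral>z. char_fun \<tau> z * (z ^ n * cnj z ^ n) \<partial>hyperbolic_measure \<alpha>) = (\<integral>z. ?\<gamma> (hyperbolic_modulus z) \<partial>hyperbolic_measure \<alpha>)"
  proof (rule Bochner_Integration.integral_cong[OF refl])
    fix z assume "z \<in> space (hyperbolic_measure \<alpha>)"
    then have z: "norm z < 1" by simp
    have 1: "z ^ n * cnj z ^ n = of_real (sqrad (hyperbolic_modulus z) ^ n)"
      by (simp add: power_mult_distrib[symmetric] complex_norm_square[symmetric] sqrad_hyperbolic_modulus z)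
    have 2: "char_fun \<tau> z = iexp (\<tau> * \<phi> (hyperbolic_modulus z)) - 1"
    proof (cases "z \<in> cball 0 radius")
      case False
      then have "\<not> hyperbolic_modulus z \<le> U" using hyperbolic_modulus_le_iff[OF z, of U] by (simp add: radius_def)
      then have "\<phi> (hyperbolic_modulus z) = 0" by (intro \<phi>_supp) simp
      then show ?thesis using False by (simp add: char_fun_def)
    qed (simp add: char_fun_def)
    show "char_fun \<tau> z * (z ^ n * cnj z ^ n) = ?\<gamma> (hyperbolic_modulus z)"
      unfolding 1 2 by simp
  qed
  also have "\<dots> = (\<integral>u. modulus_density \<alpha> u *\<^sub>R ?\<gamma> u \<partial>lborel)"
    by (rule integral_radial[OF \<alpha> \<gamma>_meas])
  finally have eq: "(\<integral>z. char_fun \<tau> z * (z ^ n * cnj z ^ n) \<partial>hyperbolic_measure \<alpha>) = (\<integral>u. modulus_density \<alpha> u *\<^sub>R ?\<gamma> u \<partial>lborel)" .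
  have "radial_moment \<alpha> (char_fun \<tau>) n = (\<integral>u. of_real (disc_coeff \<alpha> n) * (modulus_density \<alpha> u *\<^sub>R ?\<gamma> u) \<partial>lborel)"
    unfolding radial_moment_def eq by (rule integral_mult_right_zero[symmetric])
  also have "\<dots> = (\<integral>u. (disc_coeff \<alpha> n * sqrad u ^ n * modulus_density \<alpha> u) *\<^sub>R (iexp (\<tau> * \<phi> u) - 1) \<partial>lborel)"
    by (simp add: scaleR_conv_of_real mult_ac)
  also have "\<dots> = (\<integral>u. iexp (\<tau> * \<phi> u) - 1 \<partial>mode_law \<alpha> n)"
    by (rule integral_mode_law[symmetric, OF \<alpha>]) measurable
  also have "\<dots> = (\<integral>u. iexp (\<tau> * \<phi> u) \<partial>mode_law \<alpha> n) - 1"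
    by (subst Bochner_Integration.integral_diff) (auto intro!: bounded_measurable_mode[of _ 1] simp: prob_space)
  finally show ?thesis by simp
qed

text \<open>For finitely many modes the centred factors are replaced one at a time by Gaussian ones,
  and the errors add up to a multiple of the sum of the variances. Letting the number of modes grow
  keeps the inequality.\<close>

theorem characteristic_function_bound:
  assumes H: "hyperbolic_ensemble \<alpha> M X"
    and m: "mode_mean sums m" and v: "(\<lambda>n. mode_second n - (mode_mean n)\<^sup>2) sums v"
  shows "norm ((\<integral>\<omega>. iexp (\<tau> * (\<Sum>z\<in>X \<omega> \<inter> cball 0 radius. \<phi> (hyperbolic_modulus z))) \<partial>M) * iexp (- \<tau> * m) - exp (- (\<tau>\<^sup>2 * v / 2)))
    \<le> (\<bar>\<tau>\<bar> ^ 3 * B / 3 + \<tau> ^ 4 * B\<^sup>2 / 2) * v"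
proof -
  interpret R: radial_function \<alpha> radius 2 "char_fun \<tau>" by (rule radial_function_char_fun)
  let ?K = "\<bar>\<tau>\<bar> ^ 3 * B / 3 + \<tau> ^ 4 * B\<^sup>2 / 2"
  let ?v = "\<lambda>n. mode_second n - (mode_mean n)\<^sup>2"
  let ?a = "\<lambda>n. \<integral>u. iexp (\<tau> * \<phi> u) \<partial>mode_law \<alpha> n"
  have prod_eq: "(\<Prod>z\<in>X \<omega> \<inter> cball 0 radius. 1 + char_fun \<tau> z) =
      iexp (\<tau> * (\<Sum>z\<in>X \<omega> \<inter> cball 0 radius. \<phi> (hyperbolic_modulus z)))" if "\<omega> \<in> space M" for \<omega>
  proof -
    have "(\<Prod>z\<in>X \<omega> \<inter> cball 0 radius. 1 + char_fun \<tau> z) = (\<Prod>z\<in>X \<omega> \<inter> cball 0 radius. iexp (\<tau> * \<phi> (hyperbolic_modulus z)))"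
      by (intro prod.cong refl) (simp add: char_fun_def)
    also have "\<dots> = exp (\<Sum>z\<in>X \<omega> \<inter> cball 0 radius. \<i> * of_real (\<tau> * \<phi> (hyperbolic_modulus z)))"
      by (rule exp_sum[symmetric, OF R.finite_window[OF H that]])
    also have "(\<Sum>z\<in>X \<omega> \<inter> cball 0 radius. \<i> * of_real (\<tau> * \<phi> (hyperbolic_modulus z))) =
      \<i> * of_real (\<tau> * (\<Sum>z\<in>X \<omega> \<inter> cball 0 radius. \<phi> (hyperbolic_modulus z)))"
      by (simp only: sum_distrib_left of_real_sum)
    finally show ?thesis .
  qed
  have "(\<lambda>N. \<Prod>n<N. 1 + radial_moment \<alpha> (char_fun \<tau>) n) \<longlonglongrightarrow>
      (\<integral>\<omega>. (\<Prod>z\<in>X \<omega> \<inter> cball 0 radius. 1 + char_fun \<tau> z) \<partial>M)"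
    by (rule R.expectation_prod_one_plus(2)[OF H])
  also have "(\<integral>\<omega>. (\<Prod>z\<in>X \<omega> \<inter> cball 0 radius. 1 + char_fun \<tau> z) \<partial>M) =
    (\<integral>\<omega>. iexp (\<tau> * (\<Sum>z\<in>X \<omega> \<inter> cball 0 radius. \<phi> (hyperbolic_modulus z))) \<partial>M)" (is "_ = ?E")
    by (rule Bochner_Integration.integral_cong[OF refl prod_eq])
  finally have lim1: "(\<lambda>N. \<Prod>n<N. ?a n) \<longlonglongrightarrow> ?E" unfolding one_plus_radial_moment_char_fun .
  have lim2: "(\<lambda>N. iexp (- \<tau> * (\<Sum>n<N. mode_mean n))) \<longlonglongrightarrow> iexp (- \<tau> * m)"
    using m unfolding sums_def by (intro tendsto_intros)
  have lim3: "(\<lambda>N. exp (- (\<tau>\<^sup>2 * (\<Sum>n<N. ?v n) / 2))) \<longlonglongrightarrow> exp (- (\<tau>\<^sup>2 * v / 2))"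
    using v unfolding sums_def by (intro tendsto_intros) auto
  have est: "norm ((\<Prod>n<N. ?a n) * iexp (- \<tau> * (\<Sum>n<N. mode_mean n)) - exp (- (\<tau>\<^sup>2 * (\<Sum>n<N. ?v n) / 2))) \<le> ?K * (\<Sum>n<N. ?v n)" for N
  proof -
    let ?z = "\<lambda>n. ?a n * iexp (- \<tau> * mode_mean n)" and ?w = "\<lambda>n. complex_of_real (exp (- (\<tau>\<^sup>2 * ?v n / 2)))"
    have v_nonneg: "0 \<le> ?v n" for n
      unfolding mode_variance[symmetric] by (rule Bochner_Integration.integral_nonneg) simp
    have "(\<Prod>n<N. iexp (- \<tau> * mode_mean n)) = exp (\<Sum>n<N. \<i> * of_real (- \<tau> * mode_mean n))"
      by (rule exp_sum[symmetric]) simp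
    also have "(\<Sum>n<N. \<i> * of_real (- \<tau> * mode_mean n)) = \<i> * of_real (- \<tau> * (\<Sum>n<N. mode_mean n))"
      by (simp only: sum_distrib_left of_real_sum)
    finally have z: "(\<Prod>n<N. ?z n) = (\<Prod>n<N. ?a n) * iexp (- \<tau> * (\<Sum>n<N. mode_mean n))"
      by (simp only: prod.distrib)
    have "(\<Prod>n<N. exp (- (\<tau>\<^sup>2 * ?v n / 2))) = exp (\<Sum>n<N. - (\<tau>\<^sup>2 * ?v n / 2))"
      by (rule exp_sum[symmetric]) simp
    also have "(\<Sum>n<N. - (\<tau>\<^sup>2 * ?v n / 2)) = - (\<tau>\<^sup>2 * (\<Sum>n<N. ?v n) / 2)"
      by (simp only: sum_negf sum_distrib_left sum_divide_distrib)
    finally have w: "(\<Prod>n<N. ?w n) = exp (- (\<tau>\<^sup>2 * (\<Sum>n<N. ?v n) / 2))"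
      by (simp only: of_real_prod[symmetric])
    \<comment> \<open>Telescoping: all factors have modulus at most 1, so products differ by at most
      the sum of the differences of their factors.\<close>
    have "norm ((\<Prod>n<N. ?z n) - (\<Prod>n<N. ?w n)) \<le> (\<Sum>n<N. norm (?z n - ?w n))"
    proof (rule norm_prod_diff)
      fix n
      interpret prob_space "mode_law \<alpha> n" by (rule prob_space_mode_law[OF \<alpha>])
      show "norm (?z n) \<le> 1"
        using norm_iexp_expectation_le[of \<tau> \<phi>] by (simp add: norm_mult)
      show "norm (?w n) \<le> 1" using v_nonneg[of n] by simp
    qed
    also have "\<dots> \<le> (\<Sum>n<N. ?K * ?v n)"
    proof (rule sum_mono)
      fix n
      interpret prob_space "mode_law \<alpha> n" by (rule prob_space_mode_law[OF \<alpha>])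
      have "\<phi> \<in> borel_measurable (mode_law \<alpha> n)" by measurable
      from gaussian_approximation[OF this \<phi>_bound, of \<tau>, unfolded mode_variance, folded mode_mean_def]
      show "norm (?z n - ?w n) \<le> ?K * ?v n" .
    qed
    finally show ?thesis unfolding z w sum_distrib_left .
  qed
  have "(\<lambda>N. norm ((\<Prod>n<N. ?a n) * iexp (- \<tau> * (\<Sum>n<N. mode_mean n)) - exp (- (\<tau>\<^sup>2 * (\<Sum>n<N. ?v n) / 2))))
      \<longlonglongrightarrow> norm (?E * iexp (- \<tau> * m) - exp (- (\<tau>\<^sup>2 * v / 2)))"
    by (intro tendsto_norm tendsto_diff tendsto_mult lim1 lim2 lim3 tendsto_of_real)
  moreover have "(\<lambda>N. ?K * (\<Sum>n<N. ?v n)) \<longlonglongrightarrow> ?K * v"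
    using v unfolding sums_def by (intro tendsto_intros)
  ultimately show ?thesis
    by (rule LIMSEQ_le) (use est in blast)
qed

end

section \<open>Abelian asymptotics and the limiting kernel\<close>

text \<open>The quotient is, for n > 0, the sequence in Euler's limit formula for Gamma at \<alpha>
  + 1.\<close>

lemma tendsto_powr_over_disc_coeff:
  assumes "\<alpha> > 0"
  shows "(\<lambda>n. real n powr \<alpha> / disc_coeff \<alpha> n) \<longlonglongrightarrow> Gamma (\<alpha> + 1)"
proof -
  have "eventually (\<lambda>n. Gamma_series' (\<alpha> + 1) n = real n powr \<alpha> / disc_coeff \<alpha> n) sequentially"
    using eventually_gt_at_top[of 0]
  proof eventually_elim
    case (elim n)
    have "exp ((\<alpha> + 1) * ln (real n)) = real n powr \<alpha> * real n"
      using elim by (simp add: powr_def distrib_right exp_add)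
    then have "Gamma_series' (\<alpha> + 1) n = (real n * fact (n - 1)) * real n powr \<alpha> / pochhammer (\<alpha> + 1) n"
      by (simp add: Gamma_series'_def)
    also have "real n * fact (n - 1) = fact n" using elim by (simp add: fact_reduce)
    finally show ?case by (simp add: disc_coeff_def)
  qed
  with Gamma_series'_LIMSEQ[of "\<alpha> + 1"] show ?thesis by (rule Lim_transform_eventually)
qed

text \<open>The squared coefficients grow like n^(2 \<alpha>), as do the coefficients with parameter
  2 \<alpha>, whose power series is known in closed form. The constant is the quotient of the two
  Gamma limits.\<close>

lemma tendsto_disc_coeff_ratio:
  assumes "\<alpha> > 0"
  shows "(\<lambda>n. (disc_coeff \<alpha> n)\<^sup>2 / disc_coeff (2 * \<alpha>) n) \<longlonglongrightarrow> Gamma (2 * \<alpha> + 1) / (Gamma (\<alpha> + 1))\<^sup>2"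
proof -
  have "0 < Gamma (\<alpha> + 1)" by (rule Gamma_real_pos) (use assms in simp)
  then have "Gamma (\<alpha> + 1) \<noteq> 0" by simp
  then have "(\<lambda>n. (real n powr (2 * \<alpha>) / disc_coeff (2 * \<alpha>) n) / (real n powr \<alpha> / disc_coeff \<alpha> n)\<^sup>2)
      \<longlonglongrightarrow> Gamma (2 * \<alpha> + 1) / (Gamma (\<alpha> + 1))\<^sup>2"
    using assms by (intro tendsto_divide tendsto_power tendsto_powr_over_disc_coeff) auto
  moreover have "eventually (\<lambda>n. (real n powr (2 * \<alpha>) / disc_coeff (2 * \<alpha>) n) / (real n powr \<alpha> / disc_coeff \<alpha> n)\<^sup>2 =
      (disc_coeff \<alpha> n)\<^sup>2 / disc_coeff (2 * \<alpha>) n) sequentially"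
    using eventually_gt_at_top[of 0]
  proof eventually_elim
    case (elim n)
    have "real n powr (2 * \<alpha>) = (real n powr \<alpha>)\<^sup>2"
      by (simp add: power2_eq_square powr_add[symmetric])
    moreover have "real n powr \<alpha> \<noteq> 0" using elim by simp
    ultimately show ?case by (simp add: power_divide)
  qed
  ultimately show ?thesis by (rule Lim_transform_eventually)
qed

definition square_series :: "real \<Rightarrow> real \<Rightarrow> real" where
  "square_series \<alpha> q = (\<Sum>n. (disc_coeff \<alpha> n)\<^sup>2 * q ^ n)"

lemma disc_coeff_square_le:
  assumes "\<alpha> > 0"
  obtains C where "C > 0" "\<And>n. (disc_coeff \<alpha> n)\<^sup>2 \<le> C * disc_coeff (2 * \<alpha>) n"
proof -
  have "Bseq (\<lambda>n. (disc_coeff \<alpha> n)\<^sup>2 / disc_coeff (2 * \<alpha>) n)"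
    using tendsto_disc_coeff_ratio[OF assms] by (intro convergent_imp_Bseq convergentI)
  then obtain C where C: "C > 0" "\<And>n. norm ((disc_coeff \<alpha> n)\<^sup>2 / disc_coeff (2 * \<alpha>) n) \<le> C"
    by (auto simp: Bseq_def)
  have "(disc_coeff \<alpha> n)\<^sup>2 \<le> C * disc_coeff (2 * \<alpha>) n" for n
    using C(2)[of n] disc_coeff_pos[of "2 * \<alpha>" n] assms by (simp add: field_simps)
  with C(1) show ?thesis by (rule that)
qed

lemma summable_square_series:
  assumes "\<alpha> > 0" "0 \<le> q" "q < 1"
  shows "summable (\<lambda>n. (disc_coeff \<alpha> n)\<^sup>2 * q ^ n)"
proof -
  obtain C where C: "C > 0" "\<And>n. (disc_coeff \<alpha> n)\<^sup>2 \<le> C * disc_coeff (2 * \<alpha>) n"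
    using disc_coeff_square_le[OF assms(1)] by blast
  have "summable (\<lambda>n. disc_coeff (2 * \<alpha>) n * q ^ n)"
    using disc_coeff_sums[of q "2 * \<alpha>"] assms by (auto simp: sums_iff)
  then have s: "summable (\<lambda>n. C * (disc_coeff (2 * \<alpha>) n * q ^ n))" by (rule summable_mult)
  show ?thesis
  proof (rule summable_comparison_test'[OF s, of 0])
    fix n
    have "(disc_coeff \<alpha> n)\<^sup>2 * q ^ n \<le> (C * disc_coeff (2 * \<alpha>) n) * q ^ n"
      using assms by (intro mult_right_mono C) auto
    then show "norm ((disc_coeff \<alpha> n)\<^sup>2 * q ^ n) \<le> C * (disc_coeff (2 * \<alpha>) n * q ^ n)"
      using assms by (simp add: mult.assoc)
  qed
qed

lemma square_series_nonneg:
  assumes "\<alpha> > 0" "0 \<le> q" "q < 1"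
  shows "0 \<le> square_series \<alpha> q"
  unfolding square_series_def using assms by (intro suminf_nonneg summable_square_series) auto

text \<open>A convergent ratio is bounded, so the series is dominated by a multiple of (1 - q)^(-(2
  \<alpha> + 1)). The uniformity in q feeds the dominated convergence of the cross term.\<close>

lemma square_series_bound:
  assumes "\<alpha> > 0"
  obtains C where "C > 0" "\<And>q. 0 \<le> q \<Longrightarrow> q < 1 \<Longrightarrow> square_series \<alpha> q * (1 - q) powr (2 * \<alpha> + 1) \<le> C"
proof -
  obtain C where C: "C > 0" "\<And>n. (disc_coeff \<alpha> n)\<^sup>2 \<le> C * disc_coeff (2 * \<alpha>) n"
    using disc_coeff_square_le[OF assms(1)] by blast
  have "square_series \<alpha> q * (1 - q) powr (2 * \<alpha> + 1) \<le> C" if q: "0 \<le> q" "q < 1" for q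
  proof -
    have s: "(\<lambda>n. C * (disc_coeff (2 * \<alpha>) n * q ^ n)) sums (C * (1 - q) powr (- (2 * \<alpha> + 1)))"
      using q by (intro sums_mult disc_coeff_sums) auto
    have "square_series \<alpha> q \<le> (\<Sum>n. C * (disc_coeff (2 * \<alpha>) n * q ^ n))"
      unfolding square_series_def
    proof (rule suminf_le[OF _ summable_square_series[OF assms q] sums_summable[OF s]])
      show "(disc_coeff \<alpha> n)\<^sup>2 * q ^ n \<le> C * (disc_coeff (2 * \<alpha>) n * q ^ n)" for n
        using mult_right_mono[OF C(2)[of n], of "q ^ n"] q by (simp add: mult.assoc)
    qed
    also have "\<dots> = C * (1 - q) powr (- (2 * \<alpha> + 1))" using sums_unique[OF s] by simp
    finally have "square_series \<alpha> q * (1 - q) powr (2 * \<alpha> + 1) \<le> C * (1 - q) powr (- (2 * \<alpha> + 1)) * (1 - q) powr (2 * \<alpha> + 1)"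
      by (intro mult_right_mono) auto
    also have "\<dots> = C" using q by (simp only: mult.assoc powr_add[symmetric]) simp
    finally show ?thesis .
  qed
  with C(1) show ?thesis by (rule that)
qed

text \<open>Abel's theorem for the ratio of the power series with coefficients \<open>(disc_coeff \<alpha> n)\<^sup>2\<close> and
  \<open>disc_coeff (2 * \<alpha>) n\<close>; the latter sums to \<open>(1 - q) powr (- (2 * \<alpha> + 1))\<close>.\<close>

lemma tendsto_square_series:
  assumes \<alpha>: "\<alpha> > 0"
  shows "((\<lambda>q. square_series \<alpha> q * (1 - q) powr (2 * \<alpha> + 1)) \<longlongrightarrow> Gamma (2 * \<alpha> + 1) / (Gamma (\<alpha> + 1))\<^sup>2) (at_left 1)"
proof (rule tendstoI)
  fix e :: real assume e: "e > 0"
  let ?l = "Gamma (2 * \<alpha> + 1) / (Gamma (\<alpha> + 1))\<^sup>2"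
  let ?a = "\<lambda>n. (disc_coeff \<alpha> n)\<^sup>2" and ?d = "disc_coeff (2 * \<alpha>)"
  have dpos: "?d n > 0" for n using \<alpha> by (intro disc_coeff_pos) auto
  have "eventually (\<lambda>n. dist (?a n / ?d n) ?l < e / 2) sequentially"
    using tendstoD[OF tendsto_disc_coeff_ratio[OF \<alpha>], of "e / 2"] e by simp
  then obtain N where N: "\<And>n. n \<ge> N \<Longrightarrow> dist (?a n / ?d n) ?l < e / 2"
    by (auto simp: eventually_sequentially)
  have tail: "\<bar>?a n - ?l * ?d n\<bar> \<le> e / 2 * ?d n" if "n \<ge> N" for n
  proof -
    have "?a n - ?l * ?d n = (?a n / ?d n - ?l) * ?d n" using dpos[of n] by (simp add: field_simps)
    then show ?thesis using N[OF that] dpos[of n]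
      by (simp add: abs_mult dist_real_def mult_right_mono less_imp_le)
  qed
  \<comment> \<open>The finitely many coefficients not yet close to the limiting ratio contribute at
    most c, which the vanishing factor (1 - q)^(2 \<alpha> + 1) removes; the tail costs e / 2
    relative to the comparison series.\<close>
  define c where "c = (\<Sum>n<N. \<bar>?a n - ?l * ?d n\<bar>)"
  have c0: "0 \<le> c" unfolding c_def by (intro sum_nonneg) auto
  have key: "\<bar>square_series \<alpha> q * (1 - q) powr (2 * \<alpha> + 1) - ?l\<bar> \<le> c * (1 - q) powr (2 * \<alpha> + 1) + e / 2"
    if q: "0 \<le> q" "q < 1" for q
  proof -
    let ?P = "(1 - q) powr (2 * \<alpha> + 1)" and ?D = "(1 - q) powr (- (2 * \<alpha> + 1))"
    have PD: "?D * ?P = 1" using q by (simp only: powr_add[symmetric]) simp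
    have D: "(\<lambda>n. ?d n * q ^ n) sums ?D" using q by (intro disc_coeff_sums) auto
    have A: "(\<lambda>n. ?a n * q ^ n) sums square_series \<alpha> q"
      unfolding square_series_def using summable_square_series[OF \<alpha> q] by (rule summable_sums)
    have diff: "(\<lambda>n. (?a n - ?l * ?d n) * q ^ n) sums (square_series \<alpha> q - ?l * ?D)"
      using sums_diff[OF A sums_mult[OF D, of ?l]] by (simp add: algebra_simps)
    let ?h = "\<lambda>n. (if n < N then \<bar>?a n - ?l * ?d n\<bar> else 0) + e / 2 * (?d n * q ^ n)"
    have "(\<lambda>n. if n < N then \<bar>?a n - ?l * ?d n\<bar> else 0) sums c"
      unfolding c_def using sums_If_finite[of "\<lambda>n. n < N" "\<lambda>n. \<bar>?a n - ?l * ?d n\<bar>"]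
      by (simp add: lessThan_def)
    then have h: "?h sums (c + e / 2 * ?D)" by (intro sums_add sums_mult D)
    have le: "norm ((?a n - ?l * ?d n) * q ^ n) \<le> ?h n" for n
    proof (cases "n < N")
      case True
      have "\<bar>?a n - ?l * ?d n\<bar> * q ^ n \<le> \<bar>?a n - ?l * ?d n\<bar> * 1"
        using q by (intro mult_left_mono power_le_one) auto
      moreover have "0 \<le> e / 2 * (?d n * q ^ n)"
        using e q dpos[of n] by (intro mult_nonneg_nonneg) auto
      ultimately show ?thesis using True q by (simp add: abs_mult)
    next
      case False
      then have "\<bar>?a n - ?l * ?d n\<bar> * q ^ n \<le> e / 2 * ?d n * q ^ n"
        using q by (intro mult_right_mono tail) auto
      then show ?thesis using False q by (simp add: abs_mult)
    qed
    have s: "summable (\<lambda>n. norm ((?a n - ?l * ?d n) * q ^ n))"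
      by (rule summable_comparison_test'[OF sums_summable[OF h], of 0]) (use le in simp)
    have "\<bar>square_series \<alpha> q - ?l * ?D\<bar> \<le> (\<Sum>n. norm ((?a n - ?l * ?d n) * q ^ n))"
      using summable_norm[OF s] sums_unique[OF diff] by simp
    also have "\<dots> \<le> c + e / 2 * ?D"
      unfolding sums_unique[OF h] by (rule suminf_le[OF le s sums_summable[OF h]])
    finally have "\<bar>square_series \<alpha> q - ?l * ?D\<bar> * ?P \<le> (c + e / 2 * ?D) * ?P"
      by (intro mult_right_mono) auto
    moreover have "\<bar>square_series \<alpha> q - ?l * ?D\<bar> * ?P = \<bar>(square_series \<alpha> q - ?l * ?D) * ?P\<bar>"
      by (simp add: abs_mult)
    moreover have "(square_series \<alpha> q - ?l * ?D) * ?P = square_series \<alpha> q * ?P - ?l * (?D * ?P)"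
      "(c + e / 2 * ?D) * ?P = c * ?P + e / 2 * (?D * ?P)"
      by (simp_all add: algebra_simps)
    ultimately show ?thesis unfolding PD by simp
  qed
  have "((\<lambda>q. c * (1 - q) powr (2 * \<alpha> + 1)) \<longlongrightarrow> c * (1 - 1) powr (2 * \<alpha> + 1)) (at_left 1)"
    using \<alpha> by (intro tendsto_intros tendsto_powr')
      (auto simp: eventually_at_filter)
  then have "eventually (\<lambda>q. c * (1 - q) powr (2 * \<alpha> + 1) < e / 2) (at_left 1)"
    using e by (intro order_tendstoD(2)[where y = "c * (1 - 1) powr (2 * \<alpha> + 1)"]) auto
  moreover have "eventually (\<lambda>q. q \<in> {0<..<1::real}) (at_left 1)"
    by (rule eventually_at_leftI[of 0]) auto
  ultimately show "eventually (\<lambda>q. dist (square_series \<alpha> q * (1 - q) powr (2 * \<alpha> + 1)) ?l < e) (at_left 1)"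
  proof eventually_elim
    case (elim q)
    then show ?case using key[of q] by (simp add: dist_real_def)
  qed
qed

text \<open>The weight in \<open>limit_variance\<close>. Up to the factor 2 / Beta it is also the
  limit of the squared kernel, averaged over angles and rescaled; see
  \<open>tendsto_scaled_kernel\<close>.\<close>

definition limit_kernel :: "real \<Rightarrow> real \<Rightarrow> real \<Rightarrow> real" where
  "limit_kernel \<alpha> x y = exp ((\<alpha> + 1) * (x + y)) / (exp x + exp y) powr (2 * \<alpha> + 1)"

lemma limit_kernel_nonneg: "0 \<le> limit_kernel \<alpha> x y"
  by (simp add: limit_kernel_def)

lemma limit_kernel_commute: "limit_kernel \<alpha> x y = limit_kernel \<alpha> y x"
  by (simp add: limit_kernel_def add.commute)

lemma limit_kernel_measurable [measurable]:
  "(\<lambda>p. limit_kernel \<alpha> (fst p) (snd p)) \<in> borel_measurable (borel \<Otimes>\<^sub>M borel)"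
  unfolding limit_kernel_def by measurable

lemma limit_kernel_measurable_snd: "limit_kernel \<alpha> x \<in> borel_measurable borel"
  unfolding limit_kernel_def[abs_def] by measurable

text \<open>The substitution \<open>t = e\<^sup>y / (e\<^sup>x + e\<^sup>y)\<close> turns the integral into a Beta integral.\<close>

lemma nn_integral_limit_kernel:
  assumes \<alpha>: "\<alpha> > 0"
  shows "(\<integral>\<^sup>+y. ennreal (limit_kernel \<alpha> x y) \<partial>lborel) = ennreal (Beta \<alpha> (\<alpha> + 1) * exp x)"
proof -
  define g where "g y = exp y / (exp x + exp y)" for y
  define g' where "g' y = exp x * exp y / (exp x + exp y)\<^sup>2" for y
  let ?f = "\<lambda>t::real. t powr \<alpha> * (1 - t) powr (\<alpha> - 1)"
  have pos: "exp x + exp y > 0" for y by (simp add: add_pos_pos)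
  have g01: "0 < g y" "g y < 1" for y using pos[of y] by (auto simp: g_def field_simps)
  have deriv: "(g has_real_derivative g' y) (at y)" for y
    unfolding g_def g'_def using pos[of y]
    by (auto intro!: derivative_eq_intros simp: power2_eq_square field_simps)
  have g'_nonneg: "0 \<le> g' y" for y using pos[of y] by (simp add: g'_def)
  have fg: "limit_kernel \<alpha> x y = exp x * (?f (g y) * g' y)" for y
  proof -
    let ?s = "exp x + exp y"
    have 1: "1 - g y = exp x / ?s" using pos[of y] by (simp add: g_def field_simps)
    have "?f (g y) * g' y = (exp (\<alpha> * y) / ?s powr \<alpha>) * (exp ((\<alpha> - 1) * x) / ?s powr (\<alpha> - 1)) * (exp x * exp y / ?s powr 2)"
      unfolding 1 using pos[of y]
      by (simp add: g_def g'_def powr_divide exp_powr_real mult.commute)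
    also have "\<dots> = (exp (\<alpha> * y) * exp ((\<alpha> - 1) * x) * (exp x * exp y)) / (?s powr \<alpha> * ?s powr (\<alpha> - 1) * ?s powr 2)"
      by simp
    also have "?s powr \<alpha> * ?s powr (\<alpha> - 1) * ?s powr 2 = ?s powr (2 * \<alpha> + 1)"
      unfolding powr_add[symmetric] by (simp add: algebra_simps)
    finally show ?thesis
      unfolding limit_kernel_def by (simp add: exp_add[symmetric] algebra_simps)
  qed
  have g_meas [measurable]: "g \<in> borel_measurable borel" "g' \<in> borel_measurable borel"
    unfolding g_def g'_def by measurable
  \<comment> \<open>The substitution is made on the intervals [-n, n]. Continuity from below of the
    two measures carries it to the whole line and to (0, 1).\<close>
  define D1 where "D1 = density lborel (\<lambda>t. ennreal (?f t))"
  define D2 where "D2 = density lborel (\<lambda>y. ennreal (?f (g y) * g' y))"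
  have eq: "emeasure D1 {g (- real n)..g (real n)} = emeasure D2 {- real n..real n}" for n
  proof -
    have "emeasure D1 {g (- real n)..g (real n)} = (\<integral>\<^sup>+t. ennreal (?f t * indicator {g (- real n)..g (real n)} t) \<partial>lborel)"
      unfolding D1_def by (subst emeasure_density) (auto intro!: nn_integral_cong simp: indicator_def)
    also have "\<dots> = (\<integral>\<^sup>+y. ennreal (?f (g y) * g' y * indicator {- real n..real n} y) \<partial>lborel)"
    proof (rule nn_integral_substitution)
      show "set_borel_measurable borel {g (- real n)..g (real n)} ?f"
        unfolding set_borel_measurable_def by measurable
      show "continuous_on {- real n..real n} g'"
        unfolding g'_def using pos by (intro continuous_intros) (auto simp: less_imp_neq[symmetric])
    qed (auto intro: deriv g'_nonneg)
    also have "\<dots> = emeasure D2 {- real n..real n}"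
      unfolding D2_def by (subst emeasure_density) (auto intro!: nn_integral_cong simp: indicator_def)
    finally show ?thesis .
  qed
  have mono: "g a \<le> g b" if "a \<le> b" for a b
    using that deriv g'_nonneg DERIV_nonneg_imp_nondecreasing[of a b g] by blast
  have U1: "(\<Union>n. {g (- real n)..g (real n)}) = {0<..<1}"
  proof (intro equalityI subsetI)
    fix t assume "t \<in> (\<Union>n. {g (- real n)..g (real n)})"
    then obtain n where "g (- real n) \<le> t" "t \<le> g (real n)" by auto
    then show "t \<in> {0<..<1}" using g01(1)[of "- real n"] g01(2)[of "real n"] by auto
  next
    fix t :: real assume t: "t \<in> {0<..<1}"
    \<comment> \<open>The preimage of t under the increasing function g, obtained by solving for exp
      y.\<close>
    define y where "y = x + ln (t / (1 - t))"
    have "exp y = exp x * (t / (1 - t))" using t by (simp add: y_def exp_add)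
    moreover have "exp x + exp x * (t / (1 - t)) = exp x / (1 - t)" using t by (simp add: field_simps)
    ultimately have "g y = t" using t by (simp add: g_def)
    obtain n where "\<bar>y\<bar> \<le> real n" using real_arch_simple by blast
    then have "g (- real n) \<le> g y" "g y \<le> g (real n)" by (intro mono; linarith)+
    then show "t \<in> (\<Union>n. {g (- real n)..g (real n)})" using \<open>g y = t\<close> by auto
  qed
  have U2: "(\<Union>n. {- real n..real n}) = UNIV"
  proof -
    have "\<exists>n. y \<in> {- real n..real n}" for y :: real
      using real_arch_simple[of "\<bar>y\<bar>"] by (auto simp: abs_le_iff) (metis minus_le_iff)
    then show ?thesis by blast
  qed
  have "emeasure D2 UNIV = (SUP n. emeasure D2 {- real n..real n})"
    unfolding U2[symmetric] by (rule SUP_emeasure_incseq[symmetric]) (auto simp: D2_def incseq_def)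
  also have "\<dots> = (SUP n. emeasure D1 {g (- real n)..g (real n)})" by (simp only: eq)
  also have "\<dots> = emeasure D1 {0<..<1}"
    unfolding U1[symmetric]
    by (rule SUP_emeasure_incseq) (auto simp: D1_def incseq_def intro: order_trans[OF mono] order_trans[OF _ mono])
  \<comment> \<open>Passing to the closed interval adds nothing, since \<open>0 powr a\<close> is 0
    for every exponent a.\<close>
  also have "\<dots> = (\<integral>\<^sup>+t. ennreal (indicator {0..1} t *\<^sub>R (t powr ((\<alpha> + 1) - 1) * (1 - t) powr (\<alpha> - 1))) \<partial>lborel)"
    unfolding D1_def by (subst emeasure_density) (auto intro!: nn_integral_cong simp: indicator_def)
  also have "\<dots> = ennreal (Beta (\<alpha> + 1) \<alpha>)"
  proof -
    have i: "set_integrable lborel {0..1} (\<lambda>t. t powr ((\<alpha> + 1) - 1) * (1 - t) powr (\<alpha> - 1))"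
      using \<alpha> by (intro integrable_Beta) auto
    have "(LBINT t:{0..1}. t powr ((\<alpha> + 1) - 1) * (1 - t) powr (\<alpha> - 1)) = Beta (\<alpha> + 1) \<alpha>"
      using set_borel_integral_eq_integral(2)[OF i] has_integral_Beta_real[of "\<alpha> + 1" \<alpha>] \<alpha>
      by (simp add: integral_unique)
    then show ?thesis
      using i unfolding set_integrable_def set_lebesgue_integral_def
      by (subst nn_integral_eq_integral) auto
  qed
  finally have D2: "emeasure D2 UNIV = ennreal (Beta (\<alpha> + 1) \<alpha>)" .
  have "(\<integral>\<^sup>+y. ennreal (limit_kernel \<alpha> x y) \<partial>lborel) = (\<integral>\<^sup>+y. ennreal (exp x) * ennreal (?f (g y) * g' y) \<partial>lborel)"
    unfolding fg using g'_nonneg by (intro nn_integral_cong) (simp add: ennreal_mult)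
  also have "\<dots> = ennreal (exp x) * (\<integral>\<^sup>+y. ennreal (?f (g y) * g' y) \<partial>lborel)"
    by (rule nn_integral_cmult) measurable
  also have "(\<integral>\<^sup>+y. ennreal (?f (g y) * g' y) \<partial>lborel) = emeasure D2 UNIV"
    unfolding D2_def by (subst emeasure_density) auto
  finally show ?thesis
    unfolding D2 by (simp add: ennreal_mult'[symmetric] Beta_commute mult.commute)
qed

section \<open>Sums over the radial modes\<close>

lemma has_bochner_integral_lborel_prod:
  fixes f g :: "real \<Rightarrow> real"
  assumes f: "integrable lborel f" and g: "integrable lborel g"
  shows "has_bochner_integral (lborel :: (real \<times> real) measure) (\<lambda>p. f (fst p) * g (snd p)) ((\<integral>x. f x \<partial>lborel) * (\<integral>y. g y \<partial>lborel))"
proof -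
  have [measurable]: "f \<in> borel_measurable borel" "g \<in> borel_measurable borel"
    using borel_measurable_integrable[OF f] borel_measurable_integrable[OF g] by simp_all
  have i: "integrable (lborel \<Otimes>\<^sub>M lborel) (\<lambda>p. f (fst p) * g (snd p))"
  proof (rule lborel_pair.Fubini_integrable)
    show "(\<lambda>p. f (fst p) * g (snd p)) \<in> borel_measurable (lborel \<Otimes>\<^sub>M lborel)" by measurable
    have "integrable lborel (\<lambda>x. \<bar>f x\<bar> * (\<integral>y. \<bar>g y\<bar> \<partial>lborel))" using f by simp
    then show "integrable lborel (\<lambda>x. \<integral>y. norm (f (fst (x, y)) * g (snd (x, y))) \<partial>lborel)"
      by (simp add: abs_mult)
    show "AE x in lborel. integrable lborel (\<lambda>y. f (fst (x, y)) * g (snd (x, y)))"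
      using g by (intro AE_I2) simp
  qed
  moreover have "integral\<^sup>L (lborel \<Otimes>\<^sub>M lborel) (\<lambda>p. f (fst p) * g (snd p)) = (\<integral>x. f x \<partial>lborel) * (\<integral>y. g y \<partial>lborel)"
    using lborel_pair.integral_fst'[OF i] by simp
  ultimately show ?thesis by (simp add: has_bochner_integral_iff lborel_prod)
qed

lemma modulus_density_eq_0: "u < 0 \<Longrightarrow> modulus_density \<alpha> u = 0"
  by (simp add: modulus_density_def)

text \<open>The left side is the kernel on the diagonal times the density of the modulus: the mean
  density of points. Its growth \<alpha>/4 exp u is where both \<open>scale_const\<close> and the
  factor 2 in the centring come from.\<close>

lemma intensity_eq:
  "(1 - sqrad u) powr (- (\<alpha> + 1)) * modulus_density \<alpha> u = indicator {0..} u * (\<alpha> / 2 * sinh u)"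
proof -
  have "(1 - sqrad u) powr (- (\<alpha> + 1)) * (1 - sqrad u) powr \<alpha> = (1 - sqrad u) powr (- 1)"
    by (subst powr_add[symmetric]) simp
  also have "\<dots> = 1 / (1 - sqrad u)"
    using less_imp_le[OF sqrad_less_one[of u]] by (simp add: powr_minus_divide)
  also have "\<dots> = (cosh (u / 2))\<^sup>2"
  proof -
    have "1 - S / (1 + S) = 1 / (1 + S)" if "S \<ge> 0" for S :: real using that by (simp add: field_simps)
    from this[of "(sinh (u / 2))\<^sup>2"] have "1 - sqrad u = 1 / (cosh (u / 2))\<^sup>2"
      by (simp add: sqrad_def tanh_def power_divide cosh_square_eq add.commute)
    then show ?thesis by simp
  qed
  finally have *: "(1 - sqrad u) powr (- (\<alpha> + 1)) * (1 - sqrad u) powr \<alpha> = (cosh (u / 2))\<^sup>2" .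
  have "sinh u = 2 * sinh (u / 2) * cosh (u / 2)" using sinh_double[of "u / 2"] by simp
  then have t: "tanh (u / 2) * (cosh (u / 2))\<^sup>2 = sinh u / 2"
    by (simp add: tanh_def power2_eq_square)
  have "(1 - sqrad u) powr (- (\<alpha> + 1)) * modulus_density \<alpha> u =
    indicator {0..} u * (\<alpha> * (tanh (u / 2) * ((1 - sqrad u) powr (- (\<alpha> + 1)) * (1 - sqrad u) powr \<alpha>)))"
    unfolding modulus_density_def by (simp only: mult_ac)
  then show ?thesis unfolding * t by simp
qed

lemma integrable_mode_density: "\<alpha> > 0 \<Longrightarrow> integrable lborel (\<lambda>u. disc_coeff \<alpha> n * sqrad u ^ n * modulus_density \<alpha> u)"
  using has_bochner_integral_modulus_density[of \<alpha> n] by (simp add: has_bochner_integral_iff)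

lemma sqrad_mono: "0 \<le> u \<Longrightarrow> u \<le> U \<Longrightarrow> sqrad u \<le> sqrad U"
  unfolding sqrad_def by (intro power_mono) auto

lemma summable_disc_coeff_sqrad: "summable (\<lambda>n. disc_coeff \<alpha> n * sqrad u ^ n)"
  using disc_coeff_sums[of "sqrad u" \<alpha>] by (auto simp: sums_iff)

text \<open>The first bound is summable over n, the second uniform in n. In squares of mode
  integrals one factor takes each, which keeps the coefficient to the first power.\<close>

lemma mode_density_compact:
  fixes \<gamma> :: "real \<Rightarrow> real"
  assumes \<alpha>: "\<alpha> > 0" and \<gamma> [measurable]: "\<gamma> \<in> borel_measurable borel" and b: "\<And>u. \<bar>\<gamma> u\<bar> \<le> b" and supp: "\<And>u. U < u \<Longrightarrow> \<gamma> u = 0"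
  shows "integrable lborel (\<lambda>u. disc_coeff \<alpha> n * sqrad u ^ n * modulus_density \<alpha> u * \<gamma> u)"
    and "(\<integral>u. \<bar>disc_coeff \<alpha> n * sqrad u ^ n * modulus_density \<alpha> u * \<gamma> u\<bar> \<partial>lborel) \<le> b * (disc_coeff \<alpha> n * sqrad U ^ n)"
    and "(\<integral>u. \<bar>disc_coeff \<alpha> n * sqrad u ^ n * modulus_density \<alpha> u * \<gamma> u\<bar> \<partial>lborel) \<le> b"
proof -
  let ?w = "\<lambda>n u. disc_coeff \<alpha> n * sqrad u ^ n * modulus_density \<alpha> u"
  have b0: "0 \<le> b" using b[of 0] by linarith
  have w0: "0 \<le> ?w n u" for n u by (rule mode_density_nonneg[OF \<alpha>])
  have le: "\<bar>?w n u * \<gamma> u\<bar> \<le> ?w n u * b" for u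
    unfolding abs_mult[of "?w n u"] abs_of_nonneg[OF w0] by (rule mult_left_mono[OF b w0])
  show i: "integrable lborel (\<lambda>u. ?w n u * \<gamma> u)"
  proof (rule Bochner_Integration.integrable_bound[OF integrable_mult_left[OF integrable_mode_density[OF \<alpha>, of n], of b]])
    show "AE u in lborel. norm (?w n u * \<gamma> u) \<le> norm (?w n u * b)"
      using le b0 by (intro AE_I2) (metis abs_of_nonneg mult_nonneg_nonneg real_norm_def w0)
  qed measurable
  have one: "(\<integral>u. ?w n u \<partial>lborel) = 1" for n
    using has_bochner_integral_modulus_density[OF \<alpha>, of n] by (simp add: has_bochner_integral_iff)
  have "(\<integral>u. \<bar>?w n u * \<gamma> u\<bar> \<partial>lborel) \<le> (\<integral>u. ?w n u * b \<partial>lborel)"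
    by (intro integral_mono integrable_abs i integrable_mult_left integrable_mode_density \<alpha> le)
  then show "(\<integral>u. \<bar>?w n u * \<gamma> u\<bar> \<partial>lborel) \<le> b" by (simp add: one)
  \<comment> \<open>On the support \<open>sqrad u\<close> is at most \<open>sqrad U\<close>; what
    remains is the density of degree 0, of mass 1.\<close>
  have le2: "\<bar>?w n u * \<gamma> u\<bar> \<le> (b * (disc_coeff \<alpha> n * sqrad U ^ n)) * ?w 0 u" for u
  proof (cases "0 \<le> u \<and> u \<le> U")
    case True
    have "sqrad u ^ n \<le> sqrad U ^ n" using True by (intro power_mono sqrad_mono) auto
    then have "?w n u \<le> disc_coeff \<alpha> n * sqrad U ^ n * modulus_density \<alpha> u"
      using disc_coeff_pos[OF \<alpha>, of n] modulus_density_nonneg[OF \<alpha>, of u] by (intro mult_right_mono mult_left_mono) auto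
    then have "?w n u * b \<le> disc_coeff \<alpha> n * sqrad U ^ n * modulus_density \<alpha> u * b" using b0 by (rule mult_right_mono)
    then show ?thesis using le[of u] by (simp add: mult_ac)
  next
    case False
    then have "?w n u * \<gamma> u = 0" using supp[of u] modulus_density_eq_0[of u \<alpha>] by auto
    moreover have "0 \<le> (b * (disc_coeff \<alpha> n * sqrad U ^ n)) * ?w 0 u"
      using b0 disc_coeff_pos[OF \<alpha>, of n] w0[of 0 u] by (intro mult_nonneg_nonneg) auto
    ultimately show ?thesis by (simp only: abs_zero)
  qed
  have "(\<integral>u. \<bar>?w n u * \<gamma> u\<bar> \<partial>lborel) \<le> (\<integral>u. (b * (disc_coeff \<alpha> n * sqrad U ^ n)) * ?w 0 u \<partial>lborel)"
    by (intro integral_mono integrable_abs i integrable_mult_right integrable_mode_density \<alpha> le2)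
  also have "\<dots> = b * (disc_coeff \<alpha> n * sqrad U ^ n)"
    using one[of 0] by (simp only: integral_mult_right_zero mult_1_right)
  finally show "(\<integral>u. \<bar>?w n u * \<gamma> u\<bar> \<partial>lborel) \<le> b * (disc_coeff \<alpha> n * sqrad U ^ n)" .
qed

text \<open>Summed over the degrees, the mode densities give back the mean density of points;
  bounded support makes the exchange of sum and integral absolutely convergent.\<close>

lemma mode_integral_sums:
  fixes \<gamma> :: "real \<Rightarrow> real"
  assumes \<alpha>: "\<alpha> > 0" and \<gamma>: "\<gamma> \<in> borel_measurable borel" and b: "\<And>u. \<bar>\<gamma> u\<bar> \<le> b" and supp: "\<And>u. U < u \<Longrightarrow> \<gamma> u = 0"
  shows "(\<lambda>n. \<integral>u. \<gamma> u \<partial>mode_law \<alpha> n) sums (\<integral>u. indicator {0..} u * (\<alpha> / 2 * sinh u) * \<gamma> u \<partial>lborel)"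
proof -
  let ?f = "\<lambda>n u. disc_coeff \<alpha> n * sqrad u ^ n * modulus_density \<alpha> u * \<gamma> u"
  note cpt = mode_density_compact[OF \<alpha> \<gamma> b supp]
  have s: "(\<lambda>n. disc_coeff \<alpha> n * sqrad u ^ n) sums (1 - sqrad u) powr (- (\<alpha> + 1))" for u
    by (rule disc_coeff_sums) simp
  have lim: "(\<lambda>n. ?f n u) sums (indicator {0..} u * (\<alpha> / 2 * sinh u) * \<gamma> u)" for u
  proof -
    have "(\<lambda>n. ?f n u) sums ((1 - sqrad u) powr (- (\<alpha> + 1)) * (modulus_density \<alpha> u * \<gamma> u))"
      using sums_mult2[OF s, of u "modulus_density \<alpha> u * \<gamma> u"] by (simp only: mult.assoc)
    also have "(1 - sqrad u) powr (- (\<alpha> + 1)) * (modulus_density \<alpha> u * \<gamma> u) = indicator {0..} u * (\<alpha> / 2 * sinh u) * \<gamma> u"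
      unfolding mult.assoc[symmetric, of _ "modulus_density \<alpha> u"] intensity_eq ..
    finally show ?thesis .
  qed
  have abs: "summable (\<lambda>n. norm (?f n u))" for u
  proof -
    have "norm (?f n u) = disc_coeff \<alpha> n * sqrad u ^ n * \<bar>modulus_density \<alpha> u * \<gamma> u\<bar>" for n
      using disc_coeff_pos[OF \<alpha>, of n] by (simp add: abs_mult)
    then show ?thesis by (simp only:) (intro summable_mult2 summable_disc_coeff_sqrad)
  qed
  have "(\<lambda>n. integral\<^sup>L lborel (?f n)) sums (\<integral>u. (\<Sum>n. ?f n u) \<partial>lborel)"
  proof (rule sums_integral[OF cpt(1)])
    show "AE u in lborel. summable (\<lambda>n. norm (?f n u))" using abs by (intro AE_I2)
    have "summable (\<lambda>n. b * (disc_coeff \<alpha> n * sqrad U ^ n))" by (intro summable_mult summable_disc_coeff_sqrad)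
    then show "summable (\<lambda>n. \<integral>u. norm (?f n u) \<partial>lborel)"
      by (rule summable_comparison_test'[of _ 0]) (use cpt(2) in simp)
  qed
  moreover have "(\<Sum>n. ?f n u) = indicator {0..} u * (\<alpha> / 2 * sinh u) * \<gamma> u" for u
    using sums_unique[OF lim] by simp
  moreover have "(\<integral>u. \<gamma> u \<partial>mode_law \<alpha> n) = integral\<^sup>L lborel (?f n)" for n
    by (subst integral_mode_law[OF \<alpha> \<gamma>]) simp
  ultimately show ?thesis by simp
qed

text \<open>A squared integral is a double integral; summing the squared coefficients under it
  produces \<open>square_series\<close> at the product of the two squared radii.\<close>

lemma mode_square_sums:
  fixes \<gamma> :: "real \<Rightarrow> real"
  assumes \<alpha>: "\<alpha> > 0" and \<gamma> [measurable]: "\<gamma> \<in> borel_measurable borel" and b: "\<And>u. \<bar>\<gamma> u\<bar> \<le> b" and supp: "\<And>u. U < u \<Longrightarrow> \<gamma> u = 0"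
  shows "(\<lambda>n. (\<integral>u. \<gamma> u \<partial>mode_law \<alpha> n)\<^sup>2) sums
    (\<integral>p. square_series \<alpha> (sqrad (fst p) * sqrad (snd p)) * (modulus_density \<alpha> (fst p) * \<gamma> (fst p)) * (modulus_density \<alpha> (snd p) * \<gamma> (snd p)) \<partial>(lborel :: (real \<times> real) measure))"
proof -
  let ?f = "\<lambda>n u. disc_coeff \<alpha> n * sqrad u ^ n * modulus_density \<alpha> u * \<gamma> u"
  let ?F = "\<lambda>n p. ?f n (fst p) * ?f n (snd p)"
  let ?G = "\<lambda>p. (modulus_density \<alpha> (fst p) * \<gamma> (fst p)) * (modulus_density \<alpha> (snd p) * \<gamma> (snd p))"
  note cpt = mode_density_compact[OF \<alpha> \<gamma> b supp]
  have b0: "0 \<le> b" using b[of 0] by linarith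
  have F_eq: "?F n p = (disc_coeff \<alpha> n)\<^sup>2 * (sqrad (fst p) * sqrad (snd p)) ^ n * ?G p" for n p
    by (simp add: power2_eq_square power_mult_distrib mult_ac)
  have q: "0 \<le> sqrad u * sqrad v" "sqrad u * sqrad v < 1" for u v
    using mult_strict_mono[OF sqrad_less_one[of u] sqrad_less_one[of v]] by simp_all
  have lim: "(\<lambda>n. ?F n p) sums (square_series \<alpha> (sqrad (fst p) * sqrad (snd p)) * ?G p)" for p
    unfolding F_eq square_series_def by (intro sums_mult2 summable_sums summable_square_series \<alpha> q)
  have abs: "summable (\<lambda>n. norm (?F n p))" for p
  proof -
    have "norm (?F n p) = (disc_coeff \<alpha> n)\<^sup>2 * (sqrad (fst p) * sqrad (snd p)) ^ n * \<bar>?G p\<bar>" for n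
      unfolding F_eq using q by (simp add: abs_mult)
    then show ?thesis by (simp only:) (intro summable_mult2 summable_square_series \<alpha> q)
  qed
  have F: "has_bochner_integral lborel (?F n) ((\<integral>u. ?f n u \<partial>lborel) * (\<integral>u. ?f n u \<partial>lborel))" for n
    by (intro has_bochner_integral_lborel_prod cpt(1))
  have absF: "(\<integral>p. norm (?F n p) \<partial>(lborel :: (real \<times> real) measure)) \<le> b * (b * (disc_coeff \<alpha> n * sqrad U ^ n))" for n
  proof -
    have "has_bochner_integral (lborel :: (real \<times> real) measure) (\<lambda>p. \<bar>?f n (fst p)\<bar> * \<bar>?f n (snd p)\<bar>) ((\<integral>u. \<bar>?f n u\<bar> \<partial>lborel) * (\<integral>u. \<bar>?f n u\<bar> \<partial>lborel))"
      by (intro has_bochner_integral_lborel_prod integrable_abs cpt(1))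
    then have "(\<integral>p. norm (?F n p) \<partial>(lborel :: (real \<times> real) measure)) = (\<integral>u. \<bar>?f n u\<bar> \<partial>lborel) * (\<integral>u. \<bar>?f n u\<bar> \<partial>lborel)"
      by (simp only: has_bochner_integral_iff real_norm_def abs_mult)
    also have "\<dots> \<le> b * (b * (disc_coeff \<alpha> n * sqrad U ^ n))"
      by (intro mult_mono cpt(2) cpt(3) b0 Bochner_Integration.integral_nonneg abs_ge_zero)
    finally show ?thesis .
  qed
  have "(\<lambda>n. integral\<^sup>L lborel (?F n)) sums (\<integral>p. (\<Sum>n. ?F n p) \<partial>lborel)"
  proof (rule sums_integral)
    show "integrable lborel (?F n)" for n using F[of n] by (rule has_bochner_integral_iff[THEN iffD1, THEN conjunct1])
    show "AE p in lborel. summable (\<lambda>n. norm (?F n p))" using abs by (intro AE_I2)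
    have "summable (\<lambda>n. b * (b * (disc_coeff \<alpha> n * sqrad U ^ n)))" by (intro summable_mult summable_disc_coeff_sqrad)
    then show "summable (\<lambda>n. \<integral>p. norm (?F n p) \<partial>(lborel :: (real \<times> real) measure))"
      by (rule summable_comparison_test'[of _ 0]) (use absF in simp)
  qed
  moreover have "(\<Sum>n. ?F n p) = square_series \<alpha> (sqrad (fst p) * sqrad (snd p)) * ?G p" for p
    using sums_unique[OF lim] by simp
  moreover have "(\<integral>u. \<gamma> u \<partial>mode_law \<alpha> n)\<^sup>2 = integral\<^sup>L lborel (?F n)" for n
  proof -
    have "(\<integral>u. \<gamma> u \<partial>mode_law \<alpha> n) = integral\<^sup>L lborel (?f n)"
      by (subst integral_mode_law[OF \<alpha> \<gamma>]) simp
    then show ?thesis using F[of n] by (simp only: has_bochner_integral_iff power2_eq_square)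
  qed
  ultimately show ?thesis by (simp add: mult.assoc)
qed

section \<open>The scaling limit\<close>

lemma one_minus_sqrad: "1 - sqrad u = 4 * exp (- u) / (1 + exp (- u))\<^sup>2"
proof -
  have "1 - ((1 - E) / (1 + E))\<^sup>2 = 4 * E / (1 + E)\<^sup>2" if "1 + E \<noteq> 0" for E :: real
  proof -
    have "(1 + E)\<^sup>2 \<noteq> 0" using that by simp
    then have "1 - (1 - E)\<^sup>2 / (1 + E)\<^sup>2 = ((1 + E)\<^sup>2 - (1 - E)\<^sup>2) / (1 + E)\<^sup>2"
      by (simp only: diff_divide_distrib divide_self simp_thms if_False)
    also have "(1 + E)\<^sup>2 - (1 - E)\<^sup>2 = 4 * E" by (simp add: power2_eq_square algebra_simps)
    finally show ?thesis by (simp only: power_divide)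
  qed
  moreover have "1 + exp (- u) \<noteq> 0" using exp_gt_zero[of "- u"] by linarith
  moreover have "tanh (u / 2) = (1 - exp (- u)) / (1 + exp (- u))"
    using tanh_real_altdef[of "u / 2"] by simp
  ultimately show ?thesis by (simp only: sqrad_def)
qed

lemma one_minus_sqrad_bounds:
  assumes "0 \<le> u"
  shows "exp (- u) \<le> 1 - sqrad u" "1 - sqrad u \<le> 4 * exp (- u)"
proof -
  let ?E = "exp (- u)"
  have E: "0 < ?E" "?E \<le> 1" using assms by auto
  have "(1 + ?E)\<^sup>2 \<le> 2\<^sup>2" using E by (intro power_mono) auto
  moreover have "1 \<le> (1 + ?E)\<^sup>2" using E by (intro one_le_power) auto
  ultimately have q: "1 \<le> (1 + ?E)\<^sup>2" "(1 + ?E)\<^sup>2 \<le> 4" by auto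
  have "E \<le> 4 * E / Q \<and> 4 * E / Q \<le> 4 * E" if "0 < E" "1 \<le> Q" "Q \<le> 4" for E Q :: real
    using that by (simp add: field_simps)
  from this[OF E(1) q] show "?E \<le> 1 - sqrad u" "1 - sqrad u \<le> 4 * ?E"
    unfolding one_minus_sqrad by simp_all
qed

lemma tendsto_exp_one_minus_sqrad:
  "((\<lambda>R. exp R * (1 - sqrad (R + x))) \<longlongrightarrow> 4 * exp (- x)) at_top"
proof -
  have "exp R * (1 - sqrad (R + x)) = 4 * exp (- x) / (1 + exp (- x) * exp (- R))\<^sup>2" for R
  proof -
    have "exp R * exp (- (R + x)) = exp (- x)" by (simp add: exp_add[symmetric])
    moreover have "exp (- (R + x)) = exp (- x) * exp (- R)" by (simp add: exp_add[symmetric] add.commute)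
    ultimately show ?thesis unfolding one_minus_sqrad by (simp add: mult.left_commute mult.assoc)
  qed
  moreover have "((\<lambda>R::real. exp (- R)) \<longlongrightarrow> 0) at_top" by real_asymp
  then have "((\<lambda>R. 4 * exp (- x) / (1 + exp (- x) * exp (- R))\<^sup>2) \<longlongrightarrow> 4 * exp (- x) / (1 + exp (- x) * 0)\<^sup>2) at_top"
    by (intro tendsto_intros) auto
  ultimately show ?thesis by simp
qed

lemma tendsto_sqrad_shift: "((\<lambda>R. sqrad (R + x)) \<longlongrightarrow> 1) at_top"
proof (rule filterlim_compose[OF tendsto_sqrad_at_top])
  show "filterlim (\<lambda>R. R + x) at_top at_top" by real_asymp
qed

lemma tendsto_tanh_shift: "((\<lambda>R. tanh ((R + x) / 2)) \<longlongrightarrow> (1::real)) at_top"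
proof (rule filterlim_compose[OF tanh_real_at_top])
  show "filterlim (\<lambda>R. (R + x) / 2) at_top at_top" by real_asymp
qed

lemma sqrad_mult: "0 \<le> sqrad u * sqrad v" "sqrad u * sqrad v < 1"
  using mult_strict_mono[OF sqrad_less_one[of u] sqrad_less_one[of v]] by simp_all

text \<open>Powers of exp R are distributed so that every factor has a limit: the exponents -(2
  \<alpha> + 1), \<alpha> and \<alpha> add up to the -1 provided by 1 / \<open>scale_const\<close>.
  The 8 \<alpha> is \<alpha>^2 divided by \<alpha> / 8.\<close>

lemma scaled_kernel_eq:
  assumes \<alpha>: "\<alpha> > 0" and u: "0 \<le> u" and v: "0 \<le> v"
  defines "q \<equiv> sqrad u * sqrad v"
  shows "square_series \<alpha> q * modulus_density \<alpha> u * modulus_density \<alpha> v / scale_const \<alpha> R =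
    (square_series \<alpha> q * (1 - q) powr (2 * \<alpha> + 1)) * (exp R * (1 - q)) powr (- (2 * \<alpha> + 1)) *
    (8 * \<alpha> * tanh (u / 2) * tanh (v / 2)) * (exp R * (1 - sqrad u)) powr \<alpha> * (exp R * (1 - sqrad v)) powr \<alpha>"
proof -
  have q1: "1 - q > 0" using sqrad_mult[of u v] by (simp add: q_def)
  have a1: "(1 - q) powr (2 * \<alpha> + 1) * (1 - q) powr (- (2 * \<alpha> + 1)) = 1"
    using q1 by (subst powr_add[symmetric]) simp
  have a2: "exp R powr (- (2 * \<alpha> + 1)) * exp R powr \<alpha> * exp R powr \<alpha> = inverse (exp R)"
    unfolding powr_add[symmetric] by (simp add: powr_minus)
  have a3: "(exp R * (1 - q)) powr (- (2 * \<alpha> + 1)) = exp R powr (- (2 * \<alpha> + 1)) * (1 - q) powr (- (2 * \<alpha> + 1))"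
    by (rule powr_mult)
  have a4: "(exp R * (1 - sqrad u)) powr \<alpha> = exp R powr \<alpha> * (1 - sqrad u) powr \<alpha>"
    "(exp R * (1 - sqrad v)) powr \<alpha> = exp R powr \<alpha> * (1 - sqrad v) powr \<alpha>"
    by (rule powr_mult)+
  have "(square_series \<alpha> q * (1 - q) powr (2 * \<alpha> + 1)) * (exp R * (1 - q)) powr (- (2 * \<alpha> + 1)) *
    (8 * \<alpha> * tanh (u / 2) * tanh (v / 2)) * (exp R * (1 - sqrad u)) powr \<alpha> * (exp R * (1 - sqrad v)) powr \<alpha> =
    square_series \<alpha> q * (8 * \<alpha> * tanh (u / 2) * tanh (v / 2)) * (1 - sqrad u) powr \<alpha> * (1 - sqrad v) powr \<alpha> *
    ((1 - q) powr (2 * \<alpha> + 1) * (1 - q) powr (- (2 * \<alpha> + 1))) * (exp R powr (- (2 * \<alpha> + 1)) * exp R powr \<alpha> * exp R powr \<alpha>)"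
    unfolding a3 a4 by (simp only: mult_ac)
  also have "\<dots> = square_series \<alpha> q * (8 * \<alpha> * tanh (u / 2) * tanh (v / 2)) * (1 - sqrad u) powr \<alpha> * (1 - sqrad v) powr \<alpha> * inverse (exp R)"
    unfolding a1 a2 by (simp only: mult_1_right)
  also have "\<dots> = square_series \<alpha> q * modulus_density \<alpha> u * modulus_density \<alpha> v / scale_const \<alpha> R"
    using \<alpha> u v by (simp add: modulus_density_def scale_const_def field_simps)
  finally show ?thesis by simp
qed

lemma limit_constant_eq:
  fixes \<alpha> :: real
  assumes "\<alpha> > 0"
  shows "2 * \<alpha> * (Gamma (2 * \<alpha> + 1) / (Gamma (\<alpha> + 1))\<^sup>2) = 2 / Beta \<alpha> (\<alpha> + 1)"
proof -
  have "\<alpha> \<notin> \<int>\<^sub>\<le>\<^sub>0"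
  proof
    assume "\<alpha> \<in> \<int>\<^sub>\<le>\<^sub>0"
    then obtain n :: int where "\<alpha> = of_int n" "n \<le> 0" by (rule nonpos_Ints_cases)
    then have "\<alpha> \<le> 0" by simp
    with assms show False by simp
  qed
  then have "Gamma (\<alpha> + 1) = \<alpha> * Gamma \<alpha>" by (rule Gamma_plus1)
  moreover have "Gamma \<alpha> > 0" by (rule Gamma_real_pos[OF assms])
  moreover have "Gamma (2 * \<alpha> + 1) > 0" by (rule Gamma_real_pos) (use assms in simp)
  ultimately show ?thesis using assms
    by (simp add: Beta_def power2_eq_square mult_2[symmetric] add.assoc[symmetric])
qed

text \<open>As R grows, both squared radii tend to 1 at rate exp (-R), so
  \<open>square_series\<close> enters through its behaviour at 1 from the left and the other factors
  through elementary limits.\<close>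

lemma tendsto_scaled_kernel:
  assumes \<alpha>: "\<alpha> > 0"
  shows "((\<lambda>R. square_series \<alpha> (sqrad (R + x) * sqrad (R + y)) * modulus_density \<alpha> (R + x) * modulus_density \<alpha> (R + y) / scale_const \<alpha> R)
    \<longlongrightarrow> 2 / Beta \<alpha> (\<alpha> + 1) * limit_kernel \<alpha> x y) at_top"
proof -
  let ?l = "Gamma (2 * \<alpha> + 1) / (Gamma (\<alpha> + 1))\<^sup>2"
  let ?q = "\<lambda>R. sqrad (R + x) * sqrad (R + y)"
  have q1: "((\<lambda>R. ?q R) \<longlongrightarrow> 1 * 1) at_top" by (intro tendsto_mult tendsto_sqrad_shift)
  have "filterlim ?q (at_left 1) at_top"
    unfolding filterlim_at using q1 sqrad_mult by (auto intro!: always_eventually simp: less_imp_neq)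
  then have l1: "((\<lambda>R. square_series \<alpha> (?q R) * (1 - ?q R) powr (2 * \<alpha> + 1)) \<longlongrightarrow> ?l) at_top"
    by (rule filterlim_compose[OF tendsto_square_series[OF \<alpha>]])
  have l2: "((\<lambda>R. exp R * (1 - ?q R)) \<longlongrightarrow> 4 * exp (- x) + 1 * (4 * exp (- y))) at_top"
  proof -
    \<comment> \<open>From 1 - s t = (1 - s) + s (1 - t): the distances of the two factors from 1
      add up in the limit.\<close>
    have "exp R * (1 - ?q R) = exp R * (1 - sqrad (R + x)) + sqrad (R + x) * (exp R * (1 - sqrad (R + y)))" for R
      by (simp add: algebra_simps)
    then show ?thesis
      by (simp only:) (intro tendsto_add tendsto_mult tendsto_exp_one_minus_sqrad tendsto_sqrad_shift)
  qed
  have pos: "4 * exp (- x) + 1 * (4 * exp (- y)) > 0" by (simp add: add_pos_pos)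
  let ?L = "?l * (4 * exp (- x) + 1 * (4 * exp (- y))) powr (- (2 * \<alpha> + 1)) * (8 * \<alpha> * 1 * 1) * (4 * exp (- x)) powr \<alpha> * (4 * exp (- y)) powr \<alpha>"
  have lim: "((\<lambda>R. (square_series \<alpha> (?q R) * (1 - ?q R) powr (2 * \<alpha> + 1)) * (exp R * (1 - ?q R)) powr (- (2 * \<alpha> + 1)) *
    (8 * \<alpha> * tanh ((R + x) / 2) * tanh ((R + y) / 2)) * (exp R * (1 - sqrad (R + x))) powr \<alpha> * (exp R * (1 - sqrad (R + y))) powr \<alpha>) \<longlongrightarrow> ?L) at_top"
    using pos by (intro tendsto_mult l1 tendsto_powr l2 tendsto_const tendsto_tanh_shift tendsto_exp_one_minus_sqrad) auto
  \<comment> \<open>The powers of 4 combine to 1/4, which turns 8 \<alpha> into 2 \<alpha>, and exp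
    (-x) + exp (-y) is (exp x + exp y) exp (-(x + y)).\<close>
  have "?L = 2 * \<alpha> * ?l * limit_kernel \<alpha> x y"
  proof -
    have s: "4 * exp (- x) + 1 * (4 * exp (- y)) = 4 * ((exp x + exp y) * exp (- (x + y)))"
      by (simp add: exp_add[symmetric] distrib_right)
    have p: "exp x + exp y > 0" by (simp add: add_pos_pos)
    have P: "(4 * ((exp x + exp y) * exp (- (x + y)))) powr (- (2 * \<alpha> + 1)) =
      4 powr (- (2 * \<alpha> + 1)) * ((exp x + exp y) powr (- (2 * \<alpha> + 1)) * exp (- (x + y)) powr (- (2 * \<alpha> + 1)))"
      using p by (simp add: powr_mult)
    have E: "exp (- (x + y)) powr (- (2 * \<alpha> + 1)) * exp (- x) powr \<alpha> * exp (- y) powr \<alpha> = exp ((\<alpha> + 1) * (x + y))"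
      by (simp add: exp_powr_real exp_add[symmetric] algebra_simps)
    have F: "4 powr (- (2 * \<alpha> + 1)) * 4 powr \<alpha> * 4 powr \<alpha> = (1 / 4 :: real)"
      unfolding powr_add[symmetric] by (simp add: powr_minus_divide)
    have XY: "(4 * exp (- x)) powr \<alpha> = 4 powr \<alpha> * exp (- x) powr \<alpha>" "(4 * exp (- y)) powr \<alpha> = 4 powr \<alpha> * exp (- y) powr \<alpha>"
      by (simp_all add: powr_mult)
    have "?L = ?l * (8 * \<alpha>) * (4 powr (- (2 * \<alpha> + 1)) * 4 powr \<alpha> * 4 powr \<alpha>) *
      ((exp x + exp y) powr (- (2 * \<alpha> + 1)) * (exp (- (x + y)) powr (- (2 * \<alpha> + 1)) * exp (- x) powr \<alpha> * exp (- y) powr \<alpha>))"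
      unfolding s P XY by (simp only: mult_ac mult_1_left mult_1_right)
    also have "\<dots> = ?l * (8 * \<alpha>) * (1 / 4) * ((exp x + exp y) powr (- (2 * \<alpha> + 1)) * exp ((\<alpha> + 1) * (x + y)))"
      by (simp only: E F)
    also have "\<dots> = 2 * \<alpha> * ?l * limit_kernel \<alpha> x y"
      unfolding limit_kernel_def by (simp only: powr_minus_divide) simp
    finally show ?thesis .
  qed
  then have L: "?L = 2 / Beta \<alpha> (\<alpha> + 1) * limit_kernel \<alpha> x y" unfolding limit_constant_eq[OF \<alpha>] .
  have "eventually (\<lambda>R. (square_series \<alpha> (?q R) * (1 - ?q R) powr (2 * \<alpha> + 1)) * (exp R * (1 - ?q R)) powr (- (2 * \<alpha> + 1)) *
    (8 * \<alpha> * tanh ((R + x) / 2) * tanh ((R + y) / 2)) * (exp R * (1 - sqrad (R + x))) powr \<alpha> * (exp R * (1 - sqrad (R + y))) powr \<alpha> =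
    square_series \<alpha> (?q R) * modulus_density \<alpha> (R + x) * modulus_density \<alpha> (R + y) / scale_const \<alpha> R) at_top"
    using eventually_ge_at_top[of "\<bar>x\<bar> + \<bar>y\<bar>"]
  proof eventually_elim
    case (elim R)
    then show ?case by (intro scaled_kernel_eq[OF \<alpha>, symmetric]) auto
  qed
  from Lim_transform_eventually[OF lim this] show ?thesis unfolding L .
qed

lemma mult_mono_5:
  fixes a :: real
  assumes "a \<le> a'" "b \<le> b'" "c \<le> c'" "d \<le> d'" "e \<le> e'" "0 \<le> a" "0 \<le> b" "0 \<le> c" "0 \<le> d" "0 \<le> e"
  shows "a * b * c * d * e \<le> a' * b' * c' * d' * e'"
proof -
  have "0 \<le> a'" "0 \<le> b'" "0 \<le> c'" "0 \<le> d'" using assms by linarith+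
  then show ?thesis using assms by (intro mult_mono mult_nonneg_nonneg)
qed

text \<open>Each factor of \<open>scaled_kernel_eq\<close> is bounded uniformly for x and y in
  [-A, A]; A \<le> R keeps R + x and R + y nonnegative.\<close>

lemma scaled_kernel_bound:
  assumes \<alpha>: "\<alpha> > 0"
  obtains C where "\<And>R x y. A \<le> R \<Longrightarrow> \<bar>x\<bar> \<le> A \<Longrightarrow> \<bar>y\<bar> \<le> A \<Longrightarrow>
    \<bar>square_series \<alpha> (sqrad (R + x) * sqrad (R + y)) * modulus_density \<alpha> (R + x) * modulus_density \<alpha> (R + y) / scale_const \<alpha> R\<bar> \<le> C"
proof -
  obtain C0 where C0: "C0 > 0" "\<And>q. 0 \<le> q \<Longrightarrow> q < 1 \<Longrightarrow> square_series \<alpha> q * (1 - q) powr (2 * \<alpha> + 1) \<le> C0"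
    using square_series_bound[OF \<alpha>] by blast
  let ?C = "C0 * exp (- A) powr (- (2 * \<alpha> + 1)) * (8 * \<alpha> * 1 * 1) * (4 * exp A) powr \<alpha> * (4 * exp A) powr \<alpha>"
  show ?thesis
  proof (rule that[of ?C])
    fix R x y :: real assume R: "A \<le> R" and x: "\<bar>x\<bar> \<le> A" and y: "\<bar>y\<bar> \<le> A"
    let ?q = "sqrad (R + x) * sqrad (R + y)"
    have u: "0 \<le> R + x" "0 \<le> R + y" using R x y by linarith+
    have S0: "0 \<le> square_series \<alpha> ?q" by (rule square_series_nonneg[OF \<alpha> sqrad_mult])
    have bx: "exp R * (1 - sqrad (R + z)) \<le> 4 * exp A" "exp (- A) \<le> exp R * (1 - sqrad (R + z))"
      if z: "\<bar>z\<bar> \<le> A" for z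
    proof -
      have "0 \<le> R + z" using R z by linarith
      note b = one_minus_sqrad_bounds[OF this]
      have e: "exp R * exp (- (R + z)) = exp (- z)" by (simp add: exp_add[symmetric])
      have "exp R * (1 - sqrad (R + z)) \<le> exp R * (4 * exp (- (R + z)))" by (intro mult_left_mono b) auto
      also have "\<dots> = 4 * exp (- z)" using e by (simp add: mult.left_commute)
      also have "\<dots> \<le> 4 * exp A" using z by auto
      finally show "exp R * (1 - sqrad (R + z)) \<le> 4 * exp A" .
      have "exp (- A) \<le> exp (- z)" using z by auto
      also have "\<dots> = exp R * exp (- (R + z))" by (rule e[symmetric])
      also have "\<dots> \<le> exp R * (1 - sqrad (R + z))" by (intro mult_left_mono b) auto
      finally show "exp (- A) \<le> exp R * (1 - sqrad (R + z))" .
    qed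
    \<comment> \<open>The factor 1 - q has a negative exponent and needs a lower bound; q is at most
      its first factor, so 1 - q inherits the lower bound of that factor.\<close>
    have q: "exp (- A) \<le> exp R * (1 - ?q)"
    proof -
      have "?q \<le> sqrad (R + x) * 1" by (intro mult_left_mono less_imp_le[OF sqrad_less_one] sqrad_nonneg)
      then have "exp R * (1 - sqrad (R + x)) \<le> exp R * (1 - ?q)" by (intro mult_left_mono) auto
      with bx(2)[OF x] show ?thesis by linarith
    qed
    have "square_series \<alpha> ?q * modulus_density \<alpha> (R + x) * modulus_density \<alpha> (R + y) / scale_const \<alpha> R =
      (square_series \<alpha> ?q * (1 - ?q) powr (2 * \<alpha> + 1)) * (exp R * (1 - ?q)) powr (- (2 * \<alpha> + 1)) *
    (8 * \<alpha> * tanh ((R + x) / 2) * tanh ((R + y) / 2)) * (exp R * (1 - sqrad (R + x))) powr \<alpha> * (exp R * (1 - sqrad (R + y))) powr \<alpha>"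
      by (rule scaled_kernel_eq[OF \<alpha> u])
    also have "\<dots> \<le> ?C"
    proof (rule mult_mono_5)
      show "(exp R * (1 - ?q)) powr (- (2 * \<alpha> + 1)) \<le> exp (- A) powr (- (2 * \<alpha> + 1))"
        using \<alpha> q by (intro powr_mono2') auto
      have t: "0 \<le> tanh ((R + x) / 2)" "0 \<le> tanh ((R + y) / 2)" using u by simp_all
      have "tanh ((R + x) / 2) * tanh ((R + y) / 2) \<le> 1 * 1"
        using t by (intro mult_mono less_imp_le[OF tanh_real_lt_1]) auto
      then show "8 * \<alpha> * tanh ((R + x) / 2) * tanh ((R + y) / 2) \<le> 8 * \<alpha> * 1 * 1"
        using mult_left_mono[of _ _ "8 * \<alpha>"] \<alpha> by (simp add: mult.assoc)
      show "0 \<le> 8 * \<alpha> * tanh ((R + x) / 2) * tanh ((R + y) / 2)" using \<alpha> t by simp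
      show "square_series \<alpha> ?q * (1 - ?q) powr (2 * \<alpha> + 1) \<le> C0" by (rule C0(2)[OF sqrad_mult])
      show "0 \<le> square_series \<alpha> ?q * (1 - ?q) powr (2 * \<alpha> + 1)" using S0 by simp
      show "(exp R * (1 - sqrad (R + x))) powr \<alpha> \<le> (4 * exp A) powr \<alpha>"
        using \<alpha> bx(1)[OF x] by (intro powr_mono2) (auto simp: less_imp_le)
      show "(exp R * (1 - sqrad (R + y))) powr \<alpha> \<le> (4 * exp A) powr \<alpha>"
        using \<alpha> bx(1)[OF y] by (intro powr_mono2) (auto simp: less_imp_le)
    qed simp_all
    finally have "square_series \<alpha> ?q * modulus_density \<alpha> (R + x) * modulus_density \<alpha> (R + y) / scale_const \<alpha> R \<le> ?C" .
    moreover have "0 \<le> square_series \<alpha> ?q * modulus_density \<alpha> (R + x) * modulus_density \<alpha> (R + y) / scale_const \<alpha> R"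
      using S0 modulus_density_nonneg[OF \<alpha>] \<alpha> by (auto simp: scale_const_def)
    ultimately show "\<bar>square_series \<alpha> ?q * modulus_density \<alpha> (R + x) * modulus_density \<alpha> (R + y) / scale_const \<alpha> R\<bar> \<le> ?C"
      by simp
  qed
qed

section \<open>Mean and variance for a test function shifted by R\<close>

locale compact_test_function =
  fixes \<alpha> A B :: real and f :: "real \<Rightarrow> real"
  assumes \<alpha>: "\<alpha> > 0" and A: "0 \<le> A"
    and f_meas [measurable]: "f \<in> borel_measurable borel"
    and f_bound: "\<And>x. \<bar>f x\<bar> \<le> B"
    and f_supp: "\<And>x. A < \<bar>x\<bar> \<Longrightarrow> f x = 0"
begin

lemma B_nonneg: "0 \<le> B" using f_bound[of 0] by linarith

lemma f_sq_bound: "\<bar>(f x)\<^sup>2\<bar> \<le> B\<^sup>2"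
  using power_mono[OF f_bound[of x], of 2] by simp

lemma f_sq_supp: "A < \<bar>x\<bar> \<Longrightarrow> (f x)\<^sup>2 = 0"
  using f_supp[of x] by simp

end

lemma integrable_compact_mult_continuous:
  fixes \<gamma> h :: "real \<Rightarrow> real"
  assumes \<gamma> [measurable]: "\<gamma> \<in> borel_measurable borel" and b: "\<And>x. \<bar>\<gamma> x\<bar> \<le> b" and supp: "\<And>x. A < \<bar>x\<bar> \<Longrightarrow> \<gamma> x = 0"
    and h: "continuous_on UNIV h"
  shows "integrable lborel (\<lambda>x. \<gamma> x * h x)"
proof (rule Bochner_Integration.integrable_bound)
  have [measurable]: "h \<in> borel_measurable borel" using h by (rule borel_measurable_continuous_onI)
  show "(\<lambda>x. \<gamma> x * h x) \<in> borel_measurable lborel" by measurable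
  show "integrable lborel (\<lambda>x. indicator {- A..A} x *\<^sub>R (b * h x))"
    by (rule borel_integrable_compact) (auto intro!: continuous_intros continuous_on_subset[OF h])
  show "AE x in lborel. norm (\<gamma> x * h x) \<le> norm (indicator {- A..A} x *\<^sub>R (b * h x))"
  proof (rule AE_I2)
    fix x
    have b0: "0 \<le> b" using b[of 0] by linarith
    show "norm (\<gamma> x * h x) \<le> norm (indicator {- A..A} x *\<^sub>R (b * h x))"
    proof (cases "\<bar>x\<bar> \<le> A")
      case True
      then have "x \<in> {- A..A}" by auto
      then show ?thesis using mult_right_mono[OF b[of x], of "\<bar>h x\<bar>"] b0 by (simp add: abs_mult)
    qed (use supp[of x] in simp)
  qed
qed

text \<open>The two exponentials of sinh (R + x) give the two terms: \<alpha>/4 exp R is 2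
  \<open>scale_const\<close>, the other one is negligible. A \<le> R puts the shifted support in the
  half-line of moduli.\<close>

lemma intensity_integral_shift:
  fixes \<gamma> :: "real \<Rightarrow> real"
  assumes \<gamma>: "\<gamma> \<in> borel_measurable borel" and b: "\<And>x. \<bar>\<gamma> x\<bar> \<le> b" and supp: "\<And>x. A < \<bar>x\<bar> \<Longrightarrow> \<gamma> x = 0"
    and R: "A \<le> R"
  shows "(\<integral>u. indicator {0..} u * (\<alpha> / 2 * sinh u) * \<gamma> (u - R) \<partial>lborel) =
    2 * scale_const \<alpha> R * (\<integral>x. \<gamma> x * exp x \<partial>lborel) - \<alpha> / 4 * exp (- R) * (\<integral>x. \<gamma> x * exp (- x) \<partial>lborel)"
proof -
  have i: "integrable lborel (\<lambda>x. \<gamma> x * exp x)" "integrable lborel (\<lambda>x. \<gamma> x * exp (- x))"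
    by (rule integrable_compact_mult_continuous[OF \<gamma> b supp]; (assumption | intro continuous_intros))+
  have "(\<integral>u. indicator {0..} u * (\<alpha> / 2 * sinh u) * \<gamma> (u - R) \<partial>lborel) =
    (\<integral>x. indicator {0..} (R + x) * (\<alpha> / 2 * sinh (R + x)) * \<gamma> x \<partial>lborel)"
    by (subst lborel_integral_real_affine[where c = 1 and t = R]) simp_all
  also have "\<dots> = (\<integral>x. 2 * scale_const \<alpha> R * (\<gamma> x * exp x) - \<alpha> / 4 * exp (- R) * (\<gamma> x * exp (- x)) \<partial>lborel)"
  proof (rule Bochner_Integration.integral_cong[OF refl])
    fix x
    show "indicator {0..} (R + x) * (\<alpha> / 2 * sinh (R + x)) * \<gamma> x = 2 * scale_const \<alpha> R * (\<gamma> x * exp x) - \<alpha> / 4 * exp (- R) * (\<gamma> x * exp (- x))"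
    proof (cases "\<bar>x\<bar> \<le> A")
      case True
      then have "0 \<le> R + x" using R by linarith
      show ?thesis
      proof -
        have sh: "sinh (R + x) = (exp R * exp x - exp (- R) * exp (- x)) / 2"
          by (simp add: sinh_field_def exp_add[symmetric])
        show ?thesis unfolding sh using \<open>0 \<le> R + x\<close> by (simp add: scale_const_def field_simps)
      qed
    qed (use supp[of x] in simp)
  qed
  also have "\<dots> = 2 * scale_const \<alpha> R * (\<integral>x. \<gamma> x * exp x \<partial>lborel) - \<alpha> / 4 * exp (- R) * (\<integral>x. \<gamma> x * exp (- x) \<partial>lborel)"
    using i by simp
  finally show ?thesis .
qed

lemma integral_lborel_shift_pair:
  fixes G :: "real \<times> real \<Rightarrow> real"
  assumes G: "G \<in> borel_measurable borel"
  shows "(\<integral>p. G p \<partial>lborel) = (\<integral>p. G (R + fst p, R + snd p) \<partial>lborel)"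
proof -
  have "(\<integral>p. G p \<partial>lborel) = (\<integral>p. G p \<partial>distr lborel borel ((+) (R, R)))"
    by (simp only: lborel_distr_plus)
  also have "\<dots> = (\<integral>p. G ((R, R) + p) \<partial>lborel)"
    by (rule integral_distr) (simp_all add: G)
  finally show ?thesis by (simp add: plus_prod_def)
qed

lemma square_series_measurable [measurable]: "square_series \<alpha> \<in> borel_measurable borel"
  unfolding square_series_def by (intro borel_measurable_suminf) measurable

lemma has_bochner_integral_limit_kernel:
  assumes "\<alpha> > 0"
  shows "has_bochner_integral lborel (limit_kernel \<alpha> x) (Beta \<alpha> (\<alpha> + 1) * exp x)"
proof (rule has_bochner_integral_nn_integral)
  show "limit_kernel \<alpha> x \<in> borel_measurable lborel" using limit_kernel_measurable_snd by simp
  show "(\<integral>\<^sup>+y. ennreal (limit_kernel \<alpha> x y) \<partial>lborel) = ennreal (Beta \<alpha> (\<alpha> + 1) * exp x)"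
    by (rule nn_integral_limit_kernel[OF assms])
  have "0 < Beta \<alpha> (\<alpha> + 1)" unfolding Beta_def using assms by (intro divide_pos_pos mult_pos_pos Gamma_real_pos) auto
  then show "0 \<le> Beta \<alpha> (\<alpha> + 1) * exp x" by simp
qed (simp add: limit_kernel_nonneg)

context compact_test_function
begin

text \<open>Fubini: the weight depends on one variable only, and integrating out the other gives the
  Beta marginal.\<close>

lemma weighted_kernel_integral:
  fixes \<gamma> :: "real \<Rightarrow> real"
  assumes \<gamma> [measurable]: "\<gamma> \<in> borel_measurable borel" and b: "\<And>x. \<bar>\<gamma> x\<bar> \<le> b" and supp: "\<And>x. A < \<bar>x\<bar> \<Longrightarrow> \<gamma> x = 0"
  shows "integrable (lborel \<Otimes>\<^sub>M lborel) (\<lambda>p. \<gamma> (fst p) * limit_kernel \<alpha> (fst p) (snd p))"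
    and "(\<integral>p. \<gamma> (fst p) * limit_kernel \<alpha> (fst p) (snd p) \<partial>(lborel \<Otimes>\<^sub>M lborel)) = Beta \<alpha> (\<alpha> + 1) * (\<integral>x. \<gamma> x * exp x \<partial>lborel)"
proof -
  have k: "integrable lborel (limit_kernel \<alpha> x)" "integral\<^sup>L lborel (limit_kernel \<alpha> x) = Beta \<alpha> (\<alpha> + 1) * exp x" for x
    using has_bochner_integral_limit_kernel[OF \<alpha>, of x] by (simp_all add: has_bochner_integral_iff)
  have m: "(\<lambda>p. \<gamma> (fst p) * limit_kernel \<alpha> (fst p) (snd p)) \<in> borel_measurable (lborel \<Otimes>\<^sub>M lborel)"
    using limit_kernel_measurable[of \<alpha>] by (intro borel_measurable_times) (simp_all cong: measurable_cong_sets)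
  show i: "integrable (lborel \<Otimes>\<^sub>M lborel) (\<lambda>p. \<gamma> (fst p) * limit_kernel \<alpha> (fst p) (snd p))"
  proof (rule lborel_pair.Fubini_integrable[OF m])
    have "integrable lborel (\<lambda>x. Beta \<alpha> (\<alpha> + 1) * (\<bar>\<gamma> x\<bar> * exp x))"
      by (intro integrable_mult_right integrable_compact_mult_continuous[of _ b A] continuous_intros) (use b supp in auto)
    moreover have "(\<integral>y. norm (\<gamma> (fst (x, y)) * limit_kernel \<alpha> (fst (x, y)) (snd (x, y))) \<partial>lborel) = Beta \<alpha> (\<alpha> + 1) * (\<bar>\<gamma> x\<bar> * exp x)" for x
      by (simp add: abs_mult limit_kernel_nonneg k)
    ultimately show "integrable lborel (\<lambda>x. \<integral>y. norm (\<gamma> (fst (x, y)) * limit_kernel \<alpha> (fst (x, y)) (snd (x, y))) \<partial>lborel)"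
      by simp
    show "AE x in lborel. integrable lborel (\<lambda>y. \<gamma> (fst (x, y)) * limit_kernel \<alpha> (fst (x, y)) (snd (x, y)))"
      using k(1) by (intro AE_I2) simp
  qed
  show "(\<integral>p. \<gamma> (fst p) * limit_kernel \<alpha> (fst p) (snd p) \<partial>(lborel \<Otimes>\<^sub>M lborel)) = Beta \<alpha> (\<alpha> + 1) * (\<integral>x. \<gamma> x * exp x \<partial>lborel)"
  proof -
    have "(\<integral>p. \<gamma> (fst p) * limit_kernel \<alpha> (fst p) (snd p) \<partial>(lborel \<Otimes>\<^sub>M lborel)) = (\<integral>x. Beta \<alpha> (\<alpha> + 1) * (\<gamma> x * exp x) \<partial>lborel)"
      unfolding lborel_pair.integral_fst'[OF i, symmetric] by (intro Bochner_Integration.integral_cong refl) (simp add: k)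
    then show ?thesis by (simp only: integral_mult_right_zero)
  qed
qed

definition "cross_integral = (\<integral>p. f (fst p) * f (snd p) * limit_kernel \<alpha> (fst p) (snd p) \<partial>(lborel :: (real \<times> real) measure))"

text \<open>Expanding the square, each of the two pure terms equals Beta times \<integral> f^2 exp
  by symmetry and the marginal formula. This is the form in which the variance arises from the
  modes.\<close>

lemma limit_variance_eq:
  "limit_variance \<alpha> f = 2 * (\<integral>x. (f x)\<^sup>2 * exp x \<partial>lborel) - 2 / Beta \<alpha> (\<alpha> + 1) * cross_integral"
proof -
  let ?M = "lborel \<Otimes>\<^sub>M lborel :: (real \<times> real) measure"
  let ?k = "\<lambda>p. limit_kernel \<alpha> (fst p) (snd p)"
  have B0: "Beta \<alpha> (\<alpha> + 1) > 0"
    unfolding Beta_def using \<alpha> by (intro divide_pos_pos mult_pos_pos Gamma_real_pos) auto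
  have f2: "(\<lambda>x. (f x)\<^sup>2) \<in> borel_measurable borel" by measurable
  note wk = weighted_kernel_integral[OF f2 f_sq_bound f_sq_supp]
  have i1: "integrable ?M (\<lambda>p. (f (fst p))\<^sup>2 * ?k p)" by (rule wk(1))
  have sw: "(\<lambda>(x, y). (f (fst (y, x)))\<^sup>2 * ?k (y, x)) = (\<lambda>p. (f (snd p))\<^sup>2 * ?k p)"
    by (auto simp: fun_eq_iff limit_kernel_commute)
  have i2: "integrable ?M (\<lambda>p. (f (snd p))\<^sup>2 * ?k p)"
    using lborel_pair.integrable_product_swap[OF i1] unfolding sw .
  have e2: "integral\<^sup>L ?M (\<lambda>p. (f (snd p))\<^sup>2 * ?k p) = integral\<^sup>L ?M (\<lambda>p. (f (fst p))\<^sup>2 * ?k p)"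
    using lborel_pair.integral_product_swap[OF borel_measurable_integrable[OF i1]] unfolding sw .
  have m3: "(\<lambda>p. f (fst p) * f (snd p) * ?k p) \<in> borel_measurable ?M"
    using limit_kernel_measurable[of \<alpha>] by (intro borel_measurable_times) (simp_all cong: measurable_cong_sets)
  \<comment> \<open>The mixed term is dominated by the two square terms, since |a b| \<le> a^2 +
    b^2.\<close>
  have i3: "integrable ?M (\<lambda>p. f (fst p) * f (snd p) * ?k p)"
  proof (rule Bochner_Integration.integrable_bound[OF Bochner_Integration.integrable_add[OF i1 i2] m3])
    show "AE p in ?M. norm (f (fst p) * f (snd p) * ?k p) \<le> norm ((f (fst p))\<^sup>2 * ?k p + (f (snd p))\<^sup>2 * ?k p)"
    proof (rule AE_I2)
      fix p
      have "\<bar>a * b\<bar> \<le> a\<^sup>2 + b\<^sup>2" for a b :: real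
      proof -
        have "2 * \<bar>a\<bar> * \<bar>b\<bar> \<le> a\<^sup>2 + b\<^sup>2" using sum_squares_bound[of "\<bar>a\<bar>" "\<bar>b\<bar>"] by simp
        moreover have "0 \<le> \<bar>a\<bar> * \<bar>b\<bar>" by simp
        ultimately show ?thesis unfolding abs_mult by linarith
      qed
      then have "\<bar>f (fst p) * f (snd p)\<bar> * ?k p \<le> ((f (fst p))\<^sup>2 + (f (snd p))\<^sup>2) * ?k p"
        by (intro mult_right_mono limit_kernel_nonneg)
      then show "norm (f (fst p) * f (snd p) * ?k p) \<le> norm ((f (fst p))\<^sup>2 * ?k p + (f (snd p))\<^sup>2 * ?k p)"
        using limit_kernel_nonneg[of \<alpha> "fst p" "snd p"] by (simp add: abs_mult distrib_right)
    qed
  qed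
  have "(\<integral>(x, y). (f x - f y)\<^sup>2 * (exp ((\<alpha> + 1) * (x + y)) / (exp x + exp y) powr (2 * \<alpha> + 1)) \<partial>(lborel :: (real \<times> real) measure)) =
    (\<integral>p. ((f (fst p))\<^sup>2 * ?k p + (f (snd p))\<^sup>2 * ?k p) - 2 * (f (fst p) * f (snd p) * ?k p) \<partial>?M)"
    unfolding lborel_prod
  proof (intro Bochner_Integration.integral_cong refl)
    fix p :: "real \<times> real"
    obtain x y where p: "p = (x, y)" by fastforce
    have "(f x - f y)\<^sup>2 * limit_kernel \<alpha> x y = ((f x)\<^sup>2 * limit_kernel \<alpha> x y + (f y)\<^sup>2 * limit_kernel \<alpha> x y) - 2 * (f x * f y * limit_kernel \<alpha> x y)"
      by (simp add: power2_eq_square algebra_simps)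
    then show "(case p of (x, y) \<Rightarrow> (f x - f y)\<^sup>2 * (exp ((\<alpha> + 1) * (x + y)) / (exp x + exp y) powr (2 * \<alpha> + 1))) =
        ((f (fst p))\<^sup>2 * ?k p + (f (snd p))\<^sup>2 * ?k p) - 2 * (f (fst p) * f (snd p) * ?k p)"
      by (simp only: p prod.case fst_conv snd_conv limit_kernel_def)
  qed
  also have "\<dots> = 2 * integral\<^sup>L ?M (\<lambda>p. (f (fst p))\<^sup>2 * ?k p) - 2 * integral\<^sup>L ?M (\<lambda>p. f (fst p) * f (snd p) * ?k p)"
    using i1 i2 i3 e2 by simp
  also have "integral\<^sup>L ?M (\<lambda>p. (f (fst p))\<^sup>2 * ?k p) = Beta \<alpha> (\<alpha> + 1) * (\<integral>x. (f x)\<^sup>2 * exp x \<partial>lborel)"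
    by (rule wk(2))
  also have "integral\<^sup>L ?M (\<lambda>p. f (fst p) * f (snd p) * ?k p) = cross_integral"
    unfolding cross_integral_def lborel_prod ..
  finally show ?thesis
    unfolding limit_variance_def using B0 by (simp add: field_simps)
qed

text \<open>After translating both variables by R the domain is the fixed square [-A, A]^2, on which
  the rescaled kernel converges pointwise and boundedly.\<close>

lemma tendsto_cross:
  "((\<lambda>R. (\<integral>p. square_series \<alpha> (sqrad (fst p) * sqrad (snd p)) * (modulus_density \<alpha> (fst p) * f (fst p - R)) *
      (modulus_density \<alpha> (snd p) * f (snd p - R)) \<partial>(lborel :: (real \<times> real) measure)) / scale_const \<alpha> R)
    \<longlongrightarrow> 2 / Beta \<alpha> (\<alpha> + 1) * cross_integral) at_top"
proof -
  let ?H = "\<lambda>R p. square_series \<alpha> (sqrad (R + fst p) * sqrad (R + snd p)) * modulus_density \<alpha> (R + fst p) * modulus_density \<alpha> (R + snd p) / scale_const \<alpha> R"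
  let ?s = "\<lambda>R p. ?H R p * (f (fst p) * f (snd p))"
  let ?lim = "\<lambda>p. 2 / Beta \<alpha> (\<alpha> + 1) * limit_kernel \<alpha> (fst p) (snd p) * (f (fst p) * f (snd p))"
  obtain C where C: "\<And>R x y. A \<le> R \<Longrightarrow> \<bar>x\<bar> \<le> A \<Longrightarrow> \<bar>y\<bar> \<le> A \<Longrightarrow>
    \<bar>square_series \<alpha> (sqrad (R + x) * sqrad (R + y)) * modulus_density \<alpha> (R + x) * modulus_density \<alpha> (R + y) / scale_const \<alpha> R\<bar> \<le> C"
    using scaled_kernel_bound[OF \<alpha>, of A] by blast
  let ?w = "\<lambda>p :: real \<times> real. indicator ({- A..A} \<times> {- A..A}) p * (C * (B * B))"
  have "((\<lambda>R. \<integral>p. ?s R p \<partial>(lborel :: (real \<times> real) measure)) \<longlongrightarrow> (\<integral>p. ?lim p \<partial>lborel)) at_top"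
  proof (rule integral_dominated_convergence_at_top[where w = ?w])
    show "?lim \<in> borel_measurable lborel"
      unfolding lborel_prod[symmetric] using limit_kernel_measurable[of \<alpha>]
      by (intro borel_measurable_times) (simp_all cong: measurable_cong_sets)
    show "?s R \<in> borel_measurable lborel" for R
      unfolding lborel_prod[symmetric] by measurable
    have "emeasure (lborel :: (real \<times> real) measure) ({- A..A} \<times> {- A..A}) < \<infinity>"
      unfolding lborel_prod[symmetric] using A by (subst lborel.emeasure_pair_measure_Times) (auto simp: ennreal_mult_less_top)
    then show "integrable lborel ?w"
      by (intro integrable_mult_left integrable_real_indicator) (auto simp: lborel_prod[symmetric])
    show "AE p in lborel. ((\<lambda>R. ?s R p) \<longlongrightarrow> ?lim p) at_top"
      by (intro AE_I2 tendsto_mult tendsto_scaled_kernel[OF \<alpha>] tendsto_const)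
    show "\<forall>\<^sub>F R in at_top. AE p in lborel. norm (?s R p) \<le> ?w p"
      using eventually_ge_at_top[of A]
    proof eventually_elim
      case (elim R)
      show ?case
      proof (rule AE_I2)
        fix p :: "real \<times> real"
        show "norm (?s R p) \<le> ?w p"
        proof (cases "\<bar>fst p\<bar> \<le> A \<and> \<bar>snd p\<bar> \<le> A")
          case True
          then have "p \<in> {- A..A} \<times> {- A..A}" by (auto simp: mem_Times_iff)
          moreover have "\<bar>?H R p\<bar> * \<bar>f (fst p) * f (snd p)\<bar> \<le> C * (B * B)"
          proof (rule mult_mono)
            show H: "\<bar>?H R p\<bar> \<le> C" using True by (intro C[OF elim]) auto
            show "\<bar>f (fst p) * f (snd p)\<bar> \<le> B * B" unfolding abs_mult by (intro mult_mono f_bound B_nonneg abs_ge_zero)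
            show "0 \<le> C" using order_trans[OF abs_ge_zero H] .
          qed simp
          ultimately show ?thesis by (simp add: abs_mult)
        next
          case False
          then have zero: "f (fst p) * f (snd p) = 0" using f_supp[of "fst p"] f_supp[of "snd p"] by auto
          have "p \<notin> {- A..A} \<times> {- A..A}" using False by (auto simp: mem_Times_iff)
          then have "?w p = 0" by simp
          moreover note zero
          ultimately show ?thesis by (simp only: mult_zero_right norm_zero order_refl)
        qed
      qed
    qed
  qed
  moreover have "(\<integral>p. ?lim p \<partial>lborel) = 2 / Beta \<alpha> (\<alpha> + 1) * cross_integral"
    unfolding cross_integral_def integral_mult_right_zero[symmetric]
    by (intro Bochner_Integration.integral_cong refl) (simp add: mult_ac)
  moreover have "(\<integral>p. ?s R p \<partial>(lborel :: (real \<times> real) measure)) = (\<integral>p. square_series \<alpha> (sqrad (fst p) * sqrad (snd p)) * (modulus_density \<alpha> (fst p) * f (fst p - R)) *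
      (modulus_density \<alpha> (snd p) * f (snd p - R)) \<partial>(lborel :: (real \<times> real) measure)) / scale_const \<alpha> R" for R
  proof -
    let ?G = "\<lambda>p. square_series \<alpha> (sqrad (fst p) * sqrad (snd p)) * (modulus_density \<alpha> (fst p) * f (fst p - R)) *
      (modulus_density \<alpha> (snd p) * f (snd p - R))"
    have "?G \<in> borel_measurable borel" unfolding borel_prod[symmetric] by measurable
    from integral_lborel_shift_pair[OF this, of R]
    have "(\<integral>p. ?G p \<partial>lborel) / scale_const \<alpha> R = (\<integral>p. ?G (R + fst p, R + snd p) / scale_const \<alpha> R \<partial>lborel)"
      by simp
    also have "\<dots> = (\<integral>p. ?s R p \<partial>lborel)"
      by (intro Bochner_Integration.integral_cong refl) (simp add: mult_ac)
    finally show ?thesis by (rule sym)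
  qed
  ultimately show ?thesis by (simp only:)
qed

end

section \<open>Convergence in law\<close>

lemma sum_inj_tuples_1:
  fixes g :: "'a \<Rightarrow> complex"
  assumes "finite A"
  shows "(\<Sum>x\<in>inj_tuples 1 A. \<Prod>i<1. g (x i)) = (\<Sum>a\<in>A. g a)"
proof -
  have "{T. T \<subseteq> A \<and> card T = 1} = (\<lambda>a. {a}) ` A" by (auto simp: card_1_singleton_iff)
  then show ?thesis
    unfolding sum_inj_tuples[OF assms] by (simp add: sum.reindex)
qed

text \<open>The definition of the process asserts measurability of counts only. The sum is the case
  k = 1 of the factorial sums, which are limits of combinations of counts.\<close>

lemma (in radial_function) linear_statistic_measurable:
  fixes \<psi> :: "complex \<Rightarrow> real"
  assumes H: "hyperbolic_ensemble \<alpha> M X" and \<psi>: "\<psi> \<in> borel_measurable borel" and b: "\<And>z. \<bar>\<psi> z\<bar> \<le> b"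
  shows "(\<lambda>\<omega>. \<Sum>z\<in>X \<omega> \<inter> cball 0 r. \<psi> z) \<in> borel_measurable M"
proof -
  interpret W: determinantal_window M \<mu> "hyperbolic_kernel \<alpha>" X "cball 0 r" kernel_bound
    by (rule determinantal_window_cball[OF H])
  have "(\<lambda>z. complex_of_real (\<psi> z)) \<in> borel_measurable borel"
    by (rule measurable_compose[OF \<psi>]) (intro borel_measurable_continuous_onI continuous_intros)
  then have "integrable M (\<lambda>\<omega>. \<Sum>x\<in>inj_tuples 1 (X \<omega> \<inter> cball 0 r). \<Prod>i<1. complex_of_real (\<psi> (x i)))"
    by (rule W.factorial_moment(1)[where L = b]) (use b in simp)
  then have m: "(\<lambda>\<omega>. Re (\<Sum>x\<in>inj_tuples 1 (X \<omega> \<inter> cball 0 r). \<Prod>i<1. complex_of_real (\<psi> (x i)))) \<in> borel_measurable M"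
    by (intro borel_measurable_integrable integrable_Re)
  have eq: "Re (\<Sum>x\<in>inj_tuples 1 (X \<omega> \<inter> cball 0 r). \<Prod>i<1. complex_of_real (\<psi> (x i))) = (\<Sum>z\<in>X \<omega> \<inter> cball 0 r. \<psi> z)"
    if "\<omega> \<in> space M" for \<omega>
    unfolding sum_inj_tuples_1[OF finite_window[OF H that], of "\<lambda>z. complex_of_real (\<psi> z)"] by (simp add: Re_sum)
  from measurable_cong[OF eq] m show ?thesis by (rule iffD1)
qed

section \<open>Gaussian laws and the continuity theorem along a continuous parameter\<close>

lemma real_distribution_centered_gaussian:
  assumes "0 \<le> V" shows "real_distribution (centered_gaussian V)"
proof (cases "V = 0")
  case True
  interpret prob_space "return borel (0::real)" by (rule prob_space_return) simp
  show ?thesis using True by (simp add: centered_gaussian_def) (unfold_locales, simp)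
next
  case False
  with assms have "0 < sqrt V" by simp
  then interpret prob_space "density lborel (normal_density 0 (sqrt V))" by (rule prob_space_normal_density)
  show ?thesis using False by (simp add: centered_gaussian_def) (unfold_locales, simp)
qed

lemma char_centered_gaussian:
  assumes "0 \<le> V"
  shows "char (centered_gaussian V) \<theta> = exp (- (\<theta>\<^sup>2 * V / 2))"
proof (cases "V = 0")
  case True
  then show ?thesis by (simp add: centered_gaussian_def char_def integral_return)
next
  case False
  define \<sigma> where "\<sigma> = sqrt V"
  have \<sigma>: "\<sigma> > 0" "\<sigma>\<^sup>2 = V" using False assms by (auto simp: \<sigma>_def)
  have nd: "\<sigma> * normal_density 0 \<sigma> (\<sigma> * x) = std_normal_density x" for x
    using \<sigma>(1) by (simp add: normal_density_def std_normal_density_def power_mult_distrib real_sqrt_mult)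
  have m: "(\<lambda>x. iexp (t * x)) \<in> borel_measurable borel" for t
    by (intro borel_measurable_continuous_onI continuous_intros)
  have "char (centered_gaussian V) \<theta> = (\<integral>x. normal_density 0 \<sigma> x *\<^sub>R iexp (\<theta> * x) \<partial>lborel)"
    unfolding char_def centered_gaussian_def \<sigma>_def[symmetric] using False m
    by (simp only: if_False) (rule integral_density, simp_all)
  also have "\<dots> = \<bar>\<sigma>\<bar> *\<^sub>R (\<integral>x. normal_density 0 \<sigma> (0 + \<sigma> * x) *\<^sub>R iexp (\<theta> * (0 + \<sigma> * x)) \<partial>lborel)"
    by (rule lborel_integral_real_affine) (use \<sigma> in simp)
  also have "\<dots> = (\<integral>x. \<sigma> *\<^sub>R (normal_density 0 \<sigma> (\<sigma> * x) *\<^sub>R iexp (\<theta> * (\<sigma> * x))) \<partial>lborel)"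
    by (simp only: integral_scaleR_right abs_of_pos[OF \<sigma>(1)] add_0_left)
  also have "\<dots> = (\<integral>x. std_normal_density x *\<^sub>R iexp ((\<theta> * \<sigma>) * x) \<partial>lborel)"
    by (intro Bochner_Integration.integral_cong refl) (simp only: scaleR_scaleR nd mult.assoc)
  also have "\<dots> = char std_normal_distribution (\<theta> * \<sigma>)"
    unfolding char_def using m by (intro integral_density[symmetric]) simp_all
  also have "\<dots> = exp (- ((\<theta> * \<sigma>)\<^sup>2) / 2)"
    by (simp only: char_std_normal_distribution)
  also have "(\<theta> * \<sigma>)\<^sup>2 = \<theta>\<^sup>2 * V" by (simp add: power_mult_distrib \<sigma>)
  finally show ?thesis by simp
qed

text \<open>Convergence at infinity is convergence along every sequence tending to infinity, and
  along each of them Levy's continuity theorem applies.\<close>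

lemma weak_conv_along_at_top_charI:
  fixes Y :: "real \<Rightarrow> real measure"
  assumes Y: "\<And>R. real_distribution (Y R)" and L: "real_distribution L"
    and lim: "\<And>\<theta>. ((\<lambda>R. char (Y R) \<theta>) \<longlongrightarrow> char L \<theta>) at_top"
  shows "weak_conv_along Y L at_top"
  unfolding weak_conv_along_def
proof (intro allI impI)
  fix x assume x: "isCont (cdf L) x"
  show "((\<lambda>R. cdf (Y R) x) \<longlongrightarrow> cdf L x) at_top"
  proof (rule tendsto_at_topI_sequentially)
    fix X :: "nat \<Rightarrow> real" assume X: "filterlim X at_top sequentially"
    have "weak_conv_m (\<lambda>n. Y (X n)) L"
      by (rule levy_continuity[OF Y L filterlim_compose[OF lim X]])
    then show "(\<lambda>n. cdf (Y (X n)) x) \<longlonglongrightarrow> cdf L x"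
      using x by (simp add: weak_conv_m_def weak_conv_def)
  qed
qed

context compact_test_function
begin

text \<open>With |R| instead of R the window has nonnegative size for every real R, as is needed for
  measurability outside the asymptotic range.\<close>

lemma window: "window_statistic \<alpha> B (\<bar>R\<bar> + A) (\<lambda>u. f (u - R))"
proof
  show "f (u - R) = 0" if "\<bar>R\<bar> + A < u" for u using that by (intro f_supp) linarith
  show "(\<lambda>u. f (u - R)) \<in> borel_measurable borel" by measurable
qed (use \<alpha> A f_bound in auto)

definition "window_radius R = tanh ((\<bar>R\<bar> + A) / 2)"

definition "window_sum X R \<omega> = (\<Sum>z\<in>X \<omega> \<inter> cball 0 (window_radius R). f (hyperbolic_modulus z - R))"

text \<open>Points outside the window have modulus above |R| + A and contribute 0, so the infinite
  sum is finite. Configurations lie in the open disc, where the modulus is meaningful.\<close>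

lemma normalized_statistic_eq:
  assumes H: "hyperbolic_ensemble \<alpha> M X" and \<omega>: "\<omega> \<in> space M"
  shows "normalized_statistic \<alpha> f X R \<omega> = 1 / sqrt (scale_const \<alpha> R) * window_sum X R \<omega> - 2 * sqrt (scale_const \<alpha> R) * (\<integral>x. f x * exp x \<partial>lborel)"
proof -
  interpret W: window_statistic \<alpha> B "\<bar>R\<bar> + A" "\<lambda>u. f (u - R)" by (rule window)
  interpret R: radial_function \<alpha> W.radius 2 "W.char_fun 0" by (rule W.radial_function_char_fun)
  have rad: "W.radius = window_radius R" by (simp add: W.radius_def window_radius_def)
  have sub: "X \<omega> \<subseteq> ball 0 1"
    using H \<omega> by (auto simp: hyperbolic_ensemble_def determinantal_process_def simple_point_process_def)
  have "(\<Sum>\<^sub>\<infinity>z\<in>X \<omega>. f (hyperbolic_modulus z - R)) = (\<Sum>\<^sub>\<infinity>z\<in>X \<omega> \<inter> cball 0 (window_radius R). f (hyperbolic_modulus z - R))"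
  proof (rule infsum_cong_neutral)
    fix z assume z: "z \<in> X \<omega> - (X \<omega> \<inter> cball 0 (window_radius R))"
    then have "norm z < 1" using sub by auto
    then have "\<not> hyperbolic_modulus z \<le> \<bar>R\<bar> + A"
      using z by (subst hyperbolic_modulus_le_iff) (auto simp: window_radius_def)
    then show "f (hyperbolic_modulus z - R) = 0" by (intro f_supp) linarith
  qed auto
  also have "\<dots> = window_sum X R \<omega>"
    unfolding window_sum_def by (rule infsum_finite) (use R.finite_window[OF H \<omega>] rad in simp)
  finally show ?thesis by (simp add: normalized_statistic_def)
qed

lemma normalized_statistic_measurable:
  assumes H: "hyperbolic_ensemble \<alpha> M X"
  shows "normalized_statistic \<alpha> f X R \<in> borel_measurable M"
proof -
  interpret W: window_statistic \<alpha> B "\<bar>R\<bar> + A" "\<lambda>u. f (u - R)" by (rule window)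
  interpret R: radial_function \<alpha> W.radius 2 "W.char_fun 0" by (rule W.radial_function_char_fun)
  have rad: "W.radius = window_radius R" by (simp add: W.radius_def window_radius_def)
  have "(\<lambda>z. f (hyperbolic_modulus z - R)) \<in> borel_measurable borel"
    by (rule measurable_compose[OF hyperbolic_modulus_measurable W.\<phi>_meas])
  then have "window_sum X R \<in> borel_measurable M"
    unfolding window_sum_def[abs_def] rad[symmetric] by (rule R.linear_statistic_measurable[OF H]) (rule f_bound)
  then have "(\<lambda>\<omega>. 1 / sqrt (scale_const \<alpha> R) * window_sum X R \<omega> - 2 * sqrt (scale_const \<alpha> R) * (\<integral>x. f x * exp x \<partial>lborel)) \<in> borel_measurable M"
    by (intro borel_measurable_diff borel_measurable_times borel_measurable_const)
  then show ?thesis by (subst measurable_cong[OF normalized_statistic_eq[OF H]])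
qed

lemma limit_variance_nonneg: "0 \<le> limit_variance \<alpha> f"
proof -
  have "Beta \<alpha> (\<alpha> + 1) > 0"
    unfolding Beta_def using \<alpha> by (intro divide_pos_pos mult_pos_pos Gamma_real_pos) auto
  then show ?thesis
    unfolding limit_variance_def by (intro mult_nonneg_nonneg Bochner_Integration.integral_nonneg) auto
qed

text \<open>For A \<le> R, the amount by which the centring in the theorem exceeds the sum of the
  mode means: the decaying half of sinh.\<close>

definition "mean_error R = \<alpha> / 4 * exp (- R) * (\<integral>x. f x * exp (- x) \<partial>lborel)"

text \<open>For A \<le> R this is the sum of the mode variances: second moments first, then the sum
  of the squared means.\<close>

definition "window_variance R = (2 * scale_const \<alpha> R * (\<integral>x. (f x)\<^sup>2 * exp x \<partial>lborel) - \<alpha> / 4 * exp (- R) * (\<integral>x. (f x)\<^sup>2 * exp (- x) \<partial>lborel)) -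
  (\<integral>p. square_series \<alpha> (sqrad (fst p) * sqrad (snd p)) * (modulus_density \<alpha> (fst p) * f (fst p - R)) *
      (modulus_density \<alpha> (snd p) * f (snd p - R)) \<partial>(lborel :: (real \<times> real) measure))"

lemma window_characteristic_bound:
  assumes H: "hyperbolic_ensemble \<alpha> M X" and R: "A \<le> R"
  shows "norm ((\<integral>\<omega>. iexp (\<tau> * window_sum X R \<omega>) \<partial>M) * iexp (- \<tau> * (2 * scale_const \<alpha> R * (\<integral>x. f x * exp x \<partial>lborel) - mean_error R)) - exp (- (\<tau>\<^sup>2 * window_variance R / 2)))
    \<le> (\<bar>\<tau>\<bar> ^ 3 * B / 3 + \<tau> ^ 4 * B\<^sup>2 / 2) * window_variance R"
proof -
  interpret W: window_statistic \<alpha> B "\<bar>R\<bar> + A" "\<lambda>u. f (u - R)" by (rule window)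
  have rad: "W.radius = window_radius R" by (simp add: W.radius_def window_radius_def)
  have sup: "f (u - R) = 0" "(f (u - R))\<^sup>2 = 0" if "\<bar>R\<bar> + A < u" for u using W.\<phi>_supp[OF that] by auto
  have f2: "(\<lambda>x. (f x)\<^sup>2) \<in> borel_measurable borel" "(\<lambda>u. (f (u - R))\<^sup>2) \<in> borel_measurable borel" by measurable
  have 1: "W.mode_mean sums (2 * scale_const \<alpha> R * (\<integral>x. f x * exp x \<partial>lborel) - mean_error R)"
    using mode_integral_sums[OF \<alpha> W.\<phi>_meas f_bound sup(1)] intensity_integral_shift[OF f_meas f_bound f_supp R, of \<alpha>]
    unfolding W.mode_mean_def[abs_def] mean_error_def by (simp only:)
  have 2: "W.mode_second sums (2 * scale_const \<alpha> R * (\<integral>x. (f x)\<^sup>2 * exp x \<partial>lborel) - \<alpha> / 4 * exp (- R) * (\<integral>x. (f x)\<^sup>2 * exp (- x) \<partial>lborel))"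
    using mode_integral_sums[OF \<alpha> f2(2) f_sq_bound sup(2)] intensity_integral_shift[OF f2(1) f_sq_bound f_sq_supp R, of \<alpha>]
    unfolding W.mode_second_def[abs_def] by (simp only:)
  have 3: "(\<lambda>n. (W.mode_mean n)\<^sup>2) sums (\<integral>p. square_series \<alpha> (sqrad (fst p) * sqrad (snd p)) * (modulus_density \<alpha> (fst p) * f (fst p - R)) *
      (modulus_density \<alpha> (snd p) * f (snd p - R)) \<partial>(lborel :: (real \<times> real) measure))"
    unfolding W.mode_mean_def by (rule mode_square_sums[OF \<alpha> W.\<phi>_meas f_bound sup(1)])
  have 4: "(\<lambda>n. W.mode_second n - (W.mode_mean n)\<^sup>2) sums window_variance R"
    unfolding window_variance_def by (rule sums_diff[OF 2 3])
  show ?thesis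
    using W.characteristic_function_bound[OF H 1 4, of \<tau>] unfolding window_sum_def rad .
qed

text \<open>The decaying half of sinh leaves a term of relative size 2 exp (-2 R); the rest is the
  diagonal term minus the limit of the cross term.\<close>

lemma tendsto_window_variance: "((\<lambda>R. window_variance R / scale_const \<alpha> R) \<longlongrightarrow> limit_variance \<alpha> f) at_top"
proof -
  let ?I = "\<integral>x. (f x)\<^sup>2 * exp x \<partial>lborel" and ?J = "\<integral>x. (f x)\<^sup>2 * exp (- x) \<partial>lborel"
  let ?c = "\<lambda>R. (\<integral>p. square_series \<alpha> (sqrad (fst p) * sqrad (snd p)) * (modulus_density \<alpha> (fst p) * f (fst p - R)) *
      (modulus_density \<alpha> (snd p) * f (snd p - R)) \<partial>(lborel :: (real \<times> real) measure)) / scale_const \<alpha> R"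
  have "((\<lambda>R::real. exp (- 2 * R)) \<longlongrightarrow> 0) at_top" by real_asymp
  then have "((\<lambda>R. 2 * ?I - 2 * exp (- 2 * R) * ?J - ?c R) \<longlongrightarrow> 2 * ?I - 2 * 0 * ?J - 2 / Beta \<alpha> (\<alpha> + 1) * cross_integral) at_top"
    by (intro tendsto_diff tendsto_mult tendsto_const tendsto_cross)
  moreover have "window_variance R / scale_const \<alpha> R = 2 * ?I - 2 * exp (- 2 * R) * ?J - ?c R" for R
  proof -
    have "exp (- R) = exp (- 2 * R) * exp R" by (simp add: exp_add[symmetric])
    then have eq: "\<alpha> / 4 * exp (- R) * ?J = (2 * exp (- 2 * R) * ?J) * scale_const \<alpha> R"
      by (simp add: scale_const_def)
    have "scale_const \<alpha> R \<noteq> 0" using \<alpha> by (simp add: scale_const_def)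
    then show ?thesis unfolding window_variance_def eq by (simp add: diff_divide_distrib)
  qed
  ultimately show ?thesis by (simp add: limit_variance_eq)
qed

text \<open>With \<tau> = \<theta> / sqrt C the error is |\<tau>|^3 and \<tau>^4 times a variance of
  order C, hence tends to 0, while \<tau>^2 times the variance converges. The remaining centring
  error only contributes a phase tending to 1.\<close>

lemma tendsto_char_normalized_statistic:
  assumes H: "hyperbolic_ensemble \<alpha> M X"
  shows "((\<lambda>R. char (distr M borel (normalized_statistic \<alpha> f X R)) \<theta>) \<longlongrightarrow> exp (- (\<theta>\<^sup>2 * limit_variance \<alpha> f / 2))) at_top"
proof -
  let ?C = "scale_const \<alpha>"
  let ?\<tau> = "\<lambda>R. \<theta> / sqrt (?C R)"
  let ?I = "\<integral>x. f x * exp x \<partial>lborel"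
  let ?E = "\<lambda>R. \<integral>\<omega>. iexp (?\<tau> R * window_sum X R \<omega>) \<partial>M"
  let ?m = "\<lambda>R. 2 * ?C R * ?I - mean_error R"
  let ?q = "\<lambda>R. window_variance R / ?C R"
  have C: "?C R > 0" for R using \<alpha> by (simp add: scale_const_def)
  have char_eq: "char (distr M borel (normalized_statistic \<alpha> f X R)) \<theta> = ?E R * iexp (- ?\<tau> R * ?m R) * iexp (- (?\<tau> R * mean_error R))" for R
  proof -
    have "char (distr M borel (normalized_statistic \<alpha> f X R)) \<theta> = (\<integral>\<omega>. iexp (\<theta> * normalized_statistic \<alpha> f X R \<omega>) \<partial>M)"
      unfolding char_def using normalized_statistic_measurable[OF H]
      by (rule integral_distr) (intro borel_measurable_continuous_onI continuous_intros)
    also have "\<dots> = (\<integral>\<omega>. iexp (?\<tau> R * window_sum X R \<omega>) * (iexp (- ?\<tau> R * ?m R) * iexp (- (?\<tau> R * mean_error R))) \<partial>M)"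
    proof (rule Bochner_Integration.integral_cong[OF refl])
      fix \<omega> assume \<omega>: "\<omega> \<in> space M"
      have "\<theta> / s * c = \<theta> * s" if "s * s = c" "s \<noteq> 0" for s c :: real
        using that(2) unfolding that(1)[symmetric] by simp
      moreover have "sqrt (?C R) * sqrt (?C R) = ?C R" "sqrt (?C R) \<noteq> 0"
        using C[of R] by (simp_all only: real_sqrt_mult_self abs_of_pos real_sqrt_eq_0_iff less_imp_neq[symmetric] not_False_eq_True)
      ultimately have "?\<tau> R * ?C R = \<theta> * sqrt (?C R)" by blast
      then have "?\<tau> R * (2 * ?C R * ?I) = \<theta> * (2 * sqrt (?C R) * ?I)" by (metis mult.assoc mult.left_commute)
      then have "\<theta> * normalized_statistic \<alpha> f X R \<omega> = ?\<tau> R * window_sum X R \<omega> + (- ?\<tau> R * ?m R + - (?\<tau> R * mean_error R))"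
        unfolding normalized_statistic_eq[OF H \<omega>] by (simp add: algebra_simps)
      then show "iexp (\<theta> * normalized_statistic \<alpha> f X R \<omega>) = iexp (?\<tau> R * window_sum X R \<omega>) * (iexp (- ?\<tau> R * ?m R) * iexp (- (?\<tau> R * mean_error R)))"
        by (simp only: of_real_add distrib_left exp_add)
    qed
    also have "\<dots> = ?E R * (iexp (- ?\<tau> R * ?m R) * iexp (- (?\<tau> R * mean_error R)))"
      by (rule integral_mult_left_zero)
    finally show ?thesis by (simp only: mult.assoc)
  qed
  have sqrt_inf: "((\<lambda>R. 1 / sqrt (?C R)) \<longlongrightarrow> 0) at_top"
    unfolding scale_const_def using \<alpha> by real_asymp
  have bound: "norm (?E R * iexp (- ?\<tau> R * ?m R) - exp (- (\<theta>\<^sup>2 * ?q R / 2))) \<le>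
      (\<bar>\<theta>\<bar> ^ 3 * B / 3 * (1 / sqrt (?C R)) + \<theta> ^ 4 * B\<^sup>2 / 2 * (1 / sqrt (?C R))\<^sup>2) * ?q R" if R: "A \<le> R" for R
  proof -
    have s: "(sqrt (?C R))\<^sup>2 = ?C R" using C[of R] by simp
    have t2: "(?\<tau> R)\<^sup>2 * window_variance R = \<theta>\<^sup>2 * ?q R" by (simp add: power_divide s)
    have s3: "sqrt (?C R) ^ 3 = ?C R * sqrt (?C R)" by (simp only: power3_eq_cube s[unfolded power2_eq_square])
    have t3: "\<bar>?\<tau> R\<bar> ^ 3 = \<bar>\<theta>\<bar> ^ 3 * (1 / sqrt (?C R)) / ?C R"
      using C[of R] by (simp add: power_divide s3 abs_divide mult.commute)
    have s4: "sqrt (?C R) ^ 4 = (?C R) * (sqrt (?C R))\<^sup>2"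
      by (metis power_even_abs_numeral power4_eq_xxxx power2_eq_square s mult.assoc)
    have t4: "(?\<tau> R) ^ 4 = \<theta> ^ 4 * (1 / sqrt (?C R))\<^sup>2 / ?C R"
      by (simp add: power_divide s4 mult.commute)
    have "(\<bar>?\<tau> R\<bar> ^ 3 * B / 3 + (?\<tau> R) ^ 4 * B\<^sup>2 / 2) * window_variance R =
      (\<bar>\<theta>\<bar> ^ 3 * B / 3 * (1 / sqrt (?C R)) + \<theta> ^ 4 * B\<^sup>2 / 2 * (1 / sqrt (?C R))\<^sup>2) * ?q R"
      unfolding t3 t4 by (simp add: algebra_simps)
    then show ?thesis
      using window_characteristic_bound[OF H R, of "?\<tau> R"] unfolding t2 by (simp only:)
  qed
  have "((\<lambda>R. (\<bar>\<theta>\<bar> ^ 3 * B / 3 * (1 / sqrt (?C R)) + \<theta> ^ 4 * B\<^sup>2 / 2 * (1 / sqrt (?C R))\<^sup>2) * ?q R) \<longlongrightarrow>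
      (\<bar>\<theta>\<bar> ^ 3 * B / 3 * 0 + \<theta> ^ 4 * B\<^sup>2 / 2 * 0\<^sup>2) * limit_variance \<alpha> f) at_top"
    by (intro tendsto_mult tendsto_add tendsto_power tendsto_const sqrt_inf tendsto_window_variance)
  then have rhs0: "((\<lambda>R. (\<bar>\<theta>\<bar> ^ 3 * B / 3 * (1 / sqrt (?C R)) + \<theta> ^ 4 * B\<^sup>2 / 2 * (1 / sqrt (?C R))\<^sup>2) * ?q R) \<longlongrightarrow> 0) at_top"
    by simp
  have "((\<lambda>R. ?E R * iexp (- ?\<tau> R * ?m R) - exp (- (\<theta>\<^sup>2 * ?q R / 2))) \<longlongrightarrow> 0) at_top"
    by (rule Lim_null_comparison[OF eventually_mono[OF eventually_ge_at_top[of A] bound] rhs0])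
  moreover have "((\<lambda>R. complex_of_real (exp (- (\<theta>\<^sup>2 * ?q R / 2)))) \<longlongrightarrow> exp (- (\<theta>\<^sup>2 * limit_variance \<alpha> f / 2))) at_top"
    by (intro tendsto_of_real tendsto_exp tendsto_minus tendsto_divide tendsto_mult tendsto_const tendsto_window_variance) simp
  ultimately have main: "((\<lambda>R. ?E R * iexp (- ?\<tau> R * ?m R)) \<longlongrightarrow> exp (- (\<theta>\<^sup>2 * limit_variance \<alpha> f / 2))) at_top"
    using tendsto_add by fastforce
  have "((\<lambda>R. mean_error R) \<longlongrightarrow> \<alpha> / 4 * 0 * (\<integral>x. f x * exp (- x) \<partial>lborel)) at_top"
    unfolding mean_error_def by (intro tendsto_mult tendsto_const) real_asymp
  then have "((\<lambda>R. \<theta> * (1 / sqrt (?C R)) * mean_error R) \<longlongrightarrow> \<theta> * 0 * (\<alpha> / 4 * 0 * (\<integral>x. f x * exp (- x) \<partial>lborel))) at_top"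
    by (intro tendsto_mult tendsto_const sqrt_inf)
  then have "((\<lambda>R. iexp (- (\<theta> * (1 / sqrt (?C R)) * mean_error R))) \<longlongrightarrow> iexp (- (\<theta> * 0 * (\<alpha> / 4 * 0 * (\<integral>x. f x * exp (- x) \<partial>lborel))))) at_top"
    by (rule tendsto_exp[OF tendsto_mult[OF tendsto_const tendsto_of_real[OF tendsto_minus]]])
  then have "((\<lambda>R. iexp (- (?\<tau> R * mean_error R))) \<longlongrightarrow> 1) at_top" by simp
  from tendsto_mult[OF main this] show ?thesis unfolding char_eq by simp
qed

end

theorem theorem1p1:
  fixes \<alpha> :: real and M :: "'w measure" and H :: "'w \<Rightarrow> complex set" and f :: "real \<Rightarrow> real"
  assumes "\<alpha> > 0"
    and "hyperbolic_ensemble \<alpha> M H"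
    and "f \<in> borel_measurable borel"
    and "bounded (range f)"
    and "compact (closure {x. f x \<noteq> 0})"
  shows "weak_conv_along (\<lambda>R. distr M borel (normalized_statistic \<alpha> f H R))
           (centered_gaussian (limit_variance \<alpha> f)) at_top"
proof -
  obtain B where B: "\<And>x. \<bar>f x\<bar> \<le> B" using assms(4) by (auto simp: bounded_iff)
  have "bounded {x. f x \<noteq> 0}"
    using compact_imp_bounded[OF assms(5)] closure_subset bounded_subset by blast
  then obtain A where A: "A > 0" "\<And>x. f x \<noteq> 0 \<Longrightarrow> \<bar>x\<bar> \<le> A" by (auto simp: bounded_pos)
  interpret compact_test_function \<alpha> A B f
    by standard (use assms A B in \<open>force+\<close>)
  interpret prob_space M
    using assms(2) by (simp add: hyperbolic_ensemble_def determinantal_process_def simple_point_process_def)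
  show ?thesis
  proof (rule weak_conv_along_at_top_charI)
    show "real_distribution (distr M borel (normalized_statistic \<alpha> f H R))" for R
      by (rule real_distribution_distr) (rule normalized_statistic_measurable[OF assms(2)])
    show "real_distribution (centered_gaussian (limit_variance \<alpha> f))"
      by (rule real_distribution_centered_gaussian[OF limit_variance_nonneg])
    show "((\<lambda>R. char (distr M borel (normalized_statistic \<alpha> f H R)) \<theta>) \<longlongrightarrow> char (centered_gaussian (limit_variance \<alpha> f)) \<theta>) at_top" for \<theta>
      using tendsto_char_normalized_statistic[OF assms(2)] char_centered_gaussian[OF limit_variance_nonneg] by simp
  qed
qed

end
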